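(* Let $(M,g)$ be a Riemannian manifold and let $F$ be a Lorentz force on $(M,g)$. For $i=0,\dots,l$ let $K_i\in\Gamma(\mathrm{Sym}^i\,TM)$ be a symmetric tensor, with associated function $\phi_i:TM\to\mathbb{R}$, $\phi_i(v):=\frac{1}{i!}K_i(v,\dots,v)$. Then $\phi:=\sum_{i=0}^l\phi_i$ is a first integral of the magnetic flow for $F$ if and only if $$d^sK_i=F_*K_{i+1}\qquad\text{for all } i=0,\dots,l,$$ with the convention $K_{l+1}\equiv 0$.
   Context: $\nabla$ denotes the Levi-Civita connection of $g$. A Lorentz force on $(M,g)$ is a skew-symmetric endomorphism $F$ of $TM$ such that the 2-form $\omega^F(X,Y):=g(FX,Y)$ is closed. A magnetic geodesic for $F$ is a curve $\gamma$ in $M$ with $\nabla_{\gamma'}\gamma'=F\gamma'$. A differentiable function $\Psi:TM\to\mathbb{R}$ is a first integral of the magnetic flow for $F$ if $t\mapsto\Psi(\gamma'(t))$ is constant for every magnetic geodesic $\gamma$. Symmetric tensors: the symmetric product is $v_1\cdots v_l:=\sum_{\sigma\in S_l}v_{\sigma(1)}\otimes\cdots\otimes v_{\sigma(l)}$, and $\mathrm{Sym}^l\,TM$ is spanned by such products. It carries the scalar product $g(v_1\cdots v_l,w_1\cdots w_l):=\sum_{\sigma\in S_l}g(v_1,w_{\sigma(1)})\cdots g(v_l,w_{\sigma(l)})$. A section $K$ of $\mathrm{Sym}^l\,TM$ is identified with the symmetric $l$-linear form $K(v_1,\dots,v_l):=g(K,v_1\cdots v_l)$. Sections of $\mathrm{Sym}^0\,TM$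 are functions on $M$ (so $\phi_0=K_0\circ\pi$, where $\pi:TM\to M$ is the projection). The symmetric differential is $d^s:\Gamma(\mathrm{Sym}^l\,TM)\to\Gamma(\mathrm{Sym}^{l+1}\,TM)$, $d^sK=\sum_i e_i\cdot\nabla_{e_i}K$, for any local orthonormal frame $\{e_i\}$. The extension of $F$ to symmetric tensors as a $C^\infty(M)$-linear derivation $F_*$ satisfies, for $l\ge1$ and $K\in\Gamma(\mathrm{Sym}^l\,TM)$, $(F_*K)(v,\dots,v)=-l\,K(Fv,v,\dots,v)$ for all $v$. *)

theory Defs
  imports "HOL-Analysis.Analysis" "HOL-Library.Multiset" "HOL-Combinatorics.Permutations"
begin

section \<open>Smooth maps and smooth manifolds\<close>

text \<open>\<open>C\<close>-k maps on an open subset of a normed space: the iterated directional derivatives of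
  order at most k exist and are continuous.\<close>

primrec Ck_on :: "nat \<Rightarrow> 'a::real_normed_vector set \<Rightarrow> ('a \<Rightarrow> 'b::real_normed_vector) \<Rightarrow> bool" where
  "Ck_on 0 S f \<longleftrightarrow> continuous_on S f"
| "Ck_on (Suc k) S f \<longleftrightarrow>
     (\<forall>x\<in>S. f differentiable at x) \<and> (\<forall>v. Ck_on k S (\<lambda>x. frechet_derivative f (at x) v))"

definition smooth_on :: "'a::real_normed_vector set \<Rightarrow> ('a \<Rightarrow> 'b::real_normed_vector) \<Rightarrow> bool" where
  "smooth_on S f \<longleftrightarrow> (\<forall>k. Ck_on k S f)"

text \<open>A chart is a pair of its domain and its coordinate map; the values of the coordinate map
  outside the domain are irrelevant.\<close>

type_synonym ('a, 'e) chart = "'a set \<times> ('a \<Rightarrow> 'e)"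

definition chart_range :: "('a, 'e) chart \<Rightarrow> 'e set" where
  "chart_range c = snd c ` fst c"

definition chart_inv :: "('a, 'e) chart \<Rightarrow> 'e \<Rightarrow> 'a" where
  "chart_inv c = inv_into (fst c) (snd c)"

definition points :: "('a, 'e) chart set \<Rightarrow> 'a set" where
  "points A = (\<Union>c\<in>A. fst c)"

definition charts_at :: "('a, 'e) chart set \<Rightarrow> 'a \<Rightarrow> ('a, 'e) chart set" where
  "charts_at A p = {c \<in> A. p \<in> fst c}"

definition smooth_manifold ::
    "'a topology \<Rightarrow> ('a, 'e::euclidean_space) chart set \<Rightarrow> bool" where
  "smooth_manifold X A \<longleftrightarrow>
     Hausdorff_space X \<and> second_countable X \<and> topspace X = points A \<and>
     (\<forall>c\<in>A. openin X (fst c) \<and> open (chart_range c) \<and>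
        homeomorphic_map (subtopology X (fst c)) (top_of_set (chart_range c)) (snd c)) \<and>
     (\<forall>c\<in>A. \<forall>d\<in>A. smooth_on (snd c ` (fst c \<inter> fst d)) (snd d \<circ> chart_inv c))"

section \<open>Tangent vectors\<close>

text \<open>A tangent vector at p is the family of its coordinate vectors in all charts around p, related
  by the derivatives of the coordinate changes. Entries at charts not containing p are set to zero,
  so that each tangent vector has a unique representation. Thus \<open>v c\<close> is the coordinate
  vector of \<open>v\<close> in the chart \<open>c\<close>.\<close>

type_synonym ('a, 'e) tvec = "('a, 'e) chart \<Rightarrow> 'e"

definition tangent_space ::
    "('a, 'e::euclidean_space) chart set \<Rightarrow> 'a \<Rightarrow> ('a, 'e) tvec set" where
  "tangent_space A p =
     {v. (\<forall>c\<in>charts_at A p. \<forall>d\<in>charts_at A p.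
            v d = frechet_derivative (snd d \<circ> chart_inv c) (at (snd c p)) (v c)) \<and>
         (\<forall>c. c \<notin> charts_at A p \<longrightarrow> v c = 0)}"

definition tcomb :: "real \<Rightarrow> ('a, 'e::euclidean_space) tvec \<Rightarrow> real \<Rightarrow> ('a, 'e) tvec \<Rightarrow> ('a, 'e) tvec" where
  "tcomb a v b w = (\<lambda>c. a *\<^sub>R v c + b *\<^sub>R w c)"

text \<open>The tangent vector at p with coordinate vector u in the chart c.\<close>

definition of_coords ::
    "('a, 'e::euclidean_space) chart set \<Rightarrow> ('a, 'e) chart \<Rightarrow> 'a \<Rightarrow> 'e \<Rightarrow> ('a, 'e) tvec" where
  "of_coords A c p u =
     (\<lambda>d. if d \<in> charts_at A p then frechet_derivative (snd d \<circ> chart_inv c) (at (snd c p)) u else 0)"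

text \<open>Differentiability of a function on the tangent bundle, in the bundle charts
  \<open>(y, u) \<mapsto> (c\<^sup>-\<^sup>1 y, of_coords u)\<close>.\<close>

definition differentiable_on_TM ::
    "('a, 'e::euclidean_space) chart set \<Rightarrow> ('a \<times> ('a, 'e) tvec \<Rightarrow> real) \<Rightarrow> bool" where
  "differentiable_on_TM A \<Psi> \<longleftrightarrow>
     (\<forall>c\<in>A. (\<lambda>(y, u). \<Psi> (chart_inv c y, of_coords A c (chart_inv c y) u))
               differentiable_on (chart_range c \<times> UNIV))"

section \<open>Symmetric tensor fields\<close>

text \<open>An element of \<open>Sym\<^sup>l T\<^sub>pM\<close> is represented by the symmetric l-linear form on \<open>T\<^sub>pM\<close> with which
  the metric identifies it; the argument tuples are lists of length l. Only the values on lists of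
  l tangent vectors at points of the manifold matter.\<close>

type_synonym ('a, 'e) tensor = "'a \<Rightarrow> ('a, 'e) tvec list \<Rightarrow> real"

definition tvecs :: "('a, 'e::euclidean_space) chart set \<Rightarrow> 'a \<Rightarrow> nat \<Rightarrow> ('a, 'e) tvec list set" where
  "tvecs A p l = {vs. length vs = l \<and> set vs \<subseteq> tangent_space A p}"

definition tensor_eq ::
    "('a, 'e::euclidean_space) chart set \<Rightarrow> nat \<Rightarrow> ('a, 'e) tensor \<Rightarrow> ('a, 'e) tensor \<Rightarrow> bool" where
  "tensor_eq A l S T \<longleftrightarrow> (\<forall>p\<in>points A. \<forall>vs\<in>tvecs A p l. S p vs = T p vs)"

text \<open>The coordinate expression of a tensor in a chart, as an l-linear form on the model space
  depending on a point \<open>y\<close> of the chart range.\<close>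

definition tensor_coords ::
    "('a, 'e::euclidean_space) chart set \<Rightarrow> ('a, 'e) tensor \<Rightarrow> ('a, 'e) chart \<Rightarrow> 'e \<Rightarrow> 'e list \<Rightarrow> real" where
  "tensor_coords A T c y us = T (chart_inv c y) (map (of_coords A c (chart_inv c y)) us)"

definition sym_multilinear_at ::
    "('a, 'e::euclidean_space) chart set \<Rightarrow> nat \<Rightarrow> ('a, 'e) tensor \<Rightarrow> 'a \<Rightarrow> bool" where
  "sym_multilinear_at A l T p \<longleftrightarrow>
     (\<forall>vs\<in>tvecs A p l. \<forall>ws. mset ws = mset vs \<longrightarrow> T p ws = T p vs) \<and>
     (\<forall>vs\<in>tvecs A p l. \<forall>j<l. \<forall>v\<in>tangent_space A p. \<forall>w\<in>tangent_space A p. \<forall>a b.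
        T p (vs[j := tcomb a v b w]) = a * T p (vs[j := v]) + b * T p (vs[j := w]))"

definition sym_tensor_field ::
    "('a, 'e::euclidean_space) chart set \<Rightarrow> nat \<Rightarrow> ('a, 'e) tensor \<Rightarrow> bool" where
  "sym_tensor_field A l T \<longleftrightarrow>
     (\<forall>p\<in>points A. sym_multilinear_at A l T p) \<and>
     (\<forall>c\<in>A. \<forall>us. length us = l \<longrightarrow> smooth_on (chart_range c) (\<lambda>y. tensor_coords A T c y us))"

text \<open>The function \<open>v \<mapsto> 1/l! K(v, \<dots>, v)\<close> on the tangent bundle.\<close>

definition assoc_fun :: "nat \<Rightarrow> ('a, 'e) tensor \<Rightarrow> 'a \<times> ('a, 'e) tvec \<Rightarrow> real" where
  "assoc_fun l K = (\<lambda>(p, v). K p (replicate l v) / fact l)"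

section \<open>Riemannian metrics and the Levi-Civita connection\<close>

type_synonym ('a, 'e) bilin_field = "'a \<Rightarrow> ('a, 'e) tvec \<Rightarrow> ('a, 'e) tvec \<Rightarrow> real"

definition bilin_coords ::
    "('a, 'e::euclidean_space) chart set \<Rightarrow> ('a, 'e) bilin_field \<Rightarrow> ('a, 'e) chart \<Rightarrow> 'e \<Rightarrow> 'e \<Rightarrow> 'e \<Rightarrow> real" where
  "bilin_coords A b c y u v =
     b (chart_inv c y) (of_coords A c (chart_inv c y) u) (of_coords A c (chart_inv c y) v)"

definition riemannian_metric ::
    "('a, 'e::euclidean_space) chart set \<Rightarrow> ('a, 'e) bilin_field \<Rightarrow> bool" where
  "riemannian_metric A g \<longleftrightarrow>
     sym_tensor_field A 2 (\<lambda>p vs. g p (vs ! 0) (vs ! 1)) \<and>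
     (\<forall>p\<in>points A. \<forall>v\<in>tangent_space A p. v \<noteq> (\<lambda>_. 0) \<longrightarrow> g p v v > 0)"

definition riemannian_manifold ::
    "'a topology \<Rightarrow> ('a, 'e::euclidean_space) chart set \<Rightarrow> ('a, 'e) bilin_field \<Rightarrow> bool" where
  "riemannian_manifold X A g \<longleftrightarrow> smooth_manifold X A \<and> riemannian_metric A g"

text \<open>In a chart the Levi-Civita connection is \<open>\<nabla>\<^sub>u Y = DY(u) + \<Gamma>(u, Y)\<close>. Vanishing torsion means
  that \<open>\<Gamma>\<close> is symmetric, and compatibility with \<open>g\<close> is
  \<open>D\<^sub>u g(v, w) = g(\<Gamma>(u, v), w) + g(v, \<Gamma>(u, w))\<close> for constant \<open>v, w\<close>. By the lemma these conditions determine
  \<open>\<Gamma>\<close> uniquely at each point, so the definite description below is proper.\<close>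

lemma torsion_free_metric_ex1:
  fixes B :: "'e::euclidean_space \<Rightarrow> 'e \<Rightarrow> real" and D :: "'e \<Rightarrow> 'e \<Rightarrow> 'e \<Rightarrow> real"
  assumes "bilinear B" and B_sym: "\<And>v w. B v w = B w v" and B_pos: "\<And>v. v \<noteq> 0 \<Longrightarrow> B v v > 0"
    and D_lin: "\<And>v w. linear (\<lambda>u. D u v w)" and D_bil: "\<And>u. bilinear (D u)"
    and D_sym: "\<And>u v w. D u v w = D u w v"
  shows "\<exists>!\<Gamma>. bilinear \<Gamma> \<and> (\<forall>u v. \<Gamma> u v = \<Gamma> v u) \<and> (\<forall>u v w. D u v w = B (\<Gamma> u v) w + B v (\<Gamma> u w))"
proof -
  have B1: "linear (\<lambda>v. B v w)" and B2: "linear (B v)" for v w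
    using assms(1) unfolding bilinear_def by auto
  have D2: "linear (\<lambda>v. D u v w)" and D3: "linear (D u v)" for u v w
    using D_bil[of u] unfolding bilinear_def by auto
  define L where "L v = (\<Sum>b\<in>Basis. B v b *\<^sub>R b)" for v
  have L_lin: "linear L"
    unfolding L_def by (rule linear_compose_sum)
      (auto intro!: linearI simp: linear_add[OF B1] linear_scale[OF B1] scaleR_left_distrib)
  have L_inner: "L v \<bullet> w = B v w" for v w
  proof -
    have "B v w = B v (\<Sum>b\<in>Basis. (w \<bullet> b) *\<^sub>R b)" by (simp add: euclidean_representation)
    also have "\<dots> = (\<Sum>b\<in>Basis. (w \<bullet> b) * B v b)"
      by (simp add: linear_sum[OF B2] linear_scale[OF B2])
    finally show ?thesis
      by (simp add: L_def inner_sum_left inner_commute[of w] mult.commute)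
  qed
  have "inj L"
    unfolding linear_injective_0[OF L_lin]
    by (metis L_inner B_pos inner_zero_left less_irrefl)
  then have "bij L"
    using L_lin linear_injective_imp_surjective bij_def by blast
  then obtain M where M_lin: "linear M" and LM: "\<And>z. L (M z) = z"
    using linear_surjective_right_inverse[OF L_lin] unfolding bij_def by (metis comp_apply id_apply)
  define k where "k u v b = (D u v b + D v u b - D b u v) / 2" for u v b
  have k1: "linear (\<lambda>u. k u v b)" and k2: "linear (k u v)" for u v b
    unfolding k_def by (auto intro!: linearI simp: linear_add[OF D_lin] linear_scale[OF D_lin]
        linear_add[OF D2] linear_scale[OF D2] linear_add[OF D3] linear_scale[OF D3] field_simps)
  have k_sym: "k u v b = k v u b" for u v b by (simp add: k_def D_sym[of b u v])
  define G where "G u v = M (\<Sum>b\<in>Basis. k u v b *\<^sub>R b)" for u v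
  have BG: "B (G u v) w = k u v w" for u v w
  proof -
    have "k u v w = k u v (\<Sum>b\<in>Basis. (w \<bullet> b) *\<^sub>R b)" by (simp add: euclidean_representation)
    also have "\<dots> = (\<Sum>b\<in>Basis. (w \<bullet> b) * k u v b)"
      by (simp add: linear_sum[OF k2] linear_scale[OF k2])
    also have "\<dots> = L (G u v) \<bullet> w"
      by (simp add: G_def LM inner_sum_left inner_commute[of w] mult.commute)
    finally show ?thesis by (simp add: L_inner)
  qed
  have G_sym: "G u v = G v u" for u v by (simp add: G_def k_sym)
  have G1: "linear (\<lambda>u. G u v)" for v
    unfolding G_def by (rule linear_compose[OF _ M_lin, unfolded comp_def], rule linear_compose_sum)
      (auto intro!: linearI simp: linear_add[OF k1] linear_scale[OF k1] scaleR_left_distrib)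
  have "linear (G v)" for v
  proof -
    have "(\<lambda>u. G u v) = G v" by (rule ext, rule G_sym)
    then show ?thesis using G1[of v] by simp
  qed
  then have "bilinear G" unfolding bilinear_def using G1 by simp
  moreover have "D u v w = B (G u v) w + B v (G u w)" for u v w
    using BG[of u v w] BG[of u w v] B_sym[of v "G u w"] D_sym[of u w v] by (simp add: k_def)
  moreover have "H = G" if "\<forall>u v. H u v = H v u" "\<forall>u v w. D u v w = B (H u v) w + B v (H u w)" for H
  proof (intro ext)
    fix u v
    have Hc: "D a b c = B (H a b) c + B (H a c) b" for a b c
      using that(2)[rule_format, of a b c] B_sym[of b "H a c"] by simp
    have "B (H u v) w = k u v w" for w
      using Hc[of u v w] Hc[of v u w] Hc[of w u v] that(1)[rule_format, of v u]
        that(1)[rule_format, of w u] that(1)[rule_format, of w v] by (simp add: k_def)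
    then have "L (H u v) \<bullet> w = L (G u v) \<bullet> w" for w by (simp add: L_inner BG)
    then have "L (H u v) = L (G u v)" using vector_eq_rdot by blast
    then show "H u v = G u v" using \<open>inj L\<close> by (simp add: inj_eq)
  qed
  ultimately show ?thesis using G_sym by (intro ex1I[of _ G] conjI allI) blast+
qed

definition christoffel ::
    "('a, 'e::euclidean_space) chart set \<Rightarrow> ('a, 'e) bilin_field \<Rightarrow> ('a, 'e) chart \<Rightarrow> 'e \<Rightarrow> 'e \<Rightarrow> 'e \<Rightarrow> 'e" where
  "christoffel A g c x =
     (THE \<Gamma>. bilinear \<Gamma> \<and> (\<forall>u v. \<Gamma> u v = \<Gamma> v u) \<and>
        (\<forall>u v w. frechet_derivative (\<lambda>y. bilin_coords A g c y v w) (at x) u =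
           bilin_coords A g c x (\<Gamma> u v) w + bilin_coords A g c x v (\<Gamma> u w)))"

text \<open>Covariant derivative at time t of a vector field V along a curve, given by its coordinates in
  every chart around the point.\<close>

definition cov_along ::
    "('a, 'e::euclidean_space) chart set \<Rightarrow> ('a, 'e) bilin_field \<Rightarrow> (real \<Rightarrow> 'a) \<Rightarrow>
      (real \<Rightarrow> ('a, 'e) tvec) \<Rightarrow> real \<Rightarrow> ('a, 'e) tvec" where
  "cov_along A g \<gamma> V t =
     (\<lambda>c. if c \<in> charts_at A (\<gamma> t)
          then vector_derivative (\<lambda>s. V s c) (at t) +
               christoffel A g c (snd c (\<gamma> t)) (vector_derivative (\<lambda>s. snd c (\<gamma> s)) (at t)) (V t c)
          else 0)"

text \<open>Covariant derivative \<open>\<nabla>\<^sub>u K\<close> of a tensor at p, computed in an arbitrary chart around p.\<close>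

definition chart_at :: "('a, 'e) chart set \<Rightarrow> 'a \<Rightarrow> ('a, 'e) chart" where
  "chart_at A p = (SOME c. c \<in> charts_at A p)"

definition cov_tensor ::
    "('a, 'e::euclidean_space) chart set \<Rightarrow> ('a, 'e) bilin_field \<Rightarrow> ('a, 'e) tensor \<Rightarrow>
      'a \<Rightarrow> ('a, 'e) tvec \<Rightarrow> ('a, 'e) tvec list \<Rightarrow> real" where
  "cov_tensor A g K p u ws =
     (let c = chart_at A p; x = snd c p; us = map (\<lambda>w. w c) ws in
        frechet_derivative (\<lambda>y. tensor_coords A K c y us) (at x) (u c) -
        (\<Sum>j<length us. tensor_coords A K c x (us[j := christoffel A g c x (u c) (us ! j)])))"

section \<open>Symmetric product and symmetric differential\<close>

text \<open>The symmetric l-linear form identified with the symmetric product of the vectors in vs, i.e.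
  the scalar product of the symmetric products of vs and of ws.\<close>

definition sym_prod ::
    "('v \<Rightarrow> 'v \<Rightarrow> real) \<Rightarrow> 'v list \<Rightarrow> 'v list \<Rightarrow> real" where
  "sym_prod b vs ws = (\<Sum>\<sigma> | \<sigma> permutes {..<length ws}. \<Prod>i<length ws. b (vs ! i) (ws ! \<sigma> i))"

text \<open>The symmetric product \<open>e \<cdot> T\<close> of a vector with a symmetric tensor, in terms of forms. The lemma
  confirms that it extends \<open>e \<cdot> (v\<^sub>1\<cdots>v\<^sub>l) = e v\<^sub>1\<cdots>v\<^sub>l\<close>.\<close>

definition sym_mult ::
    "('v \<Rightarrow> 'v \<Rightarrow> real) \<Rightarrow> 'v \<Rightarrow> ('v list \<Rightarrow> real) \<Rightarrow> 'v list \<Rightarrow> real" where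
  "sym_mult b e T ws = (\<Sum>j<length ws. b e (ws ! j) * T (take j ws @ drop (Suc j) ws))"

lemma sym_mult_sym_prod:
  assumes "length ws = Suc (length vs)"
  shows "sym_mult b e (sym_prod b vs) ws = sym_prod b (e # vs) ws"
proof -
  let ?l = "length vs"
  define sk where "sk j k = (if k < j then k else Suc k)" for j k :: nat
  define un where "un j m = (if m < j then m else m - 1)" for j m :: nat
  have del: "(take j ws @ drop (Suc j) ws) ! k = ws ! sk j k" if "j < Suc ?l" "k < ?l" for j k
    using that assms by (auto simp: nth_append sk_def min_def)
  define ins where "ins j \<tau> = (\<lambda>i. if i = 0 then j else if i < Suc ?l then sk j (\<tau> (i - 1)) else i)"
    for j :: nat and \<tau> :: "nat \<Rightarrow> nat"
  define rm where "rm \<sigma> = (\<lambda>i. if i < ?l then un (\<sigma> 0) (\<sigma> (Suc i)) else i)" for \<sigma> :: "nat \<Rightarrow> nat"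
  have perm_iff: "p permutes {..<n} \<longleftrightarrow> p ` {..<n} \<subseteq> {..<n} \<and> inj_on p {..<n} \<and> (\<forall>i\<ge>n. p i = i)" for p and n :: nat
  proof
    assume "p permutes {..<n}"
    then show "p ` {..<n} \<subseteq> {..<n} \<and> inj_on p {..<n} \<and> (\<forall>i\<ge>n. p i = i)"
      using permutes_not_in[of p "{..<n}"] by (simp add: permutes_image permutes_inj_on)
  next
    assume "p ` {..<n} \<subseteq> {..<n} \<and> inj_on p {..<n} \<and> (\<forall>i\<ge>n. p i = i)"
    then show "p permutes {..<n}"
      by (intro bij_imp_permutes) (auto simp: bij_betw_def endo_inj_surj)
  qed
  have ins_perm: "ins j \<tau> permutes {..<Suc ?l}" if "j < Suc ?l" "\<tau> permutes {..<?l}" for j \<tau>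
  proof -
    have t: "\<tau> i < ?l" if "i < ?l" for i using that \<open>\<tau> permutes _\<close> by (metis lessThan_iff permutes_in_image)
    have ti: "\<tau> i = \<tau> k \<Longrightarrow> i = k" for i k using \<open>\<tau> permutes _\<close> by (metis permutes_inj inj_eq)
    have "inj_on (ins j \<tau>) {..<Suc ?l}"
    proof (rule inj_onI)
      fix x y assume a: "x \<in> {..<Suc ?l}" "y \<in> {..<Suc ?l}" "ins j \<tau> x = ins j \<tau> y"
      show "x = y"
        using a by (cases x; cases y) (auto simp: ins_def sk_def split: if_splits dest: ti)
    qed
    moreover have "ins j \<tau> ` {..<Suc ?l} \<subseteq> {..<Suc ?l}"
      using that(1) by (force simp: ins_def sk_def intro: less_SucI t split: if_splits)
    ultimately show ?thesis unfolding perm_iff by (auto simp: ins_def)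
  qed
  have rm_perm: "rm \<sigma> permutes {..<?l}" if "\<sigma> permutes {..<Suc ?l}" for \<sigma>
  proof -
    have s: "\<sigma> i < Suc ?l" if "i < Suc ?l" for i using that \<open>\<sigma> permutes _\<close> by (metis lessThan_iff permutes_in_image)
    have si: "\<sigma> i = \<sigma> k \<longleftrightarrow> i = k" for i k using \<open>\<sigma> permutes _\<close> by (metis permutes_inj inj_eq)
    have ne: "\<sigma> (Suc i) \<noteq> \<sigma> 0" for i by (simp add: si)
    have "inj_on (rm \<sigma>) {..<?l}"
    proof (rule inj_onI)
      fix x y assume a: "x \<in> {..<?l}" "y \<in> {..<?l}" "rm \<sigma> x = rm \<sigma> y"
      then have "\<sigma> (Suc x) = \<sigma> (Suc y)"
        using ne[of x] ne[of y] by (auto simp: rm_def un_def split: if_splits)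
      then show "x = y" by (simp add: si)
    qed
    moreover have "rm \<sigma> i < ?l" if "i < ?l" for i
      using s[of 0] s[of "Suc i"] ne[of i] that by (auto simp: rm_def un_def)
    ultimately show ?thesis unfolding perm_iff by (auto simp: rm_def)
  qed
  have "sym_mult b e (sym_prod b vs) ws =
      (\<Sum>j<Suc ?l. \<Sum>\<tau> | \<tau> permutes {..<?l}. b e (ws ! j) * (\<Prod>i<?l. b (vs ! i) (ws ! sk j (\<tau> i))))"
  proof -
    have "b e (ws ! j) * sym_prod b vs (take j ws @ drop (Suc j) ws) =
       (\<Sum>\<tau> | \<tau> permutes {..<?l}. b e (ws ! j) * (\<Prod>i<?l. b (vs ! i) (ws ! sk j (\<tau> i))))"
      if "j < Suc ?l" for j
    proof -
      have len: "length (take j ws @ drop (Suc j) ws) = ?l" using assms that by simp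
      show ?thesis unfolding sym_prod_def len sum_distrib_left
      proof (rule sum.cong[OF refl], rule arg_cong[where f = "\<lambda>x. b e (ws ! j) * x"], rule prod.cong[OF refl])
        fix \<tau> i assume "\<tau> \<in> {\<tau>. \<tau> permutes {..<?l}}" "i \<in> {..<?l}"
        then have "\<tau> i < ?l" by (metis lessThan_iff mem_Collect_eq permutes_in_image)
        then show "b (vs ! i) ((take j ws @ drop (Suc j) ws) ! \<tau> i) = b (vs ! i) (ws ! sk j (\<tau> i))"
          using del that by metis
      qed
    qed
    then show ?thesis unfolding sym_mult_def assms by (intro sum.cong) auto
  qed
  also have "\<dots> = (\<Sum>(j, \<tau>) \<in> {..<Suc ?l} \<times> {\<tau>. \<tau> permutes {..<?l}}.
      b e (ws ! j) * (\<Prod>i<?l. b (vs ! i) (ws ! sk j (\<tau> i))))"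
    by (simp add: sum.cartesian_product)
  also have "\<dots> = (\<Sum>\<sigma> | \<sigma> permutes {..<Suc ?l}. b e (ws ! \<sigma> 0) * (\<Prod>i<?l. b (vs ! i) (ws ! \<sigma> (Suc i))))"
  proof (rule sum.reindex_bij_witness[of _ "\<lambda>\<sigma>. (\<sigma> 0, rm \<sigma>)" "\<lambda>(j, \<tau>). ins j \<tau>"], goal_cases)
    case (1 a)
    then obtain j \<tau> where a: "a = (j, \<tau>)" "\<tau> permutes {..<?l}" by auto
    have "rm (ins j \<tau>) i = \<tau> i" for i
      using permutes_not_in[OF a(2), of i] by (auto simp: rm_def ins_def un_def sk_def)
    then show ?case using a by (auto simp: ins_def)
  next
    case (2 a) then show ?case using ins_perm by auto
  next
    case (3 \<sigma>)
    then have p: "\<sigma> permutes {..<Suc ?l}" by simp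
    have ne: "\<sigma> (Suc i) \<noteq> \<sigma> 0" for i using p by (metis nat.distinct(1) permutes_inj inj_eq)
    have "ins (\<sigma> 0) (rm \<sigma>) i = \<sigma> i" for i
      using permutes_not_in[OF p, of i] ne[of "i - 1"]
      by (cases i) (auto simp: rm_def ins_def un_def sk_def)
    then show ?case by auto
  next
    case (4 \<sigma>)
    then have p: "\<sigma> permutes {..<Suc ?l}" by simp
    have "\<sigma> 0 < Suc ?l" using p by (metis lessThan_iff permutes_in_image zero_less_Suc)
    then show ?case using rm_perm[OF p] by auto
  next
    case (5 a) then show ?case by (auto simp: ins_def intro!: prod.cong)
  qed
  also have "\<dots> = sym_prod b (e # vs) ws"
    unfolding sym_prod_def assms by (simp del: prod.lessThan_Suc add: prod.lessThan_Suc_shift)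
  finally show ?thesis .
qed

definition orthonormal_frame ::
    "('a, 'e::euclidean_space) chart set \<Rightarrow> ('a, 'e) bilin_field \<Rightarrow> 'a \<Rightarrow> (nat \<Rightarrow> ('a, 'e) tvec) \<Rightarrow> bool" where
  "orthonormal_frame A g p e \<longleftrightarrow>
     (\<forall>i<DIM('e). e i \<in> tangent_space A p) \<and>
     (\<forall>i<DIM('e). \<forall>j<DIM('e). g p (e i) (e j) = (if i = j then 1 else 0))"

text \<open>\<open>d\<^sup>s K = \<Sum>\<^sub>i e\<^sub>i \<cdot> \<nabla>\<^sub>e\<^sub>i K\<close>; the value does not depend on the orthonormal frame that is chosen.\<close>

definition sym_differential ::
    "('a, 'e::euclidean_space) chart set \<Rightarrow> ('a, 'e) bilin_field \<Rightarrow> ('a, 'e) tensor \<Rightarrow> ('a, 'e) tensor" where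
  "sym_differential A g K p =
     (let e = (SOME e. orthonormal_frame A g p e) in
        (\<lambda>ws. \<Sum>i<DIM('e). sym_mult (g p) (e i) (cov_tensor A g K p (e i)) ws))"

section \<open>Lorentz forces and magnetic geodesics\<close>

type_synonym ('a, 'e) endo_field = "'a \<Rightarrow> ('a, 'e) tvec \<Rightarrow> ('a, 'e) tvec"

definition endo_field ::
    "('a, 'e::euclidean_space) chart set \<Rightarrow> ('a, 'e) endo_field \<Rightarrow> bool" where
  "endo_field A F \<longleftrightarrow>
     (\<forall>p\<in>points A. \<forall>v\<in>tangent_space A p. F p v \<in> tangent_space A p) \<and>
     (\<forall>p\<in>points A. \<forall>v\<in>tangent_space A p. \<forall>w\<in>tangent_space A p. \<forall>a b.
        F p (tcomb a v b w) = tcomb a (F p v) b (F p w)) \<and>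
     (\<forall>c\<in>A. \<forall>u. smooth_on (chart_range c)
        (\<lambda>y. F (chart_inv c y) (of_coords A c (chart_inv c y) u) c))"

text \<open>Closedness of a 2-form: vanishing of the exterior derivative on constant coordinate fields.\<close>

definition closed_2form ::
    "('a, 'e::euclidean_space) chart set \<Rightarrow> ('a, 'e) bilin_field \<Rightarrow> bool" where
  "closed_2form A \<omega> \<longleftrightarrow>
     (\<forall>c\<in>A. \<forall>x\<in>chart_range c. \<forall>u v w.
        frechet_derivative (\<lambda>y. bilin_coords A \<omega> c y v w) (at x) u +
        frechet_derivative (\<lambda>y. bilin_coords A \<omega> c y w u) (at x) v +
        frechet_derivative (\<lambda>y. bilin_coords A \<omega> c y u v) (at x) w = 0)"

definition lorentz_force ::
    "('a, 'e::euclidean_space) chart set \<Rightarrow> ('a, 'e) bilin_field \<Rightarrow> ('a, 'e) endo_field \<Rightarrow> bool" where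
  "lorentz_force A g F \<longleftrightarrow>
     endo_field A F \<and>
     (\<forall>p\<in>points A. \<forall>v\<in>tangent_space A p. \<forall>w\<in>tangent_space A p. g p (F p v) w = - g p v (F p w)) \<and>
     closed_2form A (\<lambda>p v w. g p (F p v) w)"

text \<open>The derivation of symmetric tensors extending \<open>F\<close>, which maps \<open>v\<^sub>1\<cdots>v\<^sub>l\<close> to
  \<open>\<Sum>\<^sub>j v\<^sub>1\<cdots>Fv\<^sub>j\<cdots>v\<^sub>l\<close> (see the lemma). The sign arises when the skew-symmetric \<open>F\<close> is moved to the
  arguments of the form; in particular \<open>(F\<^sub>* K)(v, \<dots>, v) = - l K(Fv, v, \<dots>, v)\<close>.\<close>

definition endo_deriv :: "('a, 'e) endo_field \<Rightarrow> ('a, 'e) tensor \<Rightarrow> ('a, 'e) tensor" where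
  "endo_deriv F K p ws = - (\<Sum>j<length ws. K p (ws[j := F p (ws ! j)]))"

lemma endo_deriv_sym_prod:
  assumes "\<And>v w. v \<in> set vs \<Longrightarrow> w \<in> set ws \<Longrightarrow> b (F p v) w = - b v (F p w)" "length vs = length ws"
  shows "endo_deriv F (\<lambda>p. sym_prod b vs) p ws =
         (\<Sum>j<length vs. sym_prod b (vs[j := F p (vs ! j)]) ws)"
proof -
  let ?l = "length ws"
  have eq: "(\<Sum>j<?l. \<Prod>i<?l. b (vs ! i) (ws[j := F p (ws ! j)] ! \<sigma> i)) =
        - (\<Sum>j<?l. \<Prod>i<?l. b (vs[j := F p (vs ! j)] ! i) (ws ! \<sigma> i))" if s: "\<sigma> permutes {..<?l}" for \<sigma>
  proof -
    have inj: "\<sigma> i = \<sigma> k \<longleftrightarrow> i = k" for i k using s by (metis permutes_inj inj_eq)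
    have lt: "\<sigma> i < ?l" if "i < ?l" for i using that s by (metis lessThan_iff permutes_in_image)
    have "(\<Sum>j<?l. \<Prod>i<?l. b (vs ! i) (ws[j := F p (ws ! j)] ! \<sigma> i)) =
          (\<Sum>k<?l. \<Prod>i<?l. b (vs ! i) (ws[\<sigma> k := F p (ws ! \<sigma> k)] ! \<sigma> i))"
      by (rule sum.reindex_bij_betw[OF permutes_imp_bij[OF s], symmetric])
    also have "\<dots> = (\<Sum>k<?l. - (\<Prod>i<?l. b (vs[k := F p (vs ! k)] ! i) (ws ! \<sigma> i)))"
    proof (rule sum.cong[OF refl])
      fix k assume k: "k \<in> {..<?l}"
      have r: "(\<Prod>i<?l. f i) = f k * (\<Prod>i\<in>{..<?l} - {k}. f i)" for f :: "nat \<Rightarrow> real"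
        using k by (simp add: prod.remove)
      have "(\<Prod>i\<in>{..<?l} - {k}. b (vs ! i) (ws[\<sigma> k := F p (ws ! \<sigma> k)] ! \<sigma> i)) =
            (\<Prod>i\<in>{..<?l} - {k}. b (vs[k := F p (vs ! k)] ! i) (ws ! \<sigma> i))"
        by (rule prod.cong) (auto simp: inj)
      then show "(\<Prod>i<?l. b (vs ! i) (ws[\<sigma> k := F p (ws ! \<sigma> k)] ! \<sigma> i)) =
            - (\<Prod>i<?l. b (vs[k := F p (vs ! k)] ! i) (ws ! \<sigma> i))"
        unfolding r using k lt[of k] assms by simp
    qed
    finally show ?thesis by (simp add: sum_negf)
  qed
  have "endo_deriv F (\<lambda>p. sym_prod b vs) p ws =
     - (\<Sum>\<sigma> | \<sigma> permutes {..<?l}. \<Sum>j<?l. \<Prod>i<?l. b (vs ! i) (ws[j := F p (ws ! j)] ! \<sigma> i))"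
    unfolding endo_deriv_def sym_prod_def by (simp add: sum.swap[of _ "{..<?l}"])
  also have "\<dots> = (\<Sum>\<sigma> | \<sigma> permutes {..<?l}. \<Sum>j<?l. \<Prod>i<?l. b (vs[j := F p (vs ! j)] ! i) (ws ! \<sigma> i))"
    using eq by (simp add: sum_negf)
  finally show ?thesis using assms(2) unfolding sym_prod_def by (simp add: sum.swap[of _ "{..<?l}"])
qed

definition velocity ::
    "('a, 'e::euclidean_space) chart set \<Rightarrow> (real \<Rightarrow> 'a) \<Rightarrow> real \<Rightarrow> ('a, 'e) tvec" where
  "velocity A \<gamma> t =
     (\<lambda>c. if c \<in> charts_at A (\<gamma> t) then vector_derivative (\<lambda>s. snd c (\<gamma> s)) (at t) else 0)"

text \<open>Curves are of class C2 on an open interval, which is what the equation needs; solutions are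
  then automatically smooth because the coefficients are.\<close>

definition C2_curve ::
    "'a topology \<Rightarrow> ('a, 'e::euclidean_space) chart set \<Rightarrow> real set \<Rightarrow> (real \<Rightarrow> 'a) \<Rightarrow> bool" where
  "C2_curve X A I \<gamma> \<longleftrightarrow>
     open I \<and> is_interval I \<and> continuous_map (top_of_set I) X \<gamma> \<and>
     (\<forall>c\<in>A. Ck_on 2 {t \<in> I. \<gamma> t \<in> fst c} (\<lambda>t. snd c (\<gamma> t)))"

definition magnetic_geodesic ::
    "'a topology \<Rightarrow> ('a, 'e::euclidean_space) chart set \<Rightarrow> ('a, 'e) bilin_field \<Rightarrow> ('a, 'e) endo_field \<Rightarrow>
      real set \<Rightarrow> (real \<Rightarrow> 'a) \<Rightarrow> bool" where
  "magnetic_geodesic X A g F I \<gamma> \<longleftrightarrow>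
     C2_curve X A I \<gamma> \<and>
     (\<forall>t\<in>I. cov_along A g \<gamma> (velocity A \<gamma>) t = F (\<gamma> t) (velocity A \<gamma> t))"

definition first_integral ::
    "'a topology \<Rightarrow> ('a, 'e::euclidean_space) chart set \<Rightarrow> ('a, 'e) bilin_field \<Rightarrow> ('a, 'e) endo_field \<Rightarrow>
      ('a \<times> ('a, 'e) tvec \<Rightarrow> real) \<Rightarrow> bool" where
  "first_integral X A g F \<Psi> \<longleftrightarrow>
     differentiable_on_TM A \<Psi> \<and>
     (\<forall>I \<gamma>. magnetic_geodesic X A g F I \<gamma> \<longrightarrow> (\<lambda>t. \<Psi> (\<gamma> t, velocity A \<gamma> t)) constant_on I)"

end

theory Submission
  imports Defs
begin

text \<open>
  Write \<open>Q\<^sub>i = d\<^sup>sK\<^sub>i - F\<^sub>*K\<^bsub>i+1\<^esub>\<close>, a symmetric form of degree \<open>i + 1\<close>. Along a magnetic geodesic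
  \<open>\<gamma>\<close> with velocity \<open>v\<close> the product rule gives
  \<open>d/dt K\<^sub>i(v, \<dots>, v) = (\<nabla>\<^sub>v K\<^sub>i)(v, \<dots>, v) + i K\<^sub>i(Fv, v, \<dots>, v)\<close>, because the covariant acceleration is
  \<open>Fv\<close>. The diagonal values of \<open>d\<^sup>sK\<^sub>i\<close> and \<open>F\<^sub>*K\<^bsub>i+1\<^esub>\<close> are \<open>i + 1\<close> times
  \<open>(\<nabla>\<^sub>v K\<^sub>i)(v, \<dots>, v)\<close> and \<open>- K\<^bsub>i+1\<^esub>(Fv, v, \<dots>, v)\<close>, so after an index shift
  \<open>d/dt \<phi>(v) = \<Sum>\<^sub>i Q\<^sub>i(v, \<dots>, v) / (i + 1)!\<close>; this is \<open>derivative_along_geodesic\<close>.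

  If all \<open>Q\<^sub>i\<close> vanish, \<open>\<phi>\<close> has zero derivative along every magnetic geodesic, which lives on an
  interval, and is constant there. Conversely, a magnetic geodesic starts in every direction
  (\<open>magnetic_geodesic_exists\<close>), so that the sum vanishes for every tangent vector \<open>v\<close>. Its terms are
  homogeneous of the distinct degrees \<open>i + 1\<close>; replacing \<open>v\<close> by \<open>sv\<close> yields a polynomial in \<open>s\<close> that
  vanishes identically, hence each \<open>Q\<^sub>i\<close> vanishes on the diagonal, and a symmetric multilinear form
  that vanishes on the diagonal is zero (\<open>graded_polarization\<close>).

  For the existence of geodesics the second order equation is solved in one chart as an integral
  curve of the magnetic spray, by Picard's theorem (\<open>picard_local_existence\<close>). Picard's theorem needs
  Lipschitz Christoffel symbols; they solve a linear system with \<open>C\<close>-1 coefficients, which suffices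
  (\<open>lipschitz_near_linear_solution\<close>). A magnetic geodesic has to satisfy its equation in every chart,
  so the solution found in one chart is carried to the others by the transformation law of the
  Christoffel symbols (\<open>christoffel_change\<close>). That law follows from the uniqueness of the torsion-free
  metric connection: the transformed symbols are again metric, and they are symmetric because second
  derivatives of the transition maps are (\<open>second_derivative_symmetric\<close>).
\<close>

section \<open>Calculus of \<open>C\<close>-k maps\<close>

abbreviation deriv_at where "deriv_at f x \<equiv> frechet_derivative f (at x)"

lemma linear_basis_expansion:
  fixes L :: "'e::euclidean_space \<Rightarrow> 'b::real_vector"
  assumes "linear L"
  shows "L u = (\<Sum>b\<in>Basis. (u \<bullet> b) *\<^sub>R L b)"
  using linear_sum[OF assms, of "\<lambda>b. (u \<bullet> b) *\<^sub>R b" Basis] linear_scale[OF assms]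
  by (simp add: euclidean_representation)

text \<open>The derivative in the parameter inherits every linear relation between the values, by uniqueness of
derivatives.\<close>

lemma derivative_of_linear_family:
  fixes L :: "'s::real_normed_vector \<Rightarrow> 'e::real_vector \<Rightarrow> 'b::real_normed_vector"
  assumes S: "open S" "x \<in> S" and lin: "\<And>y. y \<in> S \<Longrightarrow> linear (L y)"
    and D: "\<And>u. ((\<lambda>y. L y u) has_derivative (\<lambda>h. D h u)) (at x)"
  shows "linear (D h)"
proof (rule linearI)
  fix u v
  have "((\<lambda>y. L y (u + v)) has_derivative (\<lambda>h. D h u + D h v)) (at x)"
    by (rule has_derivative_transform_within_open[OF has_derivative_add[OF D D] S])
      (simp add: linear_add[OF lin])
  from has_derivative_unique[OF D this] show "D h (u + v) = D h u + D h v" by metis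
next
  fix a u
  have "((\<lambda>y. L y (a *\<^sub>R u)) has_derivative (\<lambda>h. a *\<^sub>R D h u)) (at x)"
    by (rule has_derivative_transform_within_open[OF has_derivative_scaleR_right[OF D] S])
      (simp add: linear_scale[OF lin])
  from has_derivative_unique[OF D this] show "D h (a *\<^sub>R u) = a *\<^sub>R D h u" by metis
qed

text \<open>The product rule for applying linear maps that depend on a parameter to vectors that depend on it
as well. Only the derivative of each single value \<open>L y u\<close> is required, because in finite dimension
\<open>L y\<close> is determined by its values on a basis. Iterating the rule differentiates bilinear and
multilinear expressions.\<close>

lemma has_derivative_linear_family:
  fixes L :: "'s::real_normed_vector \<Rightarrow> 'e::euclidean_space \<Rightarrow> 'b::real_normed_vector"
  assumes S: "open S" "x \<in> S" and lin: "\<And>y. y \<in> S \<Longrightarrow> linear (L y)"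
    and D: "\<And>u. ((\<lambda>y. L y u) has_derivative (\<lambda>h. D h u)) (at x)"
    and a: "(a has_derivative a') (at x)"
  shows "((\<lambda>y. L y (a y)) has_derivative (\<lambda>h. D h (a x) + L x (a' h))) (at x)"
proof -
  have Dlin: "linear (D h)" for h by (rule derivative_of_linear_family[OF S lin D])
  have "((\<lambda>y. \<Sum>b\<in>Basis. (a y \<bullet> b) *\<^sub>R L y b) has_derivative
      (\<lambda>h. \<Sum>b\<in>Basis. (a x \<bullet> b) *\<^sub>R D h b + (a' h \<bullet> b) *\<^sub>R L x b)) (at x)"
    by (auto intro!: derivative_eq_intros D a)
  then have "((\<lambda>y. L y (a y)) has_derivative
      (\<lambda>h. \<Sum>b\<in>Basis. (a x \<bullet> b) *\<^sub>R D h b + (a' h \<bullet> b) *\<^sub>R L x b)) (at x)"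
    by (rule has_derivative_transform_within_open[OF _ S])
      (simp add: linear_basis_expansion[OF lin, symmetric])
  then show ?thesis
    by (simp add: sum.distrib linear_basis_expansion[OF Dlin, symmetric]
        linear_basis_expansion[OF lin[OF S(2)], symmetric])
qed

lemma Ck_on_imp_differentiable: "Ck_on (Suc k) S f \<Longrightarrow> x \<in> S \<Longrightarrow> f differentiable at x"
  by simp

lemma Ck_on_has_derivative:
  "Ck_on (Suc k) S f \<Longrightarrow> x \<in> S \<Longrightarrow> (f has_derivative deriv_at f x) (at x)"
  by (simp add: frechet_derivative_works)

lemma Ck_on_Suc_imp: "Ck_on (Suc k) S f \<Longrightarrow> Ck_on k S f"
proof (induction k arbitrary: f)
  case 0
  then show ?case
    by (auto intro!: continuous_at_imp_continuous_on differentiable_imp_continuous_within)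
qed auto

lemma Ck_on_subset: "Ck_on k S f \<Longrightarrow> T \<subseteq> S \<Longrightarrow> Ck_on k T f"
  by (induction k arbitrary: f) (auto intro: continuous_on_subset)

lemma frechet_derivative_cong_open:
  assumes "open S" "x \<in> S" "\<And>y. y \<in> S \<Longrightarrow> f y = g y"
  shows "deriv_at f x = deriv_at g x"
proof -
  have "(f has_derivative D) (at x) \<longleftrightarrow> (g has_derivative D) (at x)" for D
    using has_derivative_transform_within_open[OF _ assms(1,2)] assms(3) by metis
  then show ?thesis by (simp add: frechet_derivative_def)
qed

lemma differentiable_cong_open:
  assumes "open S" "x \<in> S" "\<And>y. y \<in> S \<Longrightarrow> f y = g y" "f differentiable at x"
  shows "g differentiable at x"
  using assms has_derivative_transform_within_open[OF _ assms(1,2)] unfolding differentiable_def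
  by metis

lemma Ck_on_cong:
  assumes "open S" "\<And>y. y \<in> S \<Longrightarrow> f y = g y" "Ck_on k S f"
  shows "Ck_on k S g"
  using assms(2,3)
proof (induction k arbitrary: f g)
  case 0
  then show ?case using continuous_on_cong by fastforce
next
  case (Suc k)
  show ?case unfolding Ck_on.simps
  proof (intro conjI ballI allI)
    show "g differentiable at x" if "x \<in> S" for x
      using differentiable_cong_open[OF assms(1) that] Suc.prems that by (metis Ck_on_imp_differentiable)
    show "Ck_on k S (\<lambda>x. deriv_at g x v)" for v
      by (rule Suc.IH[of "\<lambda>x. deriv_at f x v"])
        (use frechet_derivative_cong_open[OF assms(1) _ Suc.prems(1)] Suc.prems in auto)
  qed
qed

text \<open>The directional derivatives in the definition of \<open>Ck_on\<close> are those of a choice operator; any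
derivative that is known on an open set may be used in their place.\<close>

lemma Ck_on_SucI:
  assumes "open S" "\<And>x. x \<in> S \<Longrightarrow> (f has_derivative D x) (at x)" "\<And>v. Ck_on k S (\<lambda>x. D x v)"
  shows "Ck_on (Suc k) S f"
  unfolding Ck_on.simps
proof (intro conjI ballI allI)
  show "f differentiable at x" if "x \<in> S" for x using assms(2)[OF that] differentiable_def by blast
  show "Ck_on k S (\<lambda>x. deriv_at f x v)" for v
    by (rule Ck_on_cong[OF assms(1) _ assms(3)]) (rule fun_cong[OF frechet_derivative_at[OF assms(2)]])
qed

lemma Ck_on_const: "open S \<Longrightarrow> Ck_on k S (\<lambda>x. c)"
proof (induction k arbitrary: c)
  case (Suc k)
  then show ?case by (intro Ck_on_SucI[of S _ "\<lambda>x v. 0"]) auto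
qed auto

lemma Ck_on_add:
  assumes "open S" "Ck_on k S f" "Ck_on k S g"
  shows "Ck_on k S (\<lambda>x. f x + g x)"
  using assms(2,3)
proof (induction k arbitrary: f g)
  case 0
  then show ?case by (auto intro: continuous_on_add)
next
  case (Suc k)
  show ?case
    by (rule Ck_on_SucI[of S _ "\<lambda>x v. deriv_at f x v + deriv_at g x v"])
      (use Suc assms(1) in \<open>auto intro!: has_derivative_add Ck_on_has_derivative\<close>)
qed

lemma Ck_on_sum:
  assumes "open S" "\<And>i. i \<in> I \<Longrightarrow> Ck_on k S (f i)"
  shows "Ck_on k S (\<lambda>x. \<Sum>i\<in>I. f i x)"
  using assms(2)
  by (induction I rule: infinite_finite_induct) (auto intro: Ck_on_const Ck_on_add assms(1))

lemma (in bounded_bilinear) Ck_on_product: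
  assumes "open S" "Ck_on k S f" "Ck_on k S g"
  shows "Ck_on k S (\<lambda>x. prod (f x) (g x))"
  using assms(2,3)
proof (induction k arbitrary: f g)
  case 0
  then show ?case by (auto intro: continuous_on)
next
  case (Suc k)
  show ?case
  proof (rule Ck_on_SucI[of S _ "\<lambda>x v. prod (f x) (deriv_at g x v) + prod (deriv_at f x v) (g x)"])
    show "Ck_on k S (\<lambda>x. prod (f x) (deriv_at g x v) + prod (deriv_at f x v) (g x))" for v
      using Suc.prems Ck_on_Suc_imp[OF Suc.prems(1)] Ck_on_Suc_imp[OF Suc.prems(2)]
      by (intro Ck_on_add assms(1) Suc.IH) auto
    show "((\<lambda>x. prod (f x) (g x)) has_derivative
        (\<lambda>v. prod (f x) (deriv_at g x v) + prod (deriv_at f x v) (g x))) (at x)" if "x \<in> S" for x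
      using FDERIV[OF Ck_on_has_derivative[OF Suc.prems(1) that] Ck_on_has_derivative[OF Suc.prems(2) that]] .
  qed (fact assms)
qed

lemmas Ck_on_scaleR = bounded_bilinear.Ck_on_product[OF bounded_bilinear_scaleR]
  and Ck_on_inner = bounded_bilinear.Ck_on_product[OF bounded_bilinear_inner]

lemma Ck_on_linear_family:
  fixes L :: "'s::real_normed_vector \<Rightarrow> 'e::euclidean_space \<Rightarrow> 'b::real_normed_vector"
  assumes "open S" "\<And>y. y \<in> S \<Longrightarrow> linear (L y)" "\<And>u. Ck_on k S (\<lambda>y. L y u)" "Ck_on k S a"
  shows "Ck_on k S (\<lambda>y. L y (a y))"
proof (rule Ck_on_cong[OF assms(1)])
  show "(\<Sum>b\<in>Basis. (a y \<bullet> b) *\<^sub>R L y b) = L y (a y)" if "y \<in> S" for y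
    using linear_basis_expansion[OF assms(2)[OF that]] by metis
  show "Ck_on k S (\<lambda>y. \<Sum>b\<in>Basis. (a y \<bullet> b) *\<^sub>R L y b)"
    by (intro Ck_on_sum Ck_on_scaleR Ck_on_inner Ck_on_const assms)
qed

text \<open>By the chain rule the derivative of the composition is the family \<open>D f (g x)\<close> of linear maps applied
to \<open>D g x v\<close>, so that the induction reduces to families of linear maps.\<close>

lemma Ck_on_compose:
  fixes f :: "'b::euclidean_space \<Rightarrow> 'c::real_normed_vector"
  assumes "open S" "open T" "g ` S \<subseteq> T" "Ck_on k T f" "Ck_on k S g"
  shows "Ck_on k S (\<lambda>x. f (g x))"
  using assms(4,5)
proof (induction k arbitrary: f)
  case 0
  then show ?case using assms(3) continuous_on_compose2 by auto
next
  case (Suc k)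
  have d: "(f has_derivative deriv_at f (g x)) (at (g x))" if "x \<in> S" for x
    using Ck_on_has_derivative[OF Suc.prems(1)] assms(3) that by auto
  show ?case
  proof (rule Ck_on_SucI[of S _ "\<lambda>x v. deriv_at f (g x) (deriv_at g x v)", OF assms(1)])
    show "((\<lambda>x. f (g x)) has_derivative (\<lambda>v. deriv_at f (g x) (deriv_at g x v))) (at x)" if "x \<in> S" for x
      using has_derivative_compose[OF Ck_on_has_derivative[OF Suc.prems(2) that] d[OF that]] .
    show "Ck_on k S (\<lambda>x. deriv_at f (g x) (deriv_at g x v))" for v
    proof (rule Ck_on_linear_family[OF assms(1)])
      show "linear (deriv_at f (g y))" if "y \<in> S" for y
        using has_derivative_linear[OF d[OF that]] .
      show "Ck_on k S (\<lambda>y. deriv_at f (g y) u)" for u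
        using Suc.IH[of "\<lambda>y. deriv_at f y u"] Suc.prems Ck_on_Suc_imp by auto
    qed (use Suc.prems in auto)
  qed
qed

text \<open>Two applications of the mean value theorem, first along \<open>u\<close> and then along \<open>v\<close>. The second
difference on the left is symmetric in \<open>u\<close> and \<open>v\<close>, but the right hand side is a second derivative
in one fixed order.\<close>

lemma second_difference_mean_value:
  fixes f :: "'a::real_normed_vector \<Rightarrow> real"
  assumes f: "Ck_on 2 S f" and s: "s > 0"
    and sub: "\<And>p q. 0 \<le> p \<Longrightarrow> p \<le> s \<Longrightarrow> 0 \<le> q \<Longrightarrow> q \<le> s \<Longrightarrow> x + p *\<^sub>R u + q *\<^sub>R v \<in> S"
  shows "\<exists>p q. 0 < p \<and> p < s \<and> 0 < q \<and> q < s \<and>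
    f (x + s *\<^sub>R u + s *\<^sub>R v) - f (x + s *\<^sub>R u) - f (x + s *\<^sub>R v) + f x
    = s * s * deriv_at (\<lambda>y. deriv_at f y u) (x + p *\<^sub>R u + q *\<^sub>R v) v"
proof -
  have f1: "(f has_derivative deriv_at f y) (at y)"
    and f2: "((\<lambda>y. deriv_at f y u) has_derivative deriv_at (\<lambda>y. deriv_at f y u) y) (at y)" if "y \<in> S" for y
    using f that by (auto simp: numeral_2_eq_2 frechet_derivative_works)
  have d1: "((\<lambda>p. f (x + p *\<^sub>R u + q *\<^sub>R v)) has_real_derivative deriv_at f (x + p *\<^sub>R u + q *\<^sub>R v) u) (at p)"
    if "0 \<le> p" "p \<le> s" "0 \<le> q" "q \<le> s" for p q
  proof -
    have "((\<lambda>p. x + p *\<^sub>R u + q *\<^sub>R v) has_derivative (\<lambda>h. h *\<^sub>R u)) (at p)"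
      by (auto intro!: derivative_eq_intros)
    from has_derivative_compose[OF this f1[OF sub[OF that]]]
    show ?thesis unfolding has_field_derivative_def
      using linear_scale[OF has_derivative_linear[OF f1[OF sub[OF that]]]]
      by (simp add: mult_commute_abs)
  qed
  have d2: "((\<lambda>q. deriv_at f (x + p *\<^sub>R u + q *\<^sub>R v) u) has_real_derivative
      deriv_at (\<lambda>y. deriv_at f y u) (x + p *\<^sub>R u + q *\<^sub>R v) v) (at q)"
    if "0 \<le> p" "p \<le> s" "0 \<le> q" "q \<le> s" for p q
  proof -
    have "((\<lambda>q. x + p *\<^sub>R u + q *\<^sub>R v) has_derivative (\<lambda>h. h *\<^sub>R v)) (at q)"
      by (auto intro!: derivative_eq_intros)
    from has_derivative_compose[OF this f2[OF sub[OF that]]]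
    show ?thesis unfolding has_field_derivative_def
      using linear_scale[OF has_derivative_linear[OF f2[OF sub[OF that]]]]
      by (simp add: mult_commute_abs)
  qed
  define \<phi> where "\<phi> p = f (x + p *\<^sub>R u + s *\<^sub>R v) - f (x + p *\<^sub>R u + 0 *\<^sub>R v)" for p
  have "(\<phi> has_real_derivative deriv_at f (x + p *\<^sub>R u + s *\<^sub>R v) u - deriv_at f (x + p *\<^sub>R u + 0 *\<^sub>R v) u) (at p)"
    if "0 \<le> p" "p \<le> s" for p
    unfolding \<phi>_def using d1[OF that, of s] d1[OF that, of 0] s by (auto intro!: DERIV_diff)
  from MVT2[OF s this] obtain p where p: "0 < p" "p < s"
    and e1: "\<phi> s - \<phi> 0 = s * (deriv_at f (x + p *\<^sub>R u + s *\<^sub>R v) u - deriv_at f (x + p *\<^sub>R u + 0 *\<^sub>R v) u)"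
    by auto
  obtain q where q: "0 < q" "q < s"
    and e2: "deriv_at f (x + p *\<^sub>R u + s *\<^sub>R v) u - deriv_at f (x + p *\<^sub>R u + 0 *\<^sub>R v) u
       = s * deriv_at (\<lambda>y. deriv_at f y u) (x + p *\<^sub>R u + q *\<^sub>R v) v"
    using MVT2[OF s d2[of p]] p by auto
  show ?thesis using p q e1 e2 unfolding \<phi>_def by (intro exI[of _ p] exI[of _ q]) simp
qed

text \<open>The same second difference over \<open>s\<^sup>2\<close> equals a value of each of the two mixed derivatives, at points
that tend to \<open>x\<close> as \<open>s\<close> tends to 0; both mixed derivatives are continuous.\<close>

lemma second_derivative_symmetric_real:
  fixes f :: "'a::real_normed_vector \<Rightarrow> real"
  assumes f: "Ck_on 2 S f" and S: "open S" "x \<in> S"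
  shows "deriv_at (\<lambda>y. deriv_at f y u) x v = deriv_at (\<lambda>y. deriv_at f y v) x u"
proof (rule ccontr)
  define P where "P y = deriv_at (\<lambda>y. deriv_at f y u) y v" for y
  define Q where "Q y = deriv_at (\<lambda>y. deriv_at f y v) y u" for y
  assume "\<not> ?thesis"
  then have e: "\<bar>P x - Q x\<bar> / 2 > 0" (is "?e > 0") by (simp add: P_def Q_def)
  have "continuous_on S P" "continuous_on S Q"
    using f by (auto simp: numeral_2_eq_2 P_def Q_def)
  then have "isCont P x" "isCont Q x"
    using S continuous_on_eq_continuous_at by blast+
  then have "\<exists>d>0. \<forall>y. dist y x < d \<longrightarrow> \<bar>P y - P x\<bar> < ?e"
    "\<exists>d>0. \<forall>y. dist y x < d \<longrightarrow> \<bar>Q y - Q x\<bar> < ?e"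
    using e unfolding continuous_at_eps_delta dist_real_def by blast+
  then obtain d1 d2 where d: "d1 > 0" "d2 > 0"
    "\<And>y. dist y x < d1 \<Longrightarrow> \<bar>P y - P x\<bar> < ?e" "\<And>y. dist y x < d2 \<Longrightarrow> \<bar>Q y - Q x\<bar> < ?e"
    by metis
  obtain d3 where d3: "d3 > 0" "ball x d3 \<subseteq> S" using S open_contains_ball by blast
  define d where "d = min d1 (min d2 d3)"
  define N where "N = norm u + norm v + 1"
  \<comment> \<open>With this s, every point x + p u + q v with p, q at most s lies within d of x.\<close>
  define s where "s = d / N / 2"
  have n: "N > 0" unfolding N_def by (intro add_nonneg_pos add_nonneg_nonneg) simp_all
  have "d > 0" using d d3 by (simp add: d_def)
  then have s: "s > 0" using n by (simp add: s_def)
  have close: "dist (x + p *\<^sub>R u' + q *\<^sub>R v') x < d"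
    if "0 \<le> p" "p \<le> s" "0 \<le> q" "q \<le> s" "norm u' + norm v' = norm u + norm v" for p q u' v'
  proof -
    have "dist (x + p *\<^sub>R u' + q *\<^sub>R v') x \<le> p * norm u' + q * norm v'"
      using norm_triangle_ineq[of "p *\<^sub>R u'" "q *\<^sub>R v'"] that by (simp add: dist_norm)
    also have "\<dots> \<le> s * norm u' + s * norm v'"
      using that by (intro add_mono mult_right_mono) auto
    also have "\<dots> = s * (norm u + norm v)" using that(5) by (simp flip: distrib_left)
    also have "\<dots> \<le> s * N" using s by (simp add: N_def)
    also have "\<dots> = d / 2" using n by (simp add: s_def)
    finally show ?thesis using \<open>d > 0\<close> by linarith
  qed
  have sub: "x + p *\<^sub>R u' + q *\<^sub>R v' \<in> S"
    if "0 \<le> p" "p \<le> s" "0 \<le> q" "q \<le> s" "norm u' + norm v' = norm u + norm v" for p q u' v'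
    using close[OF that] d3(2) by (auto simp: d_def dist_commute)
  obtain p q where 1: "0 < p" "p < s" "0 < q" "q < s"
    "f (x + s *\<^sub>R u + s *\<^sub>R v) - f (x + s *\<^sub>R u) - f (x + s *\<^sub>R v) + f x
    = s * s * P (x + p *\<^sub>R u + q *\<^sub>R v)"
    using second_difference_mean_value[OF f s sub, of u v] unfolding P_def by auto
  obtain p' q' where 2: "0 < p'" "p' < s" "0 < q'" "q' < s"
    "f (x + s *\<^sub>R v + s *\<^sub>R u) - f (x + s *\<^sub>R v) - f (x + s *\<^sub>R u) + f x
    = s * s * Q (x + p' *\<^sub>R v + q' *\<^sub>R u)"
    using second_difference_mean_value[OF f s sub, of v u] unfolding Q_def by auto
  have sw: "x + s *\<^sub>R v + s *\<^sub>R u = x + s *\<^sub>R u + s *\<^sub>R v" by simp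
  have "s * s * P (x + p *\<^sub>R u + q *\<^sub>R v) = s * s * Q (x + p' *\<^sub>R v + q' *\<^sub>R u)"
    using 1(5) 2(5) unfolding sw by linarith
  then have PQ: "P (x + p *\<^sub>R u + q *\<^sub>R v) = Q (x + p' *\<^sub>R v + q' *\<^sub>R u)"
    using s by simp
  have "\<bar>P x - Q x\<bar> \<le> \<bar>P (x + p *\<^sub>R u + q *\<^sub>R v) - P x\<bar> + \<bar>Q (x + p' *\<^sub>R v + q' *\<^sub>R u) - Q x\<bar>"
    unfolding PQ by linarith
  moreover have "\<bar>P (x + p *\<^sub>R u + q *\<^sub>R v) - P x\<bar> < ?e"
    using close[of p q u v] 1 d(3) by (simp add: d_def)
  moreover have "\<bar>Q (x + p' *\<^sub>R v + q' *\<^sub>R u) - Q x\<bar> < ?e"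
    using close[of p' q' v u] 2 d(4) by (simp add: d_def)
  ultimately have "\<bar>P x - Q x\<bar> < ?e + ?e" by (meson add_strict_mono le_less_trans)
  then show False by simp
qed

lemma second_derivative_symmetric:
  fixes f :: "'a::real_normed_vector \<Rightarrow> 'b::real_inner"
  assumes f: "Ck_on 2 S f" and S: "open S" "x \<in> S"
  shows "deriv_at (\<lambda>y. deriv_at f y u) x v = deriv_at (\<lambda>y. deriv_at f y v) x u"
proof -
  have "deriv_at (\<lambda>y. deriv_at f y u) x v \<bullet> w = deriv_at (\<lambda>y. deriv_at f y v) x u \<bullet> w" for w
  proof -
    have f1: "(f has_derivative deriv_at f y) (at y)"
      and f2: "((\<lambda>y. deriv_at f y u) has_derivative deriv_at (\<lambda>y. deriv_at f y u) y) (at y)"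
      if "y \<in> S" for y u
      using f that by (auto simp: numeral_2_eq_2 frechet_derivative_works)
    have 1: "deriv_at (\<lambda>y. f y \<bullet> w) y = (\<lambda>h. deriv_at f y h \<bullet> w)" if "y \<in> S" for y
      using has_derivative_inner_left[OF f1[OF that]] frechet_derivative_at by metis
    have 2: "deriv_at (\<lambda>y. deriv_at (\<lambda>y. f y \<bullet> w) y u) x v = deriv_at (\<lambda>y. deriv_at f y u) x v \<bullet> w" for u v
    proof -
      have "((\<lambda>y. deriv_at f y u \<bullet> w) has_derivative (\<lambda>h. deriv_at (\<lambda>y. deriv_at f y u) x h \<bullet> w)) (at x)"
        using has_derivative_inner_left[OF f2[OF S(2)]] .
      moreover have "deriv_at (\<lambda>y. deriv_at (\<lambda>y. f y \<bullet> w) y u) x = deriv_at (\<lambda>y. deriv_at f y u \<bullet> w) x"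
        by (rule frechet_derivative_cong_open[OF S]) (simp add: 1)
      ultimately show ?thesis using frechet_derivative_at by metis
    qed
    have "Ck_on 2 S (\<lambda>y. f y \<bullet> w)"
      by (intro Ck_on_inner Ck_on_const f S)
    from second_derivative_symmetric_real[OF this S, of u v] show ?thesis by (simp add: 2)
  qed
  then show ?thesis using vector_eq_rdot by blast
qed

section \<open>Integral curves of Lipschitz vector fields\<close>

text \<open>A regularity that is enough for Picard's theorem, contains the \<open>C\<close>-1 maps and is preserved by
algebraic operations and by solving linear systems.\<close>

definition lipschitz_near :: "('a::metric_space \<Rightarrow> 'b::metric_space) \<Rightarrow> 'a \<Rightarrow> bool" where
  "lipschitz_near f x \<longleftrightarrow> (\<exists>r>0. \<exists>L. L-lipschitz_on (ball x r) f)"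

lemma lipschitz_near_const: "lipschitz_near (\<lambda>y. c) x"
  unfolding lipschitz_near_def by (intro exI[of _ 1] exI[of _ 0] conjI lipschitz_on_constant) simp

lemma lipschitz_near_compose:
  assumes "lipschitz_near f (g x)" "lipschitz_near g x"
  shows "lipschitz_near (\<lambda>y. f (g y)) x"
proof -
  obtain r L where f: "r > 0" "L-lipschitz_on (ball (g x) r) f"
    using assms(1) unfolding lipschitz_near_def by blast
  obtain s M where g: "s > 0" "M-lipschitz_on (ball x s) g"
    using assms(2) unfolding lipschitz_near_def by blast
  have M: "M \<ge> 0" using g(2) lipschitz_on_nonneg by blast
  define q where "q = min s (r / (M + 1))"
  have q: "q > 0" "q \<le> s" "M * q < r"
  proof -
    have "M * q \<le> M * (r / (M + 1))" using M by (intro mult_left_mono) (auto simp: q_def)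
    also have "\<dots> < r" using M f(1) by (simp add: field_simps)
    finally show "M * q < r" .
  qed (use M f(1) g(1) in \<open>auto simp: q_def\<close>)
  have gq: "M-lipschitz_on (ball x q) g" using g(2) q(2) lipschitz_on_subset by (metis subset_ball)
  have "g ` ball x q \<subseteq> ball (g x) r"
  proof safe
    fix y assume y: "y \<in> ball x q"
    have "dist (g x) (g y) \<le> M * dist x y" using lipschitz_onD[OF gq _ y] q(1) by simp
    also have "\<dots> \<le> M * q" using y M by (intro mult_left_mono) auto
    finally show "g y \<in> ball (g x) r" using q(3) by simp
  qed
  then have "L-lipschitz_on (g ` ball x q) f" using f(2) lipschitz_on_subset by blast
  then have "(L * M)-lipschitz_on (ball x q) (\<lambda>y. f (g y))"
    using lipschitz_on_compose2 gq by (simp add: lipschitz_on_compose2 mult.commute)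
  then show ?thesis unfolding lipschitz_near_def using q(1) by blast
qed

lemma (in bounded_linear) lipschitz_near_linear: "lipschitz_near f x"
proof -
  obtain B where "B-lipschitz_on (ball x 1) f" using lipschitz_boundE by blast
  then show ?thesis unfolding lipschitz_near_def by (metis zero_less_one)
qed

lemma lipschitz_near_bounded:
  fixes f :: "'a::metric_space \<Rightarrow> 'b::real_normed_vector"
  assumes "lipschitz_near f x"
  shows "\<exists>r>0. \<exists>L\<ge>0. \<exists>M\<ge>0. L-lipschitz_on (ball x r) f \<and> (\<forall>y\<in>ball x r. norm (f y) \<le> M)"
proof -
  obtain r L where f: "r > 0" "L-lipschitz_on (ball x r) f"
    using assms(1) unfolding lipschitz_near_def by blast
  have L: "L \<ge> 0" using f(2) lipschitz_on_nonneg by blast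
  have "norm (f y) \<le> norm (f x) + L * r" if y: "y \<in> ball x r" for y
  proof -
    have "dist (f x) (f y) \<le> L * dist x y" using lipschitz_onD[OF f(2) _ y] f(1) by simp
    also have "\<dots> \<le> L * r" using y L by (intro mult_left_mono) auto
    finally show ?thesis using norm_triangle_sub[of "f y" "f x"] by (simp add: dist_norm norm_minus_commute)
  qed
  moreover have "norm (f x) + L * r \<ge> 0" using L f(1) by simp
  ultimately show ?thesis using f L by blast
qed

lemma (in bounded_bilinear) lipschitz_near_product:
  assumes "lipschitz_near f x" "lipschitz_near g x"
  shows "lipschitz_near (\<lambda>y. prod (f y) (g y)) x"
proof -
  obtain r L M where f: "r > 0" "L \<ge> 0" "M \<ge> 0" "L-lipschitz_on (ball x r) f" "\<And>y. y \<in> ball x r \<Longrightarrow> norm (f y) \<le> M"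
    using lipschitz_near_bounded[OF assms(1)] by metis
  obtain r' L' M' where g: "r' > 0" "L' \<ge> 0" "M' \<ge> 0" "L'-lipschitz_on (ball x r') g" "\<And>y. y \<in> ball x r' \<Longrightarrow> norm (g y) \<le> M'"
    using lipschitz_near_bounded[OF assms(2)] by metis
  obtain K where K: "K \<ge> 0" "\<And>a b. norm (prod a b) \<le> norm a * norm b * K"
    using nonneg_bounded by blast
  define q where "q = min r r'"
  have "(K * (L * M' + M * L'))-lipschitz_on (ball x q) (\<lambda>y. prod (f y) (g y))"
  proof (rule lipschitz_onI)
    fix y z assume yz: "y \<in> ball x q" "z \<in> ball x q"
    have Lf: "norm (f y - f z) \<le> L * dist y z" and Lg: "norm (g y - g z) \<le> L' * dist y z"
      using lipschitz_onD[OF f(4), of y z] lipschitz_onD[OF g(4), of y z] yz by (auto simp: q_def dist_norm)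
    have "prod (f y) (g y) - prod (f z) (g z) = prod (f y - f z) (g y) + prod (f z) (g y - g z)"
      by (simp add: diff_left diff_right)
    then have "norm (prod (f y) (g y) - prod (f z) (g z)) \<le> norm (f y - f z) * norm (g y) * K + norm (f z) * norm (g y - g z) * K"
      using K(2) norm_triangle_le add_mono by metis
    also have "\<dots> \<le> (L * dist y z) * M' * K + M * (L' * dist y z) * K"
      using Lf Lg f(2,3,5) g(2,3,5) yz K(1)
      by (intro add_mono mult_right_mono mult_mono) (auto simp: q_def)
    finally show "dist (prod (f y) (g y)) (prod (f z) (g z)) \<le> K * (L * M' + M * L') * dist y z"
      by (simp add: dist_norm algebra_simps)
  qed (use f g K in auto)
  moreover have "q > 0" using f g by (simp add: q_def)
  ultimately show ?thesis unfolding lipschitz_near_def by blast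
qed

lemma lipschitz_near_Pair:
  assumes "lipschitz_near f x" "lipschitz_near g x"
  shows "lipschitz_near (\<lambda>y. (f y, g y)) x"
proof -
  obtain r L where f: "r > 0" "L-lipschitz_on (ball x r) f"
    using assms(1) unfolding lipschitz_near_def by blast
  obtain s M where g: "s > 0" "M-lipschitz_on (ball x s) g"
    using assms(2) unfolding lipschitz_near_def by blast
  have "L-lipschitz_on (ball x (min r s)) f" "M-lipschitz_on (ball x (min r s)) g"
    using f(2) g(2) lipschitz_on_subset by (metis min.cobounded1 min.cobounded2 subset_ball)+
  from lipschitz_on_Pair[OF this] show ?thesis
    unfolding lipschitz_near_def using f(1) g(1) by (metis min_less_iff_conj)
qed

lemma lipschitz_near_add:
  fixes f g :: "'a::metric_space \<Rightarrow> 'b::real_normed_vector"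
  assumes "lipschitz_near f x" "lipschitz_near g x"
  shows "lipschitz_near (\<lambda>y. f y + g y) x"
proof -
  have "bounded_linear (\<lambda>p. fst p + snd p :: 'b)"
    by (intro bounded_linear_add bounded_linear_fst bounded_linear_snd)
  from lipschitz_near_compose[OF bounded_linear.lipschitz_near_linear[OF this] lipschitz_near_Pair[OF assms]]
  show ?thesis by simp
qed

lemma lipschitz_near_diff:
  fixes f g :: "'a::metric_space \<Rightarrow> 'b::real_normed_vector"
  assumes "lipschitz_near f x" "lipschitz_near g x"
  shows "lipschitz_near (\<lambda>y. f y - g y) x"
proof -
  have "bounded_linear (\<lambda>p. fst p - snd p :: 'b)"
    by (intro bounded_linear_sub bounded_linear_fst bounded_linear_snd)
  from lipschitz_near_compose[OF bounded_linear.lipschitz_near_linear[OF this] lipschitz_near_Pair[OF assms]]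
  show ?thesis by simp
qed

lemma lipschitz_near_sum:
  fixes f :: "'i \<Rightarrow> 'a::metric_space \<Rightarrow> 'b::real_normed_vector"
  assumes "\<And>i. i \<in> I \<Longrightarrow> lipschitz_near (f i) x"
  shows "lipschitz_near (\<lambda>y. \<Sum>i\<in>I. f i y) x"
  using assms
  by (induction I rule: infinite_finite_induct) (auto intro: lipschitz_near_const lipschitz_near_add)

lemmas lipschitz_near_scaleR = bounded_bilinear.lipschitz_near_product[OF bounded_bilinear_scaleR]
  and lipschitz_near_inner = bounded_bilinear.lipschitz_near_product[OF bounded_bilinear_inner]

lemma lipschitz_near_cong:
  assumes "open S" "x \<in> S" "\<And>y. y \<in> S \<Longrightarrow> f y = g y" "lipschitz_near f x"
  shows "lipschitz_near g x"
proof -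
  obtain r L where f: "r > 0" "L-lipschitz_on (ball x r) f"
    using assms(4) unfolding lipschitz_near_def by blast
  obtain s where s: "s > 0" "ball x s \<subseteq> S" using assms(1,2) open_contains_ball by blast
  have "L-lipschitz_on (ball x (min r s)) f" 
    using f(2) lipschitz_on_subset by (metis min.cobounded1 subset_ball)
  then have "L-lipschitz_on (ball x (min r s)) g"
    by (rule lipschitz_on_transform) (use s(2) assms(3) in auto)
  then show ?thesis unfolding lipschitz_near_def using f(1) s(1) by (metis min_less_iff_conj)
qed

text \<open>On a compact ball the partial derivatives are bounded, which bounds the operator norm of the
derivative; the mean value inequality does the rest.\<close>

lemma Ck_on_lipschitz_near:
  fixes f :: "'a::euclidean_space \<Rightarrow> 'b::real_normed_vector"
  assumes f: "Ck_on 1 S f" and S: "open S" "x \<in> S"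
  shows "lipschitz_near f x"
proof -
  obtain r where r: "r > 0" "cball x r \<subseteq> S" using S open_contains_cball by blast
  have fd: "(f has_derivative deriv_at f y) (at y)" if "y \<in> S" for y
    using Ck_on_has_derivative[of 0] f that by simp
  have "\<exists>M. \<forall>y\<in>cball x r. norm (deriv_at f y b) \<le> M" for b
  proof -
    have "continuous_on (cball x r) (\<lambda>y. deriv_at f y b)"
      using f continuous_on_subset[OF _ r(2)] by auto
    then have "bounded ((\<lambda>y. deriv_at f y b) ` cball x r)"
      using compact_continuous_image compact_imp_bounded compact_cball by blast
    then show ?thesis by (auto simp: bounded_iff)
  qed
  then obtain M where M: "\<And>b y. y \<in> cball x r \<Longrightarrow> norm (deriv_at f y b) \<le> M b" by metis
  have "norm (f y - f z) \<le> (\<Sum>b\<in>Basis. M b) * norm (y - z)" if yz: "y \<in> cball x r" "z \<in> cball x r" for y z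
  proof (rule differentiable_bound[OF convex_cball _ _ yz])
    show "(f has_derivative deriv_at f w) (at w within cball x r)" if "w \<in> cball x r" for w
      using fd r(2) that has_derivative_at_withinI by blast
    show "onorm (deriv_at f w) \<le> (\<Sum>b\<in>Basis. M b)" if w: "w \<in> cball x r" for w
    proof (rule onorm_le)
      fix h :: 'a
      have "deriv_at f w h = (\<Sum>b\<in>Basis. (h \<bullet> b) *\<^sub>R deriv_at f w b)"
        by (rule linear_basis_expansion[OF has_derivative_linear[OF fd]]) (use w r(2) in blast)
      also have "norm \<dots> \<le> (\<Sum>b\<in>Basis. norm ((h \<bullet> b) *\<^sub>R deriv_at f w b))" by (rule norm_sum)
      also have "\<dots> \<le> (\<Sum>b\<in>Basis. norm h * M b)"
        using M[OF w] by (intro sum_mono) (auto intro!: mult_mono Basis_le_norm)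
      finally show "norm (deriv_at f w h) \<le> (\<Sum>b\<in>Basis. M b) * norm h"
        by (simp add: sum_distrib_left mult.commute)
    qed
  qed
  moreover have "(\<Sum>b\<in>Basis. M b) \<ge> 0"
    by (intro sum_nonneg) (use M[of x] r(1) norm_ge_zero order_trans in \<open>metis centre_in_cball less_imp_le\<close>)
  ultimately have "(\<Sum>b\<in>Basis. M b)-lipschitz_on (ball x r) f"
    by (auto intro!: lipschitz_onI simp: dist_norm)
  then show ?thesis unfolding lipschitz_near_def using r(1) by blast
qed

lemma lipschitz_near_linear_family:
  fixes A :: "'s::metric_space \<Rightarrow> 'e::euclidean_space \<Rightarrow> 'b::real_normed_vector"
  assumes "open S" "x \<in> S" "\<And>y. y \<in> S \<Longrightarrow> linear (A y)" "\<And>u. lipschitz_near (\<lambda>y. A y u) x"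
    "lipschitz_near a x"
  shows "lipschitz_near (\<lambda>y. A y (a y)) x"
proof (rule lipschitz_near_cong[OF assms(1,2)])
  show "(\<Sum>b\<in>Basis. (a y \<bullet> b) *\<^sub>R A y b) = A y (a y)" if "y \<in> S" for y
    using linear_basis_expansion[OF assms(3)[OF that]] by metis
  show "lipschitz_near (\<lambda>y. \<Sum>b\<in>Basis. (a y \<bullet> b) *\<^sub>R A y b) x"
    by (intro lipschitz_near_sum lipschitz_near_scaleR lipschitz_near_inner lipschitz_near_const assms)
qed

text \<open>Close to \<open>x\<close> the maps \<open>A y\<close> stay uniformly bounded below, since \<open>A x\<close> is injective. This bounds \<open>z\<close>,
and the Lipschitz estimate follows from
\<open>A y (z y - z y') = (k y - k y') - (A y - A y') (z y')\<close>.\<close>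

lemma lipschitz_near_linear_solution:
  fixes A :: "'s::metric_space \<Rightarrow> 'e::euclidean_space \<Rightarrow> 'b::euclidean_space"
  assumes S: "open S" "x \<in> S" and lin: "\<And>y. y \<in> S \<Longrightarrow> linear (A y)" and inj: "inj (A x)"
    and A: "\<And>u. lipschitz_near (\<lambda>y. A y u) x"
    and k: "lipschitz_near k x" and sol: "\<And>y. y \<in> S \<Longrightarrow> A y (z y) = k y"
  shows "lipschitz_near z x"
proof -
  have "\<forall>b. \<exists>r>0. \<exists>L. L-lipschitz_on (ball x r) (\<lambda>y. A y b)" using A unfolding lipschitz_near_def by blast
  then obtain \<rho> C where \<rho>: "\<And>b. \<rho> b > 0" and C: "\<And>b. (C b)-lipschitz_on (ball x (\<rho> b)) (\<lambda>y. A y b)" by metis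
  define c where "c = (\<Sum>b\<in>Basis. C b)"
  have Cn: "C b \<ge> 0" for b using C lipschitz_on_nonneg by blast
  have c: "c \<ge> 0" unfolding c_def by (intro sum_nonneg Cn)
  obtain r1 where r1: "r1 > 0" "ball x r1 \<subseteq> S" using S open_contains_ball by blast
  define r2 where "r2 = Min (\<rho> ` Basis)"
  have r2: "r2 > 0" and r2b: "\<And>b. b \<in> Basis \<Longrightarrow> r2 \<le> \<rho> b" using \<rho> by (auto simp: r2_def)
  have AL: "norm (A y u - A y' u) \<le> c * dist y y' * norm u"
    if y: "y \<in> ball x (min r1 r2)" "y' \<in> ball x (min r1 r2)" for y y' u
  proof -
    have yS: "y \<in> S" "y' \<in> S" using y r1(2) by auto
    have "A y u - A y' u = (\<Sum>b\<in>Basis. (u \<bullet> b) *\<^sub>R (A y b - A y' b))"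
      unfolding linear_basis_expansion[OF lin[OF yS(1)], of u] linear_basis_expansion[OF lin[OF yS(2)], of u]
      by (simp add: sum_subtractf scaleR_diff_right)
    also have "norm \<dots> \<le> (\<Sum>b\<in>Basis. norm ((u \<bullet> b) *\<^sub>R (A y b - A y' b)))" by (rule norm_sum)
    also have "\<dots> \<le> (\<Sum>b\<in>Basis. norm u * (C b * dist y y'))"
    proof (rule sum_mono)
      fix b :: 'e assume b: "b \<in> Basis"
      have "norm (A y b - A y' b) \<le> C b * dist y y'"
        using lipschitz_onD[OF C[of b], of y y'] y r2b[OF b] by (auto simp: dist_norm)
      then show "norm ((u \<bullet> b) *\<^sub>R (A y b - A y' b)) \<le> norm u * (C b * dist y y')"
        using b by (auto intro!: mult_mono Basis_le_norm)
    qed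
    finally show ?thesis by (simp add: c_def sum_distrib_left sum_distrib_right algebra_simps)
  qed
  obtain m where m: "m > 0" "\<And>u. norm (A x u) \<ge> m * norm u"
    using linear_inj_bounded_below_pos[OF lin[OF S(2)] inj] by blast
  obtain r3 N M where kk: "r3 > 0" "N \<ge> 0" "M \<ge> 0" "N-lipschitz_on (ball x r3) k" "\<And>y. y \<in> ball x r3 \<Longrightarrow> norm (k y) \<le> M"
    using lipschitz_near_bounded[OF k] by metis
  \<comment> \<open>Within m / (2 (c + 1)) of x, the map A y differs from A x by at most m / 2 in operator norm,
    so it keeps the lower bound m / 2.\<close>
  define r where "r = min (min r1 r2) (min r3 (m / (2 * (c + 1))))"
  have r: "r > 0" using r1 r2 kk m c by (simp add: r_def)
  have sub: "y \<in> ball x (min r1 r2)" "y \<in> ball x r3" "y \<in> S" if "y \<in> ball x r" for y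
    using that r1(2) by (auto simp: r_def)
  have low: "m / 2 * norm u \<le> norm (A y u)" if y: "y \<in> ball x r" for y u
  proof -
    have "norm (A x u - A y u) \<le> c * dist x y * norm u" using AL sub[OF y] r1(1) r2 by simp
    also have "\<dots> \<le> (m / 2) * norm u"
    proof (rule mult_right_mono)
      have "c * dist x y \<le> c * (m / (2 * (c + 1)))" using y c by (intro mult_left_mono) (auto simp: r_def)
      also have "\<dots> \<le> m / 2" using c m(1) by (simp add: field_simps)
      finally show "c * dist x y \<le> m / 2" .
    qed simp
    finally have "norm (A x u - A y u) \<le> m / 2 * norm u" .
    then show ?thesis using m(2)[of u] norm_triangle_ineq2[of "A x u" "A y u"] by simp
  qed
  define Z where "Z = 2 / m * M"
  have Z: "Z \<ge> 0" using m(1) kk(3) by (simp add: Z_def)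
  have zb: "norm (z y) \<le> Z" if y: "y \<in> ball x r" for y
    using low[OF y, of "z y"] kk(5)[OF sub(2)[OF y]] sol[OF sub(3)[OF y]] m(1) by (simp add: Z_def field_simps)
  have "(2 / m * (N + c * Z))-lipschitz_on (ball x r) z"
  proof (rule lipschitz_onI)
    fix y y' assume y: "y \<in> ball x r" and y': "y' \<in> ball x r"
    have "A y (z y - z y') = (k y - k y') - (A y (z y') - A y' (z y'))"
      using sol[OF sub(3)[OF y]] sol[OF sub(3)[OF y']] linear_diff[OF lin[OF sub(3)[OF y]]] by simp
    then have "norm (A y (z y - z y')) \<le> norm (k y - k y') + norm (A y (z y') - A y' (z y'))"
      using norm_triangle_ineq4 by metis
    also have "\<dots> \<le> N * dist y y' + c * dist y y' * Z"
    proof (rule add_mono)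
      show "norm (k y - k y') \<le> N * dist y y'"
        using lipschitz_onD[OF kk(4) sub(2)[OF y] sub(2)[OF y']] by (simp add: dist_norm)
      have "norm (A y (z y') - A y' (z y')) \<le> c * dist y y' * norm (z y')"
        using AL sub y y' by blast
      also have "\<dots> \<le> c * dist y y' * Z" using zb[OF y'] c by (intro mult_left_mono) auto
      finally show "norm (A y (z y') - A y' (z y')) \<le> c * dist y y' * Z" .
    qed
    finally have "m / 2 * norm (z y - z y') \<le> (N + c * Z) * dist y y'"
      using low[OF y, of "z y - z y'"] by (simp add: algebra_simps)
    then have "norm (z y - z y') \<le> 2 / m * ((N + c * Z) * dist y y')"
      using m(1) by (simp add: field_simps)
    then show "dist (z y) (z y') \<le> 2 / m * (N + c * Z) * dist y y'"
      by (simp only: dist_norm mult.assoc)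
  qed (use m(1) kk c Z in auto)
  then show ?thesis unfolding lipschitz_near_def using r by blast
qed

text \<open>The vector field is made globally Lipschitz by composing it with the closest point projection onto a
small ball; the integral equation for the modified field is solved by Banach's fixed point theorem
in the space of bounded continuous functions, and for short times the solution stays in the ball.\<close>

lemma picard_local_existence:
  fixes f :: "'v::euclidean_space \<Rightarrow> 'v"
  assumes "lipschitz_near f x0"
  shows "\<exists>\<delta>>0. \<exists>\<phi>. \<phi> 0 = x0 \<and> (\<forall>t\<in>{-\<delta><..<\<delta>}. (\<phi> has_vector_derivative f (\<phi> t)) (at t))"
proof -
  obtain r L where r: "r > 0" and L: "L-lipschitz_on (ball x0 r) f"
    using assms unfolding lipschitz_near_def by blast
  have L0: "L \<ge> 0" using L lipschitz_on_nonneg by blast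
  define C where "C = cball x0 (r / 2)"
  have C: "convex C" "closed C" "C \<noteq> {}" "C \<subseteq> ball x0 r" "x0 \<in> C"
    using r by (auto simp: C_def)
  define G where "G y = f (closest_point C y)" for y
  have G: "L-lipschitz_on UNIV G"
  proof (rule lipschitz_onI)
    fix y z
    have "dist (G y) (G z) \<le> L * dist (closest_point C y) (closest_point C z)"
      unfolding G_def using closest_point_in_set[OF C(2,3)] C(4) by (intro lipschitz_onD[OF L]) blast+
    also have "\<dots> \<le> L * dist y z" using L0 closest_point_lipschitz[OF C(1-3)] by (intro mult_left_mono)
    finally show "dist (G y) (G z) \<le> L * dist y z" .
  qed (rule L0)
  have Gc: "continuous_on UNIV G" using G lipschitz_on_continuous_on by blast
  \<comment> \<open>The two integrals in H below extend over intervals of total length at most 3 \<delta>, so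
    the contraction constant is 3 \<delta> L.\<close>
  define \<delta> where "\<delta> = 1 / (4 * (L + 1))"
  have \<delta>: "\<delta> > 0" "3 * \<delta> * L \<le> 3 / 4" using L0 by (auto simp: \<delta>_def field_simps)
  \<comment> \<open>Clamping the time extends functions on a compact interval to bounded functions on the line.\<close>
  define cl where "cl t = max (-\<delta>) (min \<delta> t)" for t
  have cl: "cl t \<in> {-\<delta>..\<delta>}" "continuous_on UNIV cl" for t
    using \<delta>(1) by (auto simp: cl_def intro!: continuous_intros)
  have hc: "continuous_on T (\<lambda>s. G (apply_bcontfun \<phi> s))" for \<phi> :: "real \<Rightarrow>\<^sub>C 'v" and T
    by (rule continuous_on_compose2[OF Gc]) auto
  have hi: "(\<lambda>s. G (apply_bcontfun \<phi> s)) integrable_on {a..b}" for \<phi> :: "real \<Rightarrow>\<^sub>C 'v" and a b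
    by (rule integrable_continuous_real[OF hc])
  \<comment> \<open>The difference of integrals from -\<delta> is the oriented integral from 0 to t, of either sign.\<close>
  define H where "H \<phi> t = x0 + integral {-\<delta>..t} (\<lambda>s. G (apply_bcontfun \<phi> s)) - integral {-\<delta>..0} (\<lambda>s. G (apply_bcontfun \<phi> s))"
    for \<phi> :: "real \<Rightarrow>\<^sub>C 'v" and t
  have Hb: "(\<lambda>t. H \<phi> (cl t)) \<in> bcontfun" for \<phi>
  proof -
    have Hc: "continuous_on {-\<delta>..\<delta>} (H \<phi>)"
      unfolding H_def by (intro continuous_intros indefinite_integral_continuous_1 hi)
    then have "bounded (H \<phi> ` {-\<delta>..\<delta>})" by (intro compact_imp_bounded compact_continuous_image) auto
    then have "bounded (range (\<lambda>t. H \<phi> (cl t)))" by (rule bounded_subset) (use cl(1) in auto)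
    moreover have "continuous_on UNIV (\<lambda>t. H \<phi> (cl t))"
      by (rule continuous_on_compose2[OF Hc cl(2)]) (use cl(1) in auto)
    ultimately show ?thesis by (simp add: bcontfun_def)
  qed
  define T where "T \<phi> = Bcontfun (\<lambda>t. H \<phi> (cl t))" for \<phi>
  have T: "apply_bcontfun (T \<phi>) t = H \<phi> (cl t)" for \<phi> t
    unfolding T_def by (simp add: Bcontfun_inverse[OF Hb])
  have contr: "dist (T \<phi>) (T \<psi>) \<le> 3 / 4 * dist \<phi> \<psi>" for \<phi> \<psi>
  proof (rule dist_bound)
    fix t
    let ?d = "\<lambda>s. G (apply_bcontfun \<phi> s) - G (apply_bcontfun \<psi> s)"
    have dn: "norm (?d s) \<le> L * dist \<phi> \<psi>" for s
    proof -
      have "norm (?d s) \<le> L * dist (apply_bcontfun \<phi> s) (apply_bcontfun \<psi> s)"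
        using lipschitz_onD[OF G] by (simp add: dist_norm)
      also have "\<dots> \<le> L * dist \<phi> \<psi>" using L0 dist_bounded by (intro mult_left_mono) auto
      finally show ?thesis .
    qed
    have ib: "norm (integral {-\<delta>..b} ?d) \<le> L * dist \<phi> \<psi> * (b + \<delta>)" if "-\<delta> \<le> b" for b
      using integral_bound[OF that continuous_on_diff[OF hc hc] dn] by simp
    have "apply_bcontfun (T \<phi>) t - apply_bcontfun (T \<psi>) t = integral {-\<delta>..cl t} ?d - integral {-\<delta>..0} ?d"
      by (simp add: T H_def integral_diff[OF hi hi])
    then have "dist (apply_bcontfun (T \<phi>) t) (apply_bcontfun (T \<psi>) t) \<le> norm (integral {-\<delta>..cl t} ?d) + norm (integral {-\<delta>..0} ?d)"
      by (simp add: dist_norm norm_triangle_ineq4)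
    also have "\<dots> \<le> L * dist \<phi> \<psi> * (2 * \<delta>) + L * dist \<phi> \<psi> * \<delta>"
      using ib[of "cl t"] ib[of 0] cl(1)[of t] \<delta>(1) L0
      by (intro add_mono order_trans[OF ib] mult_left_mono) auto
    also have "\<dots> = 3 * \<delta> * L * dist \<phi> \<psi>" by simp
    also have "\<dots> \<le> 3 / 4 * dist \<phi> \<psi>" by (rule mult_right_mono[OF \<delta>(2)]) simp
    finally show "dist (apply_bcontfun (T \<phi>) t) (apply_bcontfun (T \<psi>) t) \<le> 3 / 4 * dist \<phi> \<psi>" .
  qed
  obtain \<phi> where \<phi>: "T \<phi> = \<phi>" using banach_fix_type[of "3 / 4" T] contr by auto
  let ?\<phi> = "apply_bcontfun \<phi>"
  have eq: "?\<phi> t = H \<phi> t" if "t \<in> {-\<delta><..<\<delta>}" for t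
    using T[of \<phi> t] that by (simp add: \<phi> cl_def)
  have der: "(?\<phi> has_vector_derivative G (?\<phi> t)) (at t)" if t: "t \<in> {-\<delta><..<\<delta>}" for t
  proof -
    have "((\<lambda>t. integral {-\<delta>..t} (\<lambda>s. G (?\<phi> s))) has_vector_derivative G (?\<phi> t)) (at t within {-\<delta>..\<delta>})"
      by (rule integral_has_vector_derivative[OF hc]) (use t in auto)
    then have "((\<lambda>t. integral {-\<delta>..t} (\<lambda>s. G (?\<phi> s))) has_vector_derivative G (?\<phi> t)) (at t)"
      using t at_within_interior[of t "{-\<delta>..\<delta>}"] by simp
    then have "(H \<phi> has_vector_derivative G (?\<phi> t)) (at t)"
      unfolding H_def by (auto intro!: derivative_eq_intros)
    then show ?thesis
      by (rule has_vector_derivative_transform_within_open[of _ _ _ "{-\<delta><..<\<delta>}"]) (use t eq in auto)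
  qed
  have "isCont ?\<phi> 0" using continuous_on_apply_bcontfun[of UNIV \<phi>] continuous_on_eq_continuous_at by blast
  moreover have \<phi>0: "?\<phi> 0 = x0" using eq[of 0] \<delta>(1) by (simp add: H_def)
  ultimately obtain d where d: "d > 0" "\<And>t. \<bar>t\<bar> < d \<Longrightarrow> dist (?\<phi> t) x0 < r / 2"
    using r unfolding continuous_at_eps_delta dist_real_def by (metis diff_zero half_gt_zero)
  have "(?\<phi> has_vector_derivative f (?\<phi> t)) (at t)" if t: "t \<in> {-min d \<delta><..<min d \<delta>}" for t
  proof -
    have "\<bar>t\<bar> < d" using t by auto
    then have "?\<phi> t \<in> C" using d(2)[of t] by (auto simp: C_def dist_commute)
    then have "G (?\<phi> t) = f (?\<phi> t)" by (simp add: G_def closest_point_self)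
    then show ?thesis using der[of t] t by auto
  qed
  then show ?thesis using \<phi>0 d(1) \<delta>(1) by (intro exI[of _ "min d \<delta>"] conjI exI[of _ ?\<phi>]) auto
qed

section \<open>Symmetric multilinear forms on lists\<close>

text \<open>The common shape of the symmetric product with a vector, of the correction terms in a covariant
derivative of tensors and of the derivation induced by an endomorphism: each entry in turn is
singled out and the remaining entries keep their order.\<close>

definition slot_sum :: "('a \<Rightarrow> 'a list \<Rightarrow> real) \<Rightarrow> 'a list \<Rightarrow> real" where
  "slot_sum h ws = (\<Sum>j<length ws. h (ws ! j) (take j ws @ drop (Suc j) ws))"

text \<open>Linearity is required in the first slot only; symmetry transports it to the others.\<close>

definition sym_multilinear :: "nat \<Rightarrow> ('e::real_vector list \<Rightarrow> real) \<Rightarrow> bool" where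
  "sym_multilinear n T \<longleftrightarrow>
     (\<forall>us vs. length us = n \<longrightarrow> mset us = mset vs \<longrightarrow> T us = T vs) \<and>
     (\<forall>us. Suc (length us) = n \<longrightarrow> linear (\<lambda>u. T (u # us)))"

lemma sym_multilinear_perm:
  "sym_multilinear n T \<Longrightarrow> length us = n \<Longrightarrow> mset us = mset vs \<Longrightarrow> T us = T vs"
  unfolding sym_multilinear_def by blast

lemma sym_multilinear_linear:
  "sym_multilinear n T \<Longrightarrow> Suc (length us) = n \<Longrightarrow> linear (\<lambda>u. T (u # us))"
  unfolding sym_multilinear_def by blast

lemma sym_multilinear_0: "sym_multilinear 0 T"
  unfolding sym_multilinear_def by simp

lemma sym_multilinear_diff:
  "sym_multilinear n S \<Longrightarrow> sym_multilinear n T \<Longrightarrow> sym_multilinear n (\<lambda>us. S us - T us)"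
  unfolding sym_multilinear_def by (simp add: linear_compose_sub)

lemma sym_multilinear_add:
  "sym_multilinear n S \<Longrightarrow> sym_multilinear n T \<Longrightarrow> sym_multilinear n (\<lambda>us. S us + T us)"
  unfolding sym_multilinear_def by (simp add: linear_compose_add)

lemma sym_multilinear_Cons:
  assumes "sym_multilinear (Suc n) T"
  shows "sym_multilinear n (\<lambda>us. T (w # us))"
  unfolding sym_multilinear_def
proof (intro conjI allI impI)
  show "T (w # us) = T (w # vs)" if "length us = n" "mset us = mset vs" for us vs
    using sym_multilinear_perm[OF assms, of "w # us" "w # vs"] that by simp
  show "linear (\<lambda>u. T (w # u # us))" if "Suc (length us) = n" for us
  proof -
    have "T (w # u # us) = T (u # w # us)" for u
      using sym_multilinear_perm[OF assms, of "w # u # us" "u # w # us"] that by simp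
    then show ?thesis using sym_multilinear_linear[OF assms, of "w # us"] that by simp
  qed
qed

lemma mset_delete_nth:
  assumes "j < length ws"
  shows "mset (take j ws @ drop (Suc j) ws) = mset ws - {#ws ! j#}"
proof -
  have "mset ws = mset (take j ws @ ws ! j # drop (Suc j) ws)"
    using id_take_nth_drop[OF assms] by simp
  then show ?thesis by simp
qed

text \<open>The summand depends only on the chosen entry and on the multiset of the others, so that the sum is
a sum over the multiset of all entries.\<close>

lemma slot_sum_perm:
  assumes "\<And>w us vs. length us = n \<Longrightarrow> mset us = mset vs \<Longrightarrow> h w us = h w vs"
    and "length ws = Suc n" "mset ws = mset ws'"
  shows "slot_sum h ws = slot_sum h ws'"
proof -
  define k where "k M w = h w (SOME us. mset us = M - {#w#})" for M w
  have "slot_sum h vs = sum_mset (image_mset (k (mset vs)) (mset vs))" if vs: "length vs = Suc n" for vs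
  proof -
    have "h (vs ! j) (take j vs @ drop (Suc j) vs) = k (mset vs) (vs ! j)" if j: "j < length vs" for j
    proof -
      let ?us = "SOME us. mset us = mset vs - {#vs ! j#}"
      have "mset ?us = mset vs - {#vs ! j#}" by (rule someI) (rule mset_delete_nth[OF j])
      then have "mset (take j vs @ drop (Suc j) vs) = mset ?us" using mset_delete_nth[OF j] by simp
      moreover have "length (take j vs @ drop (Suc j) vs) = n" using vs j by simp
      ultimately show ?thesis unfolding k_def using assms(1) by blast
    qed
    then have "slot_sum h vs = (\<Sum>j<length vs. k (mset vs) (vs ! j))"
      unfolding slot_sum_def by (intro sum.cong) auto
    also have "\<dots> = sum_list (map (k (mset vs)) vs)"
      by (simp add: sum_list_sum_nth atLeast0LessThan)
    also have "\<dots> = sum_mset (image_mset (k (mset vs)) (mset vs))"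
      by (metis mset_map sum_mset_sum_list)
    finally show ?thesis .
  qed
  from this[of ws] this[of ws'] show ?thesis using assms(2,3) by (metis size_mset)
qed

lemma slot_sum_replicate:
  "slot_sum h (replicate (Suc n) u) = real (Suc n) * h u (replicate n u)"
proof -
  have "take j (replicate (Suc n) u) @ drop (Suc j) (replicate (Suc n) u) = replicate n u"
    if "j < Suc n" for j
    using that by (simp del: replicate_Suc add: take_replicate drop_replicate min_def flip: replicate_add)
  then have "slot_sum h (replicate (Suc n) u) = (\<Sum>j<Suc n. h u (replicate n u))"
    unfolding slot_sum_def by (intro sum.cong) (auto simp del: replicate_Suc)
  then show ?thesis by simp
qed

lemma slot_sum_Cons:
  "slot_sum h (w # ws) = h w ws + (\<Sum>j<length ws. h (ws ! j) (w # take j ws @ drop (Suc j) ws))"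
  unfolding slot_sum_def by (simp del: sum.lessThan_Suc add: sum.lessThan_Suc_shift)

lemma slot_sum_map: "slot_sum (\<lambda>w r. h (f w) (map f r)) ws = slot_sum h (map f ws)"
  unfolding slot_sum_def by (intro sum.cong) (auto simp: take_map drop_map)

lemma slot_sum_cong:
  "(\<And>w r. w \<in> set ws \<Longrightarrow> set r \<subseteq> set ws \<Longrightarrow> Suc (length r) = length ws \<Longrightarrow> h w r = k w r) \<Longrightarrow>
     slot_sum h ws = slot_sum k ws"
  unfolding slot_sum_def
proof (rule sum.cong[OF refl])
  fix j assume h: "\<And>w r. w \<in> set ws \<Longrightarrow> set r \<subseteq> set ws \<Longrightarrow> Suc (length r) = length ws \<Longrightarrow> h w r = k w r"
    and j: "j \<in> {..<length ws}"
  show "h (ws ! j) (take j ws @ drop (Suc j) ws) = k (ws ! j) (take j ws @ drop (Suc j) ws)"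
    by (rule h) (use j in \<open>auto dest: in_set_takeD in_set_dropD\<close>)
qed

text \<open>Both sides of the equation between tensors have this shape in a chart; they are symmetric and
multilinear, as polarization requires, although the summands single out an entry.\<close>

lemma slot_sum_multilinear:
  assumes h: "\<And>w. sym_multilinear n (h w)" and lin: "\<And>us. length us = n \<Longrightarrow> linear (\<lambda>w. h w us)"
  shows "sym_multilinear (Suc n) (slot_sum h)"
  unfolding sym_multilinear_def
proof (intro conjI allI impI)
  show "slot_sum h us = slot_sum h vs" if "length us = Suc n" "mset us = mset vs" for us vs
    using slot_sum_perm[of n h] sym_multilinear_perm[OF h] that by blast
  show "linear (\<lambda>u. slot_sum h (u # us))" if us: "Suc (length us) = Suc n" for us
    unfolding slot_sum_Cons
  proof (intro linear_compose_add lin linear_compose_sum ballI)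
    fix j assume "j \<in> {..<length us}"
    then show "linear (\<lambda>u. h (us ! j) (u # take j us @ drop (Suc j) us))"
      using us by (intro sym_multilinear_linear[OF h]) auto
  qed (use us in simp)
qed

text \<open>Differentiating \<open>T\<^sub>y(a, \<dots>, a)\<close> gives the derivative in \<open>y\<close> with frozen arguments and one term for each
argument; by symmetry these \<open>n\<close> terms agree. The induction peels off the first argument, in which
\<open>T\<^sub>y\<close> is a family of linear maps.\<close>

lemma has_derivative_diagonal:
  fixes T :: "'s::real_normed_vector \<Rightarrow> 'e::euclidean_space list \<Rightarrow> real"
  assumes S: "open S" "x \<in> S" and T: "\<And>y. y \<in> S \<Longrightarrow> sym_multilinear n (T y)"
    and D: "\<And>us. length us = n \<Longrightarrow> ((\<lambda>y. T y us) has_derivative (\<lambda>h. D h us)) (at x)"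
    and a: "(a has_derivative a') (at x)"
  shows "((\<lambda>y. T y (replicate n (a y))) has_derivative
    (\<lambda>h. D h (replicate n (a x)) + n * T x (a' h # replicate (n - 1) (a x)))) (at x)"
  using T D
proof (induction n arbitrary: T D)
  case 0
  then show ?case by simp
next
  case (Suc n)
  have "((\<lambda>y. T y (w # replicate n (a y))) has_derivative
    (\<lambda>h. D h (w # replicate n (a x)) + n * T x (w # a' h # replicate (n - 1) (a x)))) (at x)" for w
    by (rule Suc.IH[of "\<lambda>y us. T y (w # us)" "\<lambda>h us. D h (w # us)"])
      (use Suc.prems in \<open>auto intro: sym_multilinear_Cons\<close>)
  note d = this
  have l: "linear (\<lambda>w. T y (w # replicate n (a y)))" if "y \<in> S" for y
    by (rule sym_multilinear_linear[OF Suc.prems(1)[OF that]]) simp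
  have "((\<lambda>y. T y (a y # replicate n (a y))) has_derivative
    (\<lambda>h. D h (a x # replicate n (a x)) + n * T x (a x # a' h # replicate (n - 1) (a x)) +
        T x (a' h # replicate n (a x)))) (at x)"
    using has_derivative_linear_family[where L = "\<lambda>y w. T y (w # replicate n (a y))"
      and D = "\<lambda>h w. D h (w # replicate n (a x)) + n * T x (w # a' h # replicate (n - 1) (a x))",
      OF S l d a] .
  moreover have eq: "n * T x (a x # a' h # replicate (n - 1) (a x)) = n * T x (a' h # replicate n (a x))" for h
  proof (cases n)
    case (Suc m)
    then show ?thesis
      using sym_multilinear_perm[OF Suc.prems(1)[OF S(2)], of "a x # a' h # replicate m (a x)"
          "a' h # a x # replicate m (a x)"] by simp
  qed simp
  ultimately show ?case unfolding eq by (simp add: algebra_simps)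
qed

text \<open>The derivative of \<open>T(u + s w, \<dots>, u + s w) = 0\<close> at \<open>s = 0\<close> is \<open>n T(w, u, \<dots>, u)\<close>. Hence the form obtained
by fixing the first argument \<open>w\<close> vanishes on the diagonal too, and induction on the degree applies.\<close>

lemma sym_multilinear_polarization:
  fixes T :: "'e::euclidean_space list \<Rightarrow> real"
  assumes "sym_multilinear n T" "\<And>u. T (replicate n u) = 0" "length us = n"
  shows "T us = 0"
  using assms
proof (induction n arbitrary: T us)
  case 0
  then show ?case by simp
next
  case (Suc n)
  then obtain w ws where us: "us = w # ws" "length ws = n" by (metis length_Suc_conv)
  have "T (w # replicate n u) = 0" for u
  proof -
    have "((\<lambda>s. u + s *\<^sub>R w) has_derivative (\<lambda>h. h *\<^sub>R w)) (at 0)"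
      by (auto intro!: derivative_eq_intros)
    from has_derivative_diagonal[where S = UNIV and T = "\<lambda>_. T" and D = "\<lambda>_ _. 0", OF open_UNIV UNIV_I Suc.prems(1) _ this]
    have "((\<lambda>s::real. T (replicate (Suc n) (u + s *\<^sub>R w))) has_derivative
      (\<lambda>h. Suc n * T ((h *\<^sub>R w) # replicate n u))) (at 0)" by simp
    moreover have "((\<lambda>s::real. T (replicate (Suc n) (u + s *\<^sub>R w))) has_derivative (\<lambda>h. 0)) (at 0)"
      unfolding Suc.prems(2) by simp
    ultimately have "(\<lambda>h::real. Suc n * T ((h *\<^sub>R w) # replicate n u)) = (\<lambda>h. 0)"
      by (rule has_derivative_unique)
    from fun_cong[OF this, of 1] show ?thesis by simp
  qed
  then show ?case using Suc.IH[OF sym_multilinear_Cons[OF Suc.prems(1)], of w ws] us by simp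
qed

lemma sym_multilinear_homogeneous:
  "sym_multilinear n T \<Longrightarrow> T (replicate n (s *\<^sub>R u)) = s ^ n * T (replicate n u)"
proof (induction n arbitrary: T)
  case (Suc n)
  have "T ((s *\<^sub>R u) # replicate n (s *\<^sub>R u)) = s * T (u # replicate n (s *\<^sub>R u))"
    using linear_scale[OF sym_multilinear_linear[OF Suc.prems, of "replicate n (s *\<^sub>R u)"]] by simp
  then show ?case using Suc.IH[OF sym_multilinear_Cons[OF Suc.prems], of u] by simp
qed simp

text \<open>At \<open>s u\<close> the sum is a polynomial in \<open>s\<close> whose coefficients are the diagonal values of the \<open>E i\<close> at
\<open>u\<close>, up to the factors \<open>c i\<close>; an identically vanishing polynomial has vanishing coefficients.\<close>

lemma graded_polarization:
  fixes E :: "nat \<Rightarrow> 'e::euclidean_space list \<Rightarrow> real"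
  assumes E: "\<And>i. i \<le> l \<Longrightarrow> sym_multilinear (Suc i) (E i)"
    and zero: "\<And>u. (\<Sum>i\<le>l. E i (replicate (Suc i) u) / c i) = 0"
    and c: "\<And>i. c i \<noteq> 0" and "i \<le> l" "length us = Suc i"
  shows "E i us = 0"
proof (rule sym_multilinear_polarization[OF E[OF \<open>i \<le> l\<close>] _ \<open>length us = Suc i\<close>])
  fix u
  \<comment> \<open>The terms have degrees 1 to l + 1; the polynomial gets the constant coefficient 0.\<close>
  define q where "q j = (case j of 0 \<Rightarrow> 0 | Suc i \<Rightarrow> E i (replicate (Suc i) u) / c i)" for j
  have "(\<Sum>j\<le>Suc l. q j * s ^ j) = 0" for s
  proof -
    have "(\<Sum>j\<le>Suc l. q j * s ^ j) = (\<Sum>i\<le>l. q (Suc i) * s ^ Suc i)"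
      by (simp add: sum.atMost_Suc_shift q_def del: sum.atMost_Suc)
    also have "\<dots> = (\<Sum>i\<le>l. E i (replicate (Suc i) (s *\<^sub>R u)) / c i)"
      using sym_multilinear_homogeneous[OF E] by (intro sum.cong) (auto simp: q_def simp del: replicate_Suc power_Suc)
    finally show ?thesis using zero by simp
  qed
  then have "\<forall>j\<le>Suc l. q j = 0" using polyfun_eq_0[of q "Suc l"] by blast
  then have "q (Suc i) = 0" using \<open>i \<le> l\<close> by simp
  then show "E i (replicate (Suc i) u) = 0" using c by (simp add: q_def)
qed

section \<open>Orthonormal bases of an inner product\<close>

text \<open>An inner product on the model space, namely the metric at one point in a chart; it differs from the
inner product that comes with the type.\<close>

locale inner_form =
  fixes B :: "'e::euclidean_space \<Rightarrow> 'e \<Rightarrow> real"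
  assumes bilin: "bilinear B" and sym: "B v w = B w v" and pos: "v \<noteq> 0 \<Longrightarrow> B v v > 0"
begin

definition orthonormal :: "nat \<Rightarrow> (nat \<Rightarrow> 'e) \<Rightarrow> bool" where
  "orthonormal k e \<longleftrightarrow> (\<forall>i<k. \<forall>j<k. B (e i) (e j) = (if i = j then 1 else 0))"

lemma lin: "linear (\<lambda>v. B v w)" "linear (B v)"
  using bilin unfolding bilinear_def by auto

lemma orthonormal_coefficient:
  assumes "orthonormal k e" "j < k"
  shows "B (e j) (\<Sum>i<k. a i *\<^sub>R e i) = a j"
proof -
  have "B (e j) (\<Sum>i<k. a i *\<^sub>R e i) = (\<Sum>i<k. a i * B (e j) (e i))"
    by (simp add: linear_sum[OF lin(2)] linear_scale[OF lin(2)])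
  also have "\<dots> = (\<Sum>i<k. if i = j then a i else 0)"
    using assms by (intro sum.cong) (auto simp: orthonormal_def)
  finally show ?thesis using assms(2) by simp
qed

text \<open>The Gram--Schmidt step: subtract from a vector outside the span its components and normalize.\<close>

lemma orthonormal_exists: "k \<le> DIM('e) \<Longrightarrow> \<exists>e. orthonormal k e"
proof (induction k)
  case 0
  then show ?case by (simp add: orthonormal_def)
next
  case (Suc k)
  then obtain e where e: "orthonormal k e" by auto
  have "dim (e ` {..<k}) \<le> k"
    by (rule order_trans[OF dim_le_card'[OF finite_imageI]]) (auto intro: order_trans[OF card_image_le])
  then have "span (e ` {..<k}) \<noteq> UNIV" using Suc.prems dim_eq_full[of "e ` {..<k}"] by auto
  then obtain v where v: "v \<notin> span (e ` {..<k})" by blast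
  define z where "z = v - (\<Sum>i<k. B (e i) v *\<^sub>R e i)"
  have "(\<Sum>i<k. B (e i) v *\<^sub>R e i) \<in> span (e ` {..<k})"
    by (intro span_sum span_scale span_base) auto
  then have "z \<noteq> 0" using v by (auto simp: z_def)
  then have zz: "B z z > 0" by (rule pos)
  have ez: "B (e j) z = 0" if "j < k" for j
    using orthonormal_coefficient[OF e that] by (simp add: z_def linear_diff[OF lin(2)])
  then have ze: "B z (e j) = 0" if "j < k" for j using that sym by metis
  define n where "n = (1 / sqrt (B z z)) *\<^sub>R z"
  have "B n n = 1" using zz
    by (simp add: n_def linear_scale[OF lin(1)] linear_scale[OF lin(2)])
  moreover have "B n (e j) = 0" "B (e j) n = 0" if "j < k" for j
    using ez[OF that] ze[OF that] by (simp_all add: n_def linear_scale[OF lin(1)] linear_scale[OF lin(2)])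
  ultimately have "orthonormal (Suc k) (e(k := n))"
    using e by (auto simp: orthonormal_def less_Suc_eq)
  then show ?case by blast
qed

text \<open>Orthonormal vectors are independent, so that as many as the dimension span the space; the difference
of the two sides is orthogonal to all of them, hence to itself.\<close>

lemma orthonormal_expansion:
  assumes e: "orthonormal DIM('e) e"
  shows "(\<Sum>i<DIM('e). B (e i) w *\<^sub>R e i) = w"
proof -
  let ?n = "DIM('e)"
  have inj: "inj_on e {..<?n}"
  proof (rule inj_onI)
    fix i j assume "i \<in> {..<?n}" "j \<in> {..<?n}" "e i = e j"
    then show "i = j" using e unfolding orthonormal_def by (metis lessThan_iff zero_neq_one)
  qed
  have "independent (e ` {..<?n})"
  proof (rule independent_if_scalars_zero)
    fix f x assume s: "(\<Sum>x\<in>e ` {..<?n}. f x *\<^sub>R x) = 0" and "x \<in> e ` {..<?n}"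
    then obtain j where j: "x = e j" "j < ?n" by auto
    have "(\<Sum>i<?n. f (e i) *\<^sub>R e i) = 0" using s by (simp add: sum.reindex[OF inj])
    then show "f x = 0" using orthonormal_coefficient[OF e j(2), of "\<lambda>i. f (e i)"] j(1)
      linear_0[OF lin(2)] by simp
  qed simp
  then have "dim (e ` {..<?n}) = ?n" using dim_eq_card_independent card_image[OF inj] by fastforce
  then have sp: "span (e ` {..<?n}) = UNIV" using dim_eq_full by blast
  define z where "z = w - (\<Sum>i<?n. B (e i) w *\<^sub>R e i)"
  have ez: "B (e j) z = 0" if "j < ?n" for j
    using orthonormal_coefficient[OF e that] by (simp add: z_def linear_diff[OF lin(2)])
  have "B u z = 0" if "u \<in> span (e ` {..<?n})" for u
    using that
  proof (induction rule: span_induct)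
    case (step u)
    then show ?case using ez by auto
  qed (auto simp: subspace_def linear_0[OF lin(1)] linear_add[OF lin(1)] linear_scale[OF lin(1)])
  then have "B z z = 0" using sp by blast
  then have "z = 0" using pos by force
  then show ?thesis by (simp add: z_def)
qed

end

section \<open>Charts, tangent vectors and tensors in coordinates\<close>

abbreviation transition :: "('a, 'e::euclidean_space) chart \<Rightarrow> ('a, 'e) chart \<Rightarrow> 'e \<Rightarrow> 'e" where
  "transition c d \<equiv> snd d \<circ> chart_inv c"

abbreviation jac :: "('a, 'e::euclidean_space) chart \<Rightarrow> ('a, 'e) chart \<Rightarrow> 'a \<Rightarrow> 'e \<Rightarrow> 'e" where
  "jac c d p \<equiv> deriv_at (transition c d) (snd c p)"

locale manifold =
  fixes X :: "'a topology" and A :: "('a, 'e::euclidean_space) chart set"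
  assumes mfd: "smooth_manifold X A"
begin

lemma charts_atD: "c \<in> charts_at A p \<Longrightarrow> c \<in> A \<and> p \<in> fst c"
  by (simp add: charts_at_def)

lemma points_chart: "p \<in> points A \<Longrightarrow> chart_at A p \<in> charts_at A p"
  unfolding chart_at_def by (rule someI_ex) (auto simp: points_def charts_at_def)

text \<open>Charts are open maps, so that open subsets of the manifold have open images in the model space.\<close>

lemma chart_homeo:
  assumes "c \<in> A"
  shows "inj_on (snd c) (fst c)" "openin X (fst c)"
    and chart_open_image: "openin X V \<Longrightarrow> open (snd c ` (fst c \<inter> V))"
proof -
  have o: "openin X (fst c)" and r: "open (chart_range c)"
    and h: "homeomorphic_map (subtopology X (fst c)) (top_of_set (chart_range c)) (snd c)"
    using mfd assms by (auto simp: smooth_manifold_def)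
  show "openin X (fst c)" by (rule o)
  have "topspace (subtopology X (fst c)) = fst c"
    using openin_subset[OF o] by auto
  then show "inj_on (snd c) (fst c)" using homeomorphic_imp_injective_map[OF h] by simp
  show "open (snd c ` (fst c \<inter> V))" if "openin X V"
  proof -
    have "openin (subtopology X (fst c)) (fst c \<inter> V)"
      by (rule openin_subtopology_Int2[OF that])
    then have "openin (top_of_set (chart_range c)) (snd c ` (fst c \<inter> V))"
      using homeomorphic_imp_open_map[OF h] unfolding open_map_def by blast
    then show ?thesis using r openin_open_trans by blast
  qed
qed

lemma chart_range_open: "c \<in> A \<Longrightarrow> open (chart_range c)"
  using mfd by (auto simp: smooth_manifold_def)

lemma chart_inv_left: "c \<in> A \<Longrightarrow> p \<in> fst c \<Longrightarrow> chart_inv c (snd c p) = p"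
  unfolding chart_inv_def using chart_homeo(1) inv_into_f_f by metis

lemma chart_inv_right: "y \<in> chart_range c \<Longrightarrow> snd c (chart_inv c y) = y"
  unfolding chart_inv_def chart_range_def by (rule f_inv_into_f)

lemma chart_inv_mem: "y \<in> chart_range c \<Longrightarrow> chart_inv c y \<in> fst c"
  unfolding chart_inv_def chart_range_def by (rule inv_into_into)

lemma chart_inv_charts_at: "c \<in> A \<Longrightarrow> y \<in> chart_range c \<Longrightarrow> c \<in> charts_at A (chart_inv c y)"
  by (simp add: charts_at_def chart_inv_mem)

lemma chart_range_mem: "p \<in> fst c \<Longrightarrow> snd c p \<in> chart_range c"
  by (simp add: chart_range_def)

lemma charts_at_chart:
  assumes "c \<in> charts_at A p"
  shows "c \<in> A" "snd c p \<in> chart_range c"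
  using charts_atD[OF assms] chart_range_mem[of p c] by auto

lemma chart_points: "c \<in> A \<Longrightarrow> p \<in> fst c \<Longrightarrow> p \<in> points A"
  by (auto simp: points_def)

lemma overlap_open: "c \<in> A \<Longrightarrow> d \<in> A \<Longrightarrow> open (snd c ` (fst c \<inter> fst d))"
  using chart_open_image chart_homeo(2) by blast

lemma transition_smooth: "c \<in> A \<Longrightarrow> d \<in> A \<Longrightarrow> Ck_on k (snd c ` (fst c \<inter> fst d)) (transition c d)"
  using mfd by (auto simp: smooth_manifold_def smooth_on_def)

lemma transition_has_derivative:
  "c \<in> charts_at A p \<Longrightarrow> d \<in> charts_at A p \<Longrightarrow> (transition c d has_derivative jac c d p) (at (snd c p))"
  using Ck_on_has_derivative[OF transition_smooth] charts_atD by blast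

lemma jac_linear: "c \<in> charts_at A p \<Longrightarrow> d \<in> charts_at A p \<Longrightarrow> linear (jac c d p)"
  using transition_has_derivative has_derivative_linear by blast

text \<open>The chain rule for transition maps, valid near \<open>snd c p\<close>. It makes the coordinate vectors of
\<open>of_coords\<close> compatible in all charts, so that \<open>of_coords\<close> takes values in the tangent space.\<close>

lemma jac_compose:
  assumes "c \<in> charts_at A p" "d \<in> charts_at A p" "e \<in> charts_at A p"
  shows "jac d e p (jac c d p u) = jac c e p u"
proof -
  have c: "c \<in> A" "p \<in> fst c" and d: "d \<in> A" "p \<in> fst d" using assms charts_atD by blast+
  have "transition c d (snd c p) = snd d p" using chart_inv_left[OF c] by simp
  then have "((\<lambda>y. transition d e (transition c d y)) has_derivative (\<lambda>u. jac d e p (jac c d p u))) (at (snd c p))"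
    using has_derivative_compose[OF transition_has_derivative[OF assms(1,2)], of "transition d e" "jac d e p"]
      transition_has_derivative[OF assms(2,3)] by simp
  then have "(transition c e has_derivative (\<lambda>u. jac d e p (jac c d p u))) (at (snd c p))"
  proof (rule has_derivative_transform_within_open[OF _ overlap_open[OF c(1) d(1)]])
    show "snd c p \<in> snd c ` (fst c \<inter> fst d)" using c d by blast
    fix y assume "y \<in> snd c ` (fst c \<inter> fst d)"
    then show "transition d e (transition c d y) = transition c e y"
      using chart_inv_left[OF c(1)] chart_inv_left[OF d(1)] by auto
  qed
  from has_derivative_unique[OF this transition_has_derivative[OF assms(1,3)]] show ?thesis by metis
qed

lemma jac_self:
  assumes "c \<in> charts_at A p"
  shows "jac c c p u = u"
proof -
  have c: "c \<in> A" "p \<in> fst c" using assms charts_atD by blast+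
  have "((\<lambda>y. y) has_derivative (\<lambda>u. u)) (at (snd c p))" by simp
  then have "(transition c c has_derivative (\<lambda>u. u)) (at (snd c p))"
    by (rule has_derivative_transform_within_open[OF _ chart_range_open[OF c(1)] chart_range_mem[OF c(2)]])
      (simp add: chart_inv_right)
  from has_derivative_unique[OF this transition_has_derivative[OF assms assms]] show ?thesis by metis
qed

lemma of_coords_tangent:
  assumes "c \<in> charts_at A p"
  shows "of_coords A c p u \<in> tangent_space A p"
  using jac_compose[OF assms] by (auto simp: tangent_space_def of_coords_def)

lemma of_coords_self: "c \<in> charts_at A p \<Longrightarrow> of_coords A c p u c = u"
  by (simp add: of_coords_def jac_self)

lemma of_coords_component:
  assumes "v \<in> tangent_space A p" "c \<in> charts_at A p"
  shows "of_coords A c p (v c) = v"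
proof
  fix d
  show "of_coords A c p (v c) d = v d"
  proof (cases "d \<in> charts_at A p")
    case True
    then have "v d = jac c d p (v c)" using assms unfolding tangent_space_def by blast
    then show ?thesis using True by (simp only: of_coords_def if_True)
  next
    case False
    then have "v d = 0" using assms(1) unfolding tangent_space_def by blast
    then show ?thesis using False by (simp add: of_coords_def)
  qed
qed

lemma of_coords_change:
  assumes "c \<in> charts_at A p" "d \<in> charts_at A p"
  shows "of_coords A d p (jac c d p u) = of_coords A c p u"
  using jac_compose[OF assms] by (auto simp: of_coords_def fun_eq_iff)

lemma of_coords_tcomb:
  assumes "c \<in> charts_at A p"
  shows "of_coords A c p (a *\<^sub>R u + b *\<^sub>R w) = tcomb a (of_coords A c p u) b (of_coords A c p w)"
  using linear_add[OF jac_linear[OF assms]] linear_scale[OF jac_linear[OF assms]]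
  by (auto simp: of_coords_def tcomb_def fun_eq_iff)

lemma map_of_coords_component:
  assumes "ws \<in> tvecs A p n" "c \<in> charts_at A p"
  shows "map (of_coords A c p) (map (\<lambda>w. w c) ws) = ws"
  using assms(1) of_coords_component[OF _ assms(2)] by (auto simp: tvecs_def intro!: map_idI)

lemma map_of_coords_tvecs:
  assumes "c \<in> charts_at A p"
  shows "map (of_coords A c p) us \<in> tvecs A p (length us)"
  using of_coords_tangent[OF assms] by (auto simp: tvecs_def)

lemma tensor_coords_multilinear:
  assumes K: "sym_tensor_field A n K" and c: "c \<in> A" "y \<in> chart_range c"
  shows "sym_multilinear n (tensor_coords A K c y)"
proof -
  let ?p = "chart_inv c y"
  have cp: "c \<in> charts_at A ?p" by (rule chart_inv_charts_at[OF c])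
  have p: "?p \<in> points A" using chart_points[OF c(1) chart_inv_mem[OF c(2)]] .
  have perm: "K ?p ws = K ?p vs" if "vs \<in> tvecs A ?p n" "mset ws = mset vs" for vs ws
    using K p that unfolding sym_tensor_field_def sym_multilinear_at_def by blast
  have lin: "K ?p (vs[j := tcomb a v b w]) = a * K ?p (vs[j := v]) + b * K ?p (vs[j := w])"
    if "vs \<in> tvecs A ?p n" "j < n" "v \<in> tangent_space A ?p" "w \<in> tangent_space A ?p" for vs j a v b w
    using K p that unfolding sym_tensor_field_def sym_multilinear_at_def by blast
  show ?thesis
    unfolding sym_multilinear_def tensor_coords_def
  proof (intro conjI allI impI)
    fix us vs :: "'e list" assume "length us = n" "mset us = mset vs"
    then show "K ?p (map (of_coords A c ?p) us) = K ?p (map (of_coords A c ?p) vs)"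
      using perm[of "map (of_coords A c ?p) us" "map (of_coords A c ?p) vs"] map_of_coords_tvecs[OF cp, of us] by simp
  next
    fix us :: "'e list" assume us: "Suc (length us) = n"
    let ?v = "of_coords A c ?p"
    have *: "K ?p (?v (a *\<^sub>R u + b *\<^sub>R w) # map ?v us) = a * K ?p (?v u # map ?v us) + b * K ?p (?v w # map ?v us)" for a u b w
      using lin[of "map ?v (u # us)" 0 "?v u" "?v w" a b] map_of_coords_tvecs[OF cp, of "u # us"] us
        of_coords_tangent[OF cp] by (simp add: of_coords_tcomb[OF cp])
    show "linear (\<lambda>u. K ?p (map ?v (u # us)))"
    proof (rule linearI)
      show "K ?p (map ?v ((u + w) # us)) = K ?p (map ?v (u # us)) + K ?p (map ?v (w # us))" for u w
        using *[of 1 u 1 w] by simp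
      show "K ?p (map ?v ((a *\<^sub>R u) # us)) = a *\<^sub>R K ?p (map ?v (u # us))" for a u
        using *[of a u 0 u] by simp
    qed
  qed
qed

lemma tensor_coords_smooth:
  "sym_tensor_field A n K \<Longrightarrow> c \<in> A \<Longrightarrow> length us = n \<Longrightarrow>
     Ck_on k (chart_range c) (\<lambda>y. tensor_coords A K c y us)"
  by (simp add: sym_tensor_field_def smooth_on_def)

lemma tensor_coords_has_derivative:
  assumes "sym_tensor_field A n K" "c \<in> A" "y \<in> chart_range c" "length us = n"
  shows "((\<lambda>z. tensor_coords A K c z us) has_derivative deriv_at (\<lambda>z. tensor_coords A K c z us) y) (at y)"
  using Ck_on_has_derivative[OF tensor_coords_smooth[OF assms(1,2,4)] assms(3)] .

lemma tensor_coords_component: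
  assumes "c \<in> charts_at A p" "ws \<in> tvecs A p n"
  shows "tensor_coords A K c (snd c p) (map (\<lambda>w. w c) ws) = K p ws"
  using map_of_coords_component[OF assms(2,1)] charts_atD[OF assms(1)]
  by (simp add: tensor_coords_def chart_inv_left)

lemma zero_tensor_field: "sym_tensor_field A n (\<lambda>p vs. 0)"
  using chart_range_open
  by (auto simp: sym_tensor_field_def sym_multilinear_at_def smooth_on_def tensor_coords_def intro: Ck_on_const)

text \<open>In a chart the function associated with a tensor is the diagonal of a multilinear form that depends
on the point, to which \<open>has_derivative_diagonal\<close> applies.\<close>

lemma assoc_fun_coords:
  assumes "c \<in> charts_at A p"
  shows "assoc_fun n K (p, of_coords A c p u) = tensor_coords A K c (snd c p) (replicate n u) / fact n"
  using chart_inv_left charts_atD[OF assms] by (simp add: assoc_fun_def tensor_coords_def)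

text \<open>The bundle charts turn the function into a diagonal as in \<open>assoc_fun_coords\<close>, with the point and the
vector both varying.\<close>

lemma assoc_fun_differentiable:
  assumes K: "sym_tensor_field A n K"
  shows "differentiable_on_TM A (assoc_fun n K)"
  unfolding differentiable_on_TM_def differentiable_on_def
proof (intro ballI)
  fix c z assume c: "c \<in> A" and z: "z \<in> chart_range c \<times> (UNIV :: 'e set)"
  let ?S = "chart_range c \<times> (UNIV :: 'e set)"
  have zr: "fst z \<in> chart_range c" using z by auto
  have S: "open ?S" using chart_range_open[OF c] by (auto intro: open_Times)
  have "((\<lambda>z. tensor_coords A K c (fst z) (replicate n (snd z))) has_derivative
    (\<lambda>h. deriv_at (\<lambda>y. tensor_coords A K c y (replicate n (snd z))) (fst z) (fst h) +
       n * tensor_coords A K c (fst z) (snd h # replicate (n - 1) (snd z)))) (at z)"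
  proof (rule has_derivative_diagonal[where S = ?S and T = "\<lambda>z. tensor_coords A K c (fst z)"
        and D = "\<lambda>h us. deriv_at (\<lambda>y. tensor_coords A K c y us) (fst z) (fst h)", OF S z])
    show "sym_multilinear n (tensor_coords A K c (fst y))" if "y \<in> ?S" for y
      using tensor_coords_multilinear[OF K c] that by auto
    show "((\<lambda>z. tensor_coords A K c (fst z) us) has_derivative
      (\<lambda>h. deriv_at (\<lambda>y. tensor_coords A K c y us) (fst z) (fst h))) (at z)" if "length us = n" for us
      by (rule has_derivative_compose[OF has_derivative_fst[OF has_derivative_ident]
            tensor_coords_has_derivative[OF K c zr that]])
    show "(snd has_derivative snd) (at z)"
      using has_derivative_snd[OF has_derivative_ident] .
  qed
  then have "(\<lambda>z. tensor_coords A K c (fst z) (replicate n (snd z)) / fact n) differentiable (at z)"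
    using differentiableI differentiable_cmult_left_iff by (fastforce simp: divide_inverse intro: differentiable_mult)
  then have "(\<lambda>(y, u). assoc_fun n K (chart_inv c y, of_coords A c (chart_inv c y) u)) differentiable (at z)"
    by (rule differentiable_cong_open[OF S z, rotated])
      (use assoc_fun_coords[OF chart_inv_charts_at[OF c]] chart_inv_right[of _ c] in auto)
  then show "(\<lambda>(y, u). assoc_fun n K (chart_inv c y, of_coords A c (chart_inv c y) u)) differentiable (at z within ?S)"
    by (rule differentiable_at_withinI)
qed

lemma sum_assoc_fun_differentiable:
  assumes "\<And>i. i \<le> l \<Longrightarrow> sym_tensor_field A i (K i)"
  shows "differentiable_on_TM A (\<lambda>\<xi>. \<Sum>i\<le>l. assoc_fun i (K i) \<xi>)"
  using assoc_fun_differentiable[OF assms]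
  unfolding differentiable_on_TM_def differentiable_on_def split_def
  by (auto intro!: differentiable_sum)

lemma chart_velocity_change:
  assumes U: "open U" "t \<in> U" "\<And>s. s \<in> U \<Longrightarrow> \<gamma> s \<in> fst c"
    and cd: "c \<in> charts_at A (\<gamma> t)" "d \<in> charts_at A (\<gamma> t)"
    and x: "((\<lambda>s. snd c (\<gamma> s)) has_vector_derivative u) (at t)"
  shows "((\<lambda>s. snd d (\<gamma> s)) has_vector_derivative jac c d (\<gamma> t) u) (at t)"
proof -
  have c: "c \<in> A" using cd charts_atD by blast
  have "((\<lambda>s. transition c d (snd c (\<gamma> s))) has_derivative (\<lambda>h. jac c d (\<gamma> t) (h *\<^sub>R u))) (at t)"
    using has_derivative_compose[OF x[unfolded has_vector_derivative_def] transition_has_derivative[OF cd]] .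
  then have "((\<lambda>s. transition c d (snd c (\<gamma> s))) has_vector_derivative jac c d (\<gamma> t) u) (at t)"
    by (simp add: has_vector_derivative_def linear_scale[OF jac_linear[OF cd]])
  then show ?thesis
    by (rule has_vector_derivative_transform_within_open[OF _ U(1,2)])
      (simp add: chart_inv_left[OF c U(3)])
qed

text \<open>By the chain rule, one chart determines the velocity in all charts.\<close>

lemma velocity_of_coords:
  assumes U: "open U" "t \<in> U" "\<And>s. s \<in> U \<Longrightarrow> \<gamma> s \<in> fst c"
    and c: "c \<in> charts_at A (\<gamma> t)"
    and x: "((\<lambda>s. snd c (\<gamma> s)) has_vector_derivative u) (at t)"
  shows "velocity A \<gamma> t = of_coords A c (\<gamma> t) u"
proof
  show "velocity A \<gamma> t d = of_coords A c (\<gamma> t) u d" for d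
    using vector_derivative_at[OF chart_velocity_change[OF U c _ x, of d]]
    by (simp add: velocity_def of_coords_def)
qed

lemma of_coords_inject:
  "c \<in> charts_at A p \<Longrightarrow> of_coords A c p u = of_coords A c p w \<longleftrightarrow> u = w"
  using of_coords_self by metis

end

section \<open>The Levi-Civita connection under a change of charts\<close>

locale riemannian = manifold X A for X :: "'a topology" and A :: "('a, 'e::euclidean_space) chart set" +
  fixes g :: "('a, 'e) bilin_field"
  assumes metric: "riemannian_metric A g"
begin

abbreviation "metric_coords \<equiv> bilin_coords A g"

lemma metric_coords_tensor:
  "metric_coords c y u v = tensor_coords A (\<lambda>p vs. g p (vs ! 0) (vs ! 1)) c y [u, v]"
  by (simp add: bilin_coords_def tensor_coords_def)

lemma metric_tensor: "sym_tensor_field A 2 (\<lambda>p vs. g p (vs ! 0) (vs ! 1))"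
  using metric by (simp add: riemannian_metric_def)

lemma metric_coords_smooth: "c \<in> A \<Longrightarrow> Ck_on k (chart_range c) (\<lambda>y. metric_coords c y u v)"
  unfolding metric_coords_tensor by (rule tensor_coords_smooth[OF metric_tensor]) auto

lemma metric_coords_has_derivative:
  "c \<in> A \<Longrightarrow> x \<in> chart_range c \<Longrightarrow>
    ((\<lambda>y. metric_coords c y u v) has_derivative deriv_at (\<lambda>y. metric_coords c y u v) x) (at x)"
  using Ck_on_has_derivative[OF metric_coords_smooth] by blast

lemma metric_inner_form:
  assumes c: "c \<in> A" "y \<in> chart_range c"
  shows "inner_form (metric_coords c y)"
proof
  let ?T = "tensor_coords A (\<lambda>p vs. g p (vs ! 0) (vs ! 1)) c y"
  have T: "sym_multilinear 2 ?T" by (rule tensor_coords_multilinear[OF metric_tensor c])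
  show s: "metric_coords c y v w = metric_coords c y w v" for v w
    unfolding metric_coords_tensor by (rule sym_multilinear_perm[OF T]) auto
  have l: "linear (\<lambda>v. metric_coords c y v w)" for w
    unfolding metric_coords_tensor by (rule sym_multilinear_linear[OF T]) auto
  moreover have "metric_coords c y v = (\<lambda>w. metric_coords c y w v)" for v using s by blast
  ultimately show "bilinear (metric_coords c y)" unfolding bilinear_def by metis
  have cp: "c \<in> charts_at A (chart_inv c y)" by (rule chart_inv_charts_at[OF c])
  show "metric_coords c y v v > 0" if "v \<noteq> 0" for v
  proof -
    have "of_coords A c (chart_inv c y) v \<noteq> (\<lambda>_. 0)"
      using of_coords_self[OF cp, of v] that by metis
    then show ?thesis
      using metric of_coords_tangent[OF cp, of v] chart_points[OF c(1) chart_inv_mem[OF c(2)]]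
      unfolding riemannian_metric_def bilin_coords_def by blast
  qed
qed

text \<open>The property that singles out the Christoffel symbols, named so that its uniqueness can be used for
symbols obtained in another way.\<close>

definition is_christoffel :: "('a, 'e) chart \<Rightarrow> 'e \<Rightarrow> ('e \<Rightarrow> 'e \<Rightarrow> 'e) \<Rightarrow> bool" where
  "is_christoffel c x \<Gamma> \<longleftrightarrow> bilinear \<Gamma> \<and> (\<forall>u v. \<Gamma> u v = \<Gamma> v u) \<and>
        (\<forall>u v w. deriv_at (\<lambda>y. metric_coords c y v w) x u =
           metric_coords c x (\<Gamma> u v) w + metric_coords c x v (\<Gamma> u w))"

lemma christoffel_ex1:
  assumes c: "c \<in> A" "x \<in> chart_range c"
  shows "\<exists>!\<Gamma>. is_christoffel c x \<Gamma>"
  unfolding is_christoffel_def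
proof (rule torsion_free_metric_ex1)
  interpret B: inner_form "metric_coords c x" by (rule metric_inner_form[OF c])
  show "bilinear (metric_coords c x)" by (rule B.bilin)
  show "metric_coords c x v w = metric_coords c x w v" for v w by (rule B.sym)
  show "metric_coords c x v v > 0" if "v \<noteq> 0" for v using B.pos[OF that] .
  note D = metric_coords_has_derivative[OF c]
  note ro = chart_range_open[OF c(1)]
  show "linear (\<lambda>u. deriv_at (\<lambda>y. metric_coords c y v w) x u)" for v w
    by (rule has_derivative_linear[OF D])
  show sym: "deriv_at (\<lambda>y. metric_coords c y v w) x u = deriv_at (\<lambda>y. metric_coords c y w v) x u" for u v w
  proof -
    have "metric_coords c y v w = metric_coords c y w v" if "y \<in> chart_range c" for y
      using inner_form.sym[OF metric_inner_form[OF c(1) that]] .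
    then have "deriv_at (\<lambda>y. metric_coords c y v w) x = deriv_at (\<lambda>y. metric_coords c y w v) x"
      by (rule frechet_derivative_cong_open[OF ro c(2)])
    then show ?thesis by simp
  qed
  have l: "linear (\<lambda>v. deriv_at (\<lambda>y. metric_coords c y v w) x u)" for u w
    by (rule derivative_of_linear_family[OF ro c(2) inner_form.lin(1)[OF metric_inner_form[OF c(1)]] D])
  show "bilinear (\<lambda>v w. deriv_at (\<lambda>y. metric_coords c y v w) x u)" for u
  proof -
    have "(\<lambda>w. deriv_at (\<lambda>y. metric_coords c y v w) x u) = (\<lambda>w. deriv_at (\<lambda>y. metric_coords c y w v) x u)" for v
      using sym by blast
    then show ?thesis unfolding bilinear_def using l by simp
  qed
qed

lemma christoffel_is:
  assumes c: "c \<in> A" "x \<in> chart_range c"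
  shows "is_christoffel c x (christoffel A g c x)"
proof -
  have "christoffel A g c x = (THE \<Gamma>. is_christoffel c x \<Gamma>)"
    unfolding christoffel_def is_christoffel_def ..
  then show ?thesis using theI'[OF christoffel_ex1[OF c]] by simp
qed

lemma metric_coords_change:
  assumes "c \<in> charts_at A p" "d \<in> charts_at A p"
  shows "metric_coords d (snd d p) (jac c d p v) (jac c d p w) = metric_coords c (snd c p) v w"
  using of_coords_change[OF assms] charts_atD[OF assms(1)] charts_atD[OF assms(2)]
  by (simp add: bilin_coords_def chart_inv_left)

lemma metric_component:
  assumes "c \<in> charts_at A p" "v \<in> tangent_space A p" "w \<in> tangent_space A p"
  shows "g p v w = metric_coords c (snd c p) (v c) (w c)"
  using of_coords_component[OF _ assms(1)] assms charts_atD[OF assms(1)]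
  by (simp add: bilin_coords_def chart_inv_left)

text \<open>Differentiating \<open>g\<^sub>c(v, w) = g\<^sub>d(Jv, Jw)\<close>, where \<open>J\<close> depends on the point, shows that
\<open>(a, b) \<mapsto> J \<Gamma>\<^sub>c(J\<^sup>-\<^sup>1a, J\<^sup>-\<^sup>1b) - H(J\<^sup>-\<^sup>1a, J\<^sup>-\<^sup>1b)\<close> with the second derivative \<open>H\<close> of the transition map is
compatible with the metric in the chart \<open>d\<close>. It is symmetric since \<open>H\<close> is, and therefore it is \<open>\<Gamma>\<^sub>d\<close>.\<close>

lemma christoffel_change:
  assumes "c \<in> charts_at A p" "d \<in> charts_at A p"
  shows "christoffel A g d (snd d p) (jac c d p u) (jac c d p v) +
      deriv_at (\<lambda>y. deriv_at (transition c d) y v) (snd c p) u =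
    jac c d p (christoffel A g c (snd c p) u v)"
proof -
  have c: "c \<in> A" "p \<in> fst c" and d: "d \<in> A" "p \<in> fst d" using assms charts_atD by blast+
  let ?x = "snd c p" and ?x' = "snd d p" and ?J = "jac c d p" and ?I = "jac d c p"
  let ?\<Gamma> = "christoffel A g c ?x" and ?\<tau> = "transition c d"
  let ?S = "snd c ` (fst c \<inter> fst d)"
  define H where "H u v = deriv_at (\<lambda>y. deriv_at ?\<tau> y v) ?x u" for u v
  have xr: "?x \<in> chart_range c" "?x' \<in> chart_range d" by (rule chart_range_mem[OF c(2)], rule chart_range_mem[OF d(2)])
  have S: "open ?S" "?x \<in> ?S" using overlap_open[OF c(1) d(1)] c(2) d(2) by auto
  have \<Gamma>: "is_christoffel c ?x ?\<Gamma>" using christoffel_is c(1) xr(1) by blast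
  then have \<Gamma>bil: "bilinear ?\<Gamma>" and \<Gamma>sym: "\<And>u v. ?\<Gamma> u v = ?\<Gamma> v u"
    and \<Gamma>comp: "\<And>u v w. deriv_at (\<lambda>y. metric_coords c y v w) ?x u =
           metric_coords c ?x (?\<Gamma> u v) w + metric_coords c ?x v (?\<Gamma> u w)"
    unfolding is_christoffel_def by auto
  have t2: "Ck_on 2 ?S ?\<tau>" by (rule transition_smooth[OF c(1) d(1)])
  have dH: "((\<lambda>y. deriv_at ?\<tau> y v) has_derivative (\<lambda>u. H u v)) (at ?x)" for v
    using t2 S(2) unfolding H_def by (auto simp: numeral_2_eq_2 frechet_derivative_works)
  have Hsym: "H u v = H v u" for u v
    unfolding H_def by (rule second_derivative_symmetric[OF t2 S])
  have H1: "linear (\<lambda>u. H u v)" for v by (rule has_derivative_linear[OF dH])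
  have H2: "linear (H u)" for u
  proof -
    have "H u = (\<lambda>v. H v u)" using Hsym by blast
    then show ?thesis using H1[of u] by simp
  qed
  have JI: "?J (?I a) = a" and IJ: "?I (?J a) = a" for a
    using jac_compose[OF assms(2,1,2)] jac_compose[OF assms(1,2,1)] jac_self assms by auto
  have J: "linear ?J" and I: "linear ?I" using jac_linear assms by blast+
  have xx: "?\<tau> ?x = ?x'" using chart_inv_left[OF c] by simp
  interpret Bd: inner_form "metric_coords d ?x'" by (rule metric_inner_form[OF d(1) xr(2)])
  have Bform: "inner_form (metric_coords d (?\<tau> y))" if "y \<in> ?S" for y
    using that by (intro metric_inner_form[OF d(1)]) (auto simp: chart_inv_left[OF c(1)] chart_range_mem)
  have main: "deriv_at (\<lambda>y. metric_coords c y v w) ?x u =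
      deriv_at (\<lambda>z. metric_coords d z (?J v) (?J w)) ?x' (?J u) +
      metric_coords d ?x' (H u v) (?J w) + metric_coords d ?x' (?J v) (H u w)" for u v w
  proof -
    have B0: "((\<lambda>y. metric_coords d (?\<tau> y) a b) has_derivative
        (\<lambda>u. deriv_at (\<lambda>z. metric_coords d z a b) ?x' (?J u))) (at ?x)" for a b
      by (rule has_derivative_compose[OF transition_has_derivative[OF assms], unfolded xx,
            OF metric_coords_has_derivative[OF d(1) xr(2)]])
    have B1: "((\<lambda>y. metric_coords d (?\<tau> y) (deriv_at ?\<tau> y v) b) has_derivative
        (\<lambda>u. deriv_at (\<lambda>z. metric_coords d z (?J v) b) ?x' (?J u) + metric_coords d (?\<tau> ?x) (H u v) b)) (at ?x)" for b
      by (rule has_derivative_linear_family[where L = "\<lambda>y u. metric_coords d (?\<tau> y) u b",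
            OF S inner_form.lin(1)[OF Bform] B0 dH])
    have "((\<lambda>y. metric_coords d (?\<tau> y) (deriv_at ?\<tau> y v) (deriv_at ?\<tau> y w)) has_derivative
        (\<lambda>u. deriv_at (\<lambda>z. metric_coords d z (?J v) (?J w)) ?x' (?J u) +
          metric_coords d (?\<tau> ?x) (H u v) (?J w) + metric_coords d (?\<tau> ?x) (?J v) (H u w))) (at ?x)"
      by (rule has_derivative_linear_family[where L = "\<lambda>y. metric_coords d (?\<tau> y) (deriv_at ?\<tau> y v)",
            OF S inner_form.lin(2)[OF Bform] B1 dH])
    then have "((\<lambda>y. metric_coords c y v w) has_derivative
        (\<lambda>u. deriv_at (\<lambda>z. metric_coords d z (?J v) (?J w)) ?x' (?J u) +
          metric_coords d (?\<tau> ?x) (H u v) (?J w) + metric_coords d (?\<tau> ?x) (?J v) (H u w))) (at ?x)"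
    proof (rule has_derivative_transform_within_open[OF _ S])
      fix y assume "y \<in> ?S"
      then obtain q where q: "y = snd c q" "c \<in> charts_at A q" "d \<in> charts_at A q"
        using c(1) d(1) by (auto simp: charts_at_def)
      then show "metric_coords d (?\<tau> y) (deriv_at ?\<tau> y v) (deriv_at ?\<tau> y w) = metric_coords c y v w"
        using metric_coords_change[OF q(2,3)] chart_inv_left[OF c(1)] charts_atD[OF q(2)] by simp
    qed
    from fun_cong[OF has_derivative_unique[OF this metric_coords_has_derivative[OF c(1) xr(1)]], of u]
    show ?thesis unfolding xx by (rule sym)
  qed
  define \<Gamma>' where "\<Gamma>' a b = ?J (?\<Gamma> (?I a) (?I b)) - H (?I a) (?I b)" for a b
  have "is_christoffel d ?x' \<Gamma>'"
    unfolding is_christoffel_def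
  proof (intro conjI allI)
    have \<Gamma>l: "linear (\<lambda>u. ?\<Gamma> u v)" "linear (?\<Gamma> v)" for v using \<Gamma>bil unfolding bilinear_def by auto
    show s: "\<Gamma>' a b = \<Gamma>' b a" for a b unfolding \<Gamma>'_def using \<Gamma>sym Hsym by metis
    have l: "linear (\<lambda>a. \<Gamma>' a b)" for b
      unfolding \<Gamma>'_def
      using linear_compose[OF linear_compose[OF I \<Gamma>l(1)] J] linear_compose[OF I H1]
      by (intro linear_compose_sub) (simp_all add: o_def)
    moreover have "\<Gamma>' b = (\<lambda>a. \<Gamma>' a b)" for b using s by blast
    ultimately show "bilinear \<Gamma>'" unfolding bilinear_def by metis
    fix a b e
    define u v w where "u = ?I a" and "v = ?I b" and "w = ?I e"
    have a: "a = ?J u" "b = ?J v" "e = ?J w" by (simp_all add: u_def v_def w_def JI)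
    have "metric_coords d ?x' (\<Gamma>' a b) e + metric_coords d ?x' b (\<Gamma>' a e) =
       metric_coords d ?x' (?J (?\<Gamma> u v)) (?J w) + metric_coords d ?x' (?J v) (?J (?\<Gamma> u w)) -
       (metric_coords d ?x' (H u v) (?J w) + metric_coords d ?x' (?J v) (H u w))"
      by (simp add: a \<Gamma>'_def IJ linear_diff[OF Bd.lin(1)] linear_diff[OF Bd.lin(2)])
    also have "\<dots> = deriv_at (\<lambda>z. metric_coords d z b e) ?x' a"
      using main[where u = u and v = v and w = w] \<Gamma>comp[where u = u and v = v and w = w] unfolding metric_coords_change[OF assms] by (simp add: a)
    finally show "deriv_at (\<lambda>z. metric_coords d z b e) ?x' a =
      metric_coords d ?x' (\<Gamma>' a b) e + metric_coords d ?x' b (\<Gamma>' a e)" by simp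
  qed
  then have "christoffel A g d ?x' = \<Gamma>'"
    using christoffel_ex1[OF d(1) xr(2)] christoffel_is[OF d(1) xr(2)] by blast
  then show ?thesis by (simp add: \<Gamma>'_def IJ H_def)
qed

text \<open>In another chart the acceleration acquires the second derivative of the transition map, which
the change of the Christoffel symbols cancels. So the covariant acceleration is the tangent vector
whose coordinates in the given chart are \<open>x'' + \<Gamma>(x', x')\<close>.\<close>

lemma cov_along_velocity:
  assumes U: "open U" "t \<in> U" "\<And>s. s \<in> U \<Longrightarrow> \<gamma> s \<in> fst c" and c: "c \<in> A"
    and x: "\<And>s. s \<in> U \<Longrightarrow> ((\<lambda>s. snd c (\<gamma> s)) has_vector_derivative u s) (at s)"
    and u: "(u has_vector_derivative w) (at t)"
  shows "cov_along A g \<gamma> (velocity A \<gamma>) t =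
    of_coords A c (\<gamma> t) (w + christoffel A g c (snd c (\<gamma> t)) (u t) (u t))"
proof
  fix d
  let ?x = "\<lambda>s. snd c (\<gamma> s)"
  have ct: "c \<in> charts_at A (\<gamma> s)" if "s \<in> U" for s
    using U(3)[OF that] c by (simp add: charts_at_def)
  show "cov_along A g \<gamma> (velocity A \<gamma>) t d =
    of_coords A c (\<gamma> t) (w + christoffel A g c (snd c (\<gamma> t)) (u t) (u t)) d"
  proof (cases "d \<in> charts_at A (\<gamma> t)")
    case False
    then show ?thesis by (simp add: cov_along_def of_coords_def)
  next
    case True
    then have d: "d \<in> A" "\<gamma> t \<in> fst d" using charts_atD by blast+
    let ?S = "snd c ` (fst c \<inter> fst d)" and ?\<tau> = "transition c d" and ?J = "jac c d (\<gamma> t)"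
    define U' where "U' = U \<inter> ?x -` ?S"
    have "continuous_on U ?x"
      using x by (intro continuous_at_imp_continuous_on ballI) (blast intro: has_vector_derivative_continuous)
    then have U': "open U'"
      unfolding U'_def by (rule continuous_open_preimage[OF _ U(1) overlap_open[OF c d(1)]])
    have tU': "t \<in> U'" using U d by (auto simp: U'_def)
    have mem: "d \<in> charts_at A (\<gamma> s)" "s \<in> U" "?x s \<in> ?S" if s: "s \<in> U'" for s
    proof -
      obtain q where q: "q \<in> fst c" "q \<in> fst d" "?x s = snd c q" using s by (auto simp: U'_def)
      have "\<gamma> s = q" using q(1,3) U(3)[of s] s inj_onD[OF chart_homeo(1)[OF c]] by (auto simp: U'_def)
      then show "d \<in> charts_at A (\<gamma> s)" "s \<in> U" "?x s \<in> ?S" using q d s by (auto simp: U'_def charts_at_def)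
    qed
    have t2: "Ck_on 2 ?S ?\<tau>" by (rule transition_smooth[OF c d(1)])
    have vel: "velocity A \<gamma> s d = deriv_at ?\<tau> (?x s) (u s)" if s: "s \<in> U'" for s
      using velocity_of_coords[OF U(1) mem(2)[OF s] U(3) ct[OF mem(2)[OF s]] x[OF mem(2)[OF s]]] mem(1)[OF s]
      by (simp add: of_coords_def)
    define H where "H v = deriv_at (\<lambda>y. deriv_at ?\<tau> y v) (?x t)" for v
    have dH: "((\<lambda>y. deriv_at ?\<tau> y v) has_derivative H v) (at (?x t))" for v
      using t2 mem(3)[OF tU'] unfolding H_def by (auto simp: numeral_2_eq_2 frechet_derivative_works)
    have 1: "((\<lambda>s. deriv_at ?\<tau> (?x s) v) has_derivative (\<lambda>h. H v (h *\<^sub>R u t))) (at t)" for v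
      using has_derivative_compose[OF x[OF U(2), unfolded has_vector_derivative_def] dH] .
    have lin: "linear (deriv_at ?\<tau> (?x s))" if "s \<in> U'" for s
      using jac_linear[OF ct mem(1)] mem(2) that by blast
    have "((\<lambda>s. deriv_at ?\<tau> (?x s) (u s)) has_derivative (\<lambda>h. H (u t) (h *\<^sub>R u t) + ?J (h *\<^sub>R w))) (at t)"
      by (rule has_derivative_linear_family[OF U' tU' lin 1 u[unfolded has_vector_derivative_def]])
    then have "((\<lambda>s. deriv_at ?\<tau> (?x s) (u s)) has_vector_derivative H (u t) (u t) + ?J w) (at t)"
      by (simp add: has_vector_derivative_def linear_scale[OF lin[OF tU']]
          linear_scale[OF has_derivative_linear[OF dH]] scaleR_add_right)
    then have "((\<lambda>s. velocity A \<gamma> s d) has_vector_derivative H (u t) (u t) + ?J w) (at t)"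
      by (rule has_vector_derivative_transform_within_open[OF _ U' tU']) (simp add: vel)
    then have A1: "vector_derivative (\<lambda>s. velocity A \<gamma> s d) (at t) = H (u t) (u t) + ?J w"
      by (rule vector_derivative_at)
    have A2: "vector_derivative (\<lambda>s. snd d (\<gamma> s)) (at t) = ?J (u t)"
      by (rule vector_derivative_at[OF chart_velocity_change[OF U ct[OF U(2)] True x[OF U(2)]]])
    show ?thesis
      using True christoffel_change[OF ct[OF U(2)] True, of "u t" "u t"]
      by (simp add: cov_along_def A1 A2 vel[OF tU'] of_coords_def linear_add[OF lin[OF tU']] H_def add.commute)
  qed
qed

lemma christoffel_bilinear:
  assumes "c \<in> A" "y \<in> chart_range c"
  shows "linear (\<lambda>u. christoffel A g c y u v)" "linear (christoffel A g c y v)"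
  using christoffel_is[OF assms] unfolding is_christoffel_def bilinear_def by auto

text \<open>Koszul's formula: the cyclic combination of three compatibility equations in which all terms but
one cancel.\<close>

lemma koszul:
  assumes c: "c \<in> A" "y \<in> chart_range c"
  shows "metric_coords c y (christoffel A g c y u v) w =
    (deriv_at (\<lambda>y. metric_coords c y v w) y u + deriv_at (\<lambda>y. metric_coords c y u w) y v -
     deriv_at (\<lambda>y. metric_coords c y u v) y w) / 2"
proof -
  have *: "christoffel A g c y u v = christoffel A g c y v u"
    "deriv_at (\<lambda>y. metric_coords c y v w) y u =
       metric_coords c y (christoffel A g c y u v) w + metric_coords c y v (christoffel A g c y u w)" for u v w
    using christoffel_is[OF c] unfolding is_christoffel_def by auto
  have s: "metric_coords c y v w = metric_coords c y w v" for v w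
    by (rule inner_form.sym[OF metric_inner_form[OF c]])
  show ?thesis
    using *(1)[of u v] *(1)[of u w] *(1)[of v w] *(2)[where u = u and v = v and w = w]
      *(2)[where u = v and v = u and w = w] *(2)[where u = w and v = u and w = v]
      s[of u "christoffel A g c y v w"] s[of v "christoffel A g c y u w"] s[of u "christoffel A g c y w v"]
    by simp
qed

text \<open>Koszul's formula is a linear system for the Christoffel symbols. Its matrix is that of the metric,
which is injective, and its right hand side consists of first derivatives of the metric.\<close>

lemma christoffel_lipschitz_near:
  assumes c: "c \<in> A" "x \<in> chart_range c"
  shows "lipschitz_near (\<lambda>y. christoffel A g c y u v) x"
proof (rule lipschitz_near_linear_solution)
  let ?A = "\<lambda>y z. \<Sum>b\<in>Basis. metric_coords c y z b *\<^sub>R b"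
  note ro = chart_range_open[OF c(1)]
  show "open (chart_range c)" "x \<in> chart_range c" by (fact ro c(2))+
  have 1: "lipschitz_near (\<lambda>y. metric_coords c y v w) x" for v w
    by (rule Ck_on_lipschitz_near[OF metric_coords_smooth[OF c(1)] ro c(2)])
  have 2: "lipschitz_near (\<lambda>y. deriv_at (\<lambda>y. metric_coords c y v w) y u) x" for u v w
    by (rule Ck_on_lipschitz_near[OF _ ro c(2)])
      (use metric_coords_smooth[OF c(1), of 2 v w] in \<open>auto simp: numeral_2_eq_2\<close>)
  show lin: "linear (?A y)" if "y \<in> chart_range c" for y
    by (intro linear_compose_sum ballI linearI)
      (simp_all add: linear_add[OF inner_form.lin(1)[OF metric_inner_form[OF c(1) that]]]
        linear_scale[OF inner_form.lin(1)[OF metric_inner_form[OF c(1) that]]] scaleR_left_distrib)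
  show "inj (?A x)"
    unfolding linear_injective_0[OF lin[OF c(2)]]
  proof (intro allI impI)
    interpret B: inner_form "metric_coords c x" by (rule metric_inner_form[OF c])
    fix z assume z: "?A x z = 0"
    have "metric_coords c x z b = 0" if "b \<in> Basis" for b
      using arg_cong[OF z, of "\<lambda>w. w \<bullet> b"] that by (simp add: inner_sum_left inner_Basis if_distrib cong: if_cong)
    then have "metric_coords c x z z = 0"
      using linear_basis_expansion[OF B.lin(2), of z z] by simp
    then show "z = 0" using B.pos[of z] by force
  qed
  show "lipschitz_near (\<lambda>y. ?A y u) x" for u
    by (intro lipschitz_near_sum lipschitz_near_scaleR lipschitz_near_const 1)
  show "lipschitz_near (\<lambda>y. \<Sum>b\<in>Basis. (inverse 2 *\<^sub>R (deriv_at (\<lambda>y. metric_coords c y v b) y u +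
      deriv_at (\<lambda>y. metric_coords c y u b) y v - deriv_at (\<lambda>y. metric_coords c y u v) y b)) *\<^sub>R b) x"
    by (intro lipschitz_near_sum lipschitz_near_scaleR lipschitz_near_const lipschitz_near_add lipschitz_near_diff 2)
  show "?A y (christoffel A g c y u v) =
    (\<Sum>b\<in>Basis. (inverse 2 *\<^sub>R (deriv_at (\<lambda>y. metric_coords c y v b) y u +
      deriv_at (\<lambda>y. metric_coords c y u b) y v - deriv_at (\<lambda>y. metric_coords c y u v) y b)) *\<^sub>R b)"
    if "y \<in> chart_range c" for y
    by (simp add: koszul[OF c(1) that] field_simps)
qed

end

section \<open>Magnetic geodesics\<close>

locale magnetic = riemannian X A g
  for X :: "'a topology" and A :: "('a, 'e::euclidean_space) chart set" and g :: "('a, 'e) bilin_field" +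
  fixes F :: "('a, 'e) endo_field"
  assumes force: "endo_field A F"
begin

definition force_coords :: "('a, 'e) chart \<Rightarrow> 'e \<Rightarrow> 'e \<Rightarrow> 'e" where
  "force_coords c y u = F (chart_inv c y) (of_coords A c (chart_inv c y) u) c"

lemma force_of_coords:
  assumes c: "c \<in> charts_at A p"
  shows "F p (of_coords A c p u) = of_coords A c p (force_coords c (snd c p) u)"
proof -
  have "p \<in> points A" "chart_inv c (snd c p) = p"
    using charts_atD[OF c] chart_points chart_inv_left by blast+
  moreover from this have "F p (of_coords A c p u) \<in> tangent_space A p"
    using force of_coords_tangent[OF c] unfolding endo_field_def by blast
  ultimately show ?thesis using of_coords_component[OF _ c] by (simp add: force_coords_def)
qed

lemma force_coords_linear:
  assumes c: "c \<in> A" "y \<in> chart_range c"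
  shows "linear (force_coords c y)"
proof -
  let ?p = "chart_inv c y"
  have cp: "c \<in> charts_at A ?p" and p: "?p \<in> points A"
    using chart_inv_charts_at[OF c] chart_points[OF c(1) chart_inv_mem[OF c(2)]] by auto
  have *: "force_coords c y (a *\<^sub>R u + b *\<^sub>R w) = a *\<^sub>R force_coords c y u + b *\<^sub>R force_coords c y w" for a b u w
  proof -
    have "F ?p (tcomb a (of_coords A c ?p u) b (of_coords A c ?p w)) =
        tcomb a (F ?p (of_coords A c ?p u)) b (F ?p (of_coords A c ?p w))"
      using force p of_coords_tangent[OF cp] unfolding endo_field_def by blast
    then show ?thesis by (simp add: force_coords_def of_coords_tcomb[OF cp] tcomb_def)
  qed
  show ?thesis
  proof (rule linearI)
    show "force_coords c y (u + w) = force_coords c y u + force_coords c y w" for u w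
      using *[of 1 u 1 w] by simp
    show "force_coords c y (a *\<^sub>R u) = a *\<^sub>R force_coords c y u" for a u
      using *[of a u 0 u] by simp
  qed
qed

lemma force_coords_smooth: "c \<in> A \<Longrightarrow> Ck_on k (chart_range c) (\<lambda>y. force_coords c y u)"
  using force by (simp add: endo_field_def smooth_on_def force_coords_def)

text \<open>Both sides of the equation are tangent vectors, so one chart decides whether they agree.\<close>

lemma magnetic_equation_coords:
  assumes U: "open U" "t \<in> U" "\<And>s. s \<in> U \<Longrightarrow> \<gamma> s \<in> fst c" and c: "c \<in> A"
    and x: "\<And>s. s \<in> U \<Longrightarrow> ((\<lambda>s. snd c (\<gamma> s)) has_vector_derivative u s) (at s)"
    and u: "(u has_vector_derivative w) (at t)"
  shows "cov_along A g \<gamma> (velocity A \<gamma>) t = F (\<gamma> t) (velocity A \<gamma> t) \<longleftrightarrow>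
    w + christoffel A g c (snd c (\<gamma> t)) (u t) (u t) = force_coords c (snd c (\<gamma> t)) (u t)"
proof -
  have ct: "c \<in> charts_at A (\<gamma> t)" using U c by (simp add: charts_at_def)
  have "cov_along A g \<gamma> (velocity A \<gamma>) t =
      of_coords A c (\<gamma> t) (w + christoffel A g c (snd c (\<gamma> t)) (u t) (u t))"
    by (rule cov_along_velocity[OF assms])
  moreover have "velocity A \<gamma> t = of_coords A c (\<gamma> t) (u t)"
    by (rule velocity_of_coords[OF U ct x[OF U(2)]])
  ultimately show ?thesis
    by (simp add: force_of_coords[OF ct] of_coords_inject[OF ct])
qed

text \<open>The second order equation as a vector field on position and velocity.\<close>

definition spray :: "('a, 'e) chart \<Rightarrow> 'e \<times> 'e \<Rightarrow> 'e \<times> 'e" where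
  "spray c z = (snd z, force_coords c (fst z) (snd z) - christoffel A g c (fst z) (snd z) (snd z))"

lemma spray_lipschitz_near:
  assumes c: "c \<in> A" "fst z \<in> chart_range c"
  shows "lipschitz_near (spray c) z"
proof -
  let ?S = "chart_range c \<times> UNIV"
  have S: "open ?S" "z \<in> ?S"
    using c chart_range_open[OF c(1)] by (auto intro: open_Times simp: mem_Times_iff)
  have f: "lipschitz_near fst z" and s: "lipschitz_near snd z"
    by (rule bounded_linear.lipschitz_near_linear, simp add: bounded_linear_fst bounded_linear_snd)+
  have 1: "lipschitz_near (\<lambda>z. force_coords c (fst z) u) z" for u
    by (rule lipschitz_near_compose[OF Ck_on_lipschitz_near[OF force_coords_smooth[OF c(1)] chart_range_open[OF c(1)] c(2)] f])
  have 2: "lipschitz_near (\<lambda>z. christoffel A g c (fst z) u v) z" for u v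
    by (rule lipschitz_near_compose[OF christoffel_lipschitz_near[OF c] f])
  have 3: "lipschitz_near (\<lambda>z. force_coords c (fst z) (snd z)) z"
    by (rule lipschitz_near_linear_family[OF S _ 1 s]) (use force_coords_linear[OF c(1)] in auto)
  have 4: "lipschitz_near (\<lambda>z. christoffel A g c (fst z) u (snd z)) z" for u
    by (rule lipschitz_near_linear_family[OF S _ 2 s]) (use christoffel_bilinear(2)[OF c(1)] in auto)
  have 5: "lipschitz_near (\<lambda>z. christoffel A g c (fst z) (snd z) (snd z)) z"
    by (rule lipschitz_near_linear_family[OF S _ 4 s]) (use christoffel_bilinear(1)[OF c(1)] in auto)
  show ?thesis unfolding spray_def by (intro lipschitz_near_Pair s lipschitz_near_diff 3 5)
qed

text \<open>The integral curve of the spray in one chart, as long as its position stays in the range of the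
chart.\<close>

lemma magnetic_geodesic_exists:
  assumes p: "p \<in> points A" and v: "v \<in> tangent_space A p"
  shows "\<exists>I \<gamma>. magnetic_geodesic X A g F I \<gamma> \<and> 0 \<in> I \<and> \<gamma> 0 = p \<and> velocity A \<gamma> 0 = v"
proof -
  define c where "c = chart_at A p"
  have cp: "c \<in> charts_at A p" unfolding c_def by (rule points_chart[OF p])
  then have c: "c \<in> A" "p \<in> fst c" using charts_atD by blast+
  have "lipschitz_near (spray c) (snd c p, v c)"
    by (rule spray_lipschitz_near) (use c chart_range_mem[OF c(2)] in auto)
  from picard_local_existence[OF this] obtain \<delta> \<phi> where \<delta>: "\<delta> > 0" and \<phi>0: "\<phi> 0 = (snd c p, v c)"
    and \<phi>: "\<And>t. t \<in> {-\<delta><..<\<delta>} \<Longrightarrow> (\<phi> has_vector_derivative spray c (\<phi> t)) (at t)" by blast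
  define x where "x t = fst (\<phi> t)" for t
  define u where "u t = snd (\<phi> t)" for t
  define w where "w t = force_coords c (x t) (u t) - christoffel A g c (x t) (u t) (u t)" for t
  have spl: "spray c (\<phi> t) = (u t, w t)" for t by (simp add: spray_def x_def u_def w_def)
  have dx: "(x has_vector_derivative u t) (at t)" and du: "(u has_vector_derivative w t) (at t)"
    if "t \<in> {-\<delta><..<\<delta>}" for t
    using has_derivative_fst[OF \<phi>[OF that, unfolded has_vector_derivative_def]]
      has_derivative_snd[OF \<phi>[OF that, unfolded has_vector_derivative_def]]
    unfolding x_def u_def has_vector_derivative_def spl by (simp_all add: u_def[symmetric])
  have xc0: "continuous_on {-\<delta><..<\<delta>} x"
    using dx by (intro continuous_at_imp_continuous_on ballI) (blast intro: has_vector_derivative_continuous)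
  have "open ({-\<delta><..<\<delta>} \<inter> x -` chart_range c)"
    by (rule continuous_open_preimage[OF xc0 _ chart_range_open[OF c(1)]]) simp
  moreover have "0 \<in> {-\<delta><..<\<delta>} \<inter> x -` chart_range c"
    using \<delta> chart_range_mem[OF c(2)] by (simp add: x_def \<phi>0)
  ultimately obtain r where r: "r > 0" "ball 0 r \<subseteq> {-\<delta><..<\<delta>} \<inter> x -` chart_range c"
    using open_contains_ball by blast
  define I where "I = ball (0::real) r"
  define \<gamma> where "\<gamma> t = chart_inv c (x t)" for t
  have I: "open I" "0 \<in> I" "is_interval I"
    using r by (auto simp: I_def is_interval_ball_real)
  have xr: "x t \<in> chart_range c" and tI: "t \<in> {-\<delta><..<\<delta>}" if "t \<in> I" for t using r that by (auto simp: I_def)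
  have \<gamma>c: "\<gamma> t \<in> fst c" and \<gamma>x: "snd c (\<gamma> t) = x t" if "t \<in> I" for t
    using chart_inv_mem[OF xr[OF that]] chart_inv_right[OF xr[OF that]] by (auto simp: \<gamma>_def)
  have xc: "continuous_on I x" using xc0 tI continuous_on_subset by blast
  have d\<gamma>: "((\<lambda>s. snd c (\<gamma> s)) has_vector_derivative u t) (at t)" if "t \<in> I" for t
    by (rule has_vector_derivative_transform_within_open[OF dx[OF tI[OF that]] I(1) that]) (simp add: \<gamma>x)
  have uc: "continuous_on I u"
    using du tI by (intro continuous_at_imp_continuous_on ballI) (blast intro: has_vector_derivative_continuous)
  have wc: "continuous_on I w"
  proof -
    have "isCont w t" if t: "t \<in> I" for t
    proof -
      have "continuous (at (x t, u t)) (spray c)"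
      proof -
        obtain q L where q: "q > 0" "L-lipschitz_on (ball (x t, u t) q) (spray c)"
          using spray_lipschitz_near[of c "(x t, u t)"] c(1) xr[OF t] unfolding lipschitz_near_def by auto
        then show ?thesis
          using lipschitz_on_continuous_on continuous_on_eq_continuous_at[OF open_ball] by (metis centre_in_ball)
      qed
      moreover have "isCont (\<lambda>t. (x t, u t)) t"
        using xc uc t continuous_on_eq_continuous_at[OF I(1)] by (auto intro: continuous_Pair)
      ultimately have "isCont (\<lambda>t. spray c (x t, u t)) t" by (rule isCont_o2[rotated])
      then have "isCont (\<lambda>t. snd (spray c (x t, u t))) t" by (rule continuous_snd)
      then show ?thesis unfolding spray_def w_def[abs_def] by simp
    qed
    then show ?thesis by (simp add: continuous_at_imp_continuous_on)
  qed
  have x2: "Ck_on 2 I x"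
  proof -
    have "Ck_on 1 I u"
      unfolding One_nat_def
      by (rule Ck_on_SucI[OF I(1), of _ "\<lambda>t h. h *\<^sub>R w t"])
        (use du tI wc in \<open>auto simp: has_vector_derivative_def intro!: continuous_intros\<close>)
    then have "Ck_on 1 I (\<lambda>t. h *\<^sub>R u t)" for h :: real
      by (intro Ck_on_scaleR Ck_on_const I(1))
    then have "Ck_on (Suc 1) I x"
      by (rule Ck_on_SucI[OF I(1), of _ "\<lambda>t h. h *\<^sub>R u t", rotated])
        (use dx tI in \<open>simp add: has_vector_derivative_def\<close>)
    then show ?thesis by (simp only: Suc_1)
  qed
  have preimage: "open {t \<in> I. \<gamma> t \<in> V}" if V: "openin X V" for V
  proof -
    have "\<gamma> t \<in> V \<longleftrightarrow> x t \<in> snd c ` (fst c \<inter> V)" if t: "t \<in> I" for t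
    proof
      assume "\<gamma> t \<in> V"
      then show "x t \<in> snd c ` (fst c \<inter> V)" using \<gamma>c[OF t] \<gamma>x[OF t] by force
    next
      assume "x t \<in> snd c ` (fst c \<inter> V)"
      then show "\<gamma> t \<in> V" using chart_inv_left[OF c(1)] by (auto simp: \<gamma>_def)
    qed
    then have "{t \<in> I. \<gamma> t \<in> V} = I \<inter> x -` (snd c ` (fst c \<inter> V))" by blast
    then show ?thesis
      using continuous_open_preimage[OF xc I(1) chart_open_image[OF c(1) V]] by simp
  qed
  have "magnetic_geodesic X A g F I \<gamma>"
    unfolding magnetic_geodesic_def C2_curve_def
  proof (intro conjI ballI)
    show "open I" "is_interval I" by (fact I)+
    have "\<gamma> t \<in> topspace X" if "t \<in> I" for t
      using \<gamma>c[OF that] openin_subset[OF chart_homeo(2)[OF c(1)]] by blast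
    then show "continuous_map (top_of_set I) X \<gamma>"
      unfolding continuous_map_def using preimage by (auto simp: openin_open_eq I(1))
    show "cov_along A g \<gamma> (velocity A \<gamma>) t = F (\<gamma> t) (velocity A \<gamma> t)" if t: "t \<in> I" for t
      by (rule iffD2[OF magnetic_equation_coords[OF I(1) t \<gamma>c c(1) d\<gamma> du[OF tI[OF t]]]])
        (simp_all add: w_def \<gamma>x[OF t])
    fix d assume d: "d \<in> A"
    let ?T = "{t \<in> I. \<gamma> t \<in> fst d}"
    have T: "open ?T" by (rule preimage[OF chart_homeo(2)[OF d]])
    have "Ck_on 2 ?T (\<lambda>t. transition c d (x t))"
    proof (rule Ck_on_compose[OF T overlap_open[OF c(1) d] _ transition_smooth[OF c(1) d]])
      show "x ` ?T \<subseteq> snd c ` (fst c \<inter> fst d)" using \<gamma>c \<gamma>x by force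
      show "Ck_on 2 ?T x" by (rule Ck_on_subset[OF x2]) auto
    qed
    then show "Ck_on 2 ?T (\<lambda>t. snd d (\<gamma> t))" by (simp add: \<gamma>_def)
  qed
  moreover have \<gamma>0: "\<gamma> 0 = p" using chart_inv_left[OF c] by (simp add: \<gamma>_def x_def \<phi>0)
  moreover have "velocity A \<gamma> 0 = v"
    using velocity_of_coords[OF I(1,2) \<gamma>c _ d\<gamma>[OF I(2)]] cp \<gamma>0 of_coords_component[OF v cp]
    by (simp add: u_def \<phi>0)
  ultimately show ?thesis using I(2) by blast
qed

end

section \<open>Both sides of the equation in a chart\<close>

context magnetic
begin

text \<open>The covariant derivative in a chart. Writing the replaced argument first instead of leaving it in
its place makes no difference for symmetric tensors and turns the correction into a \<open>slot_sum\<close>.\<close>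

definition cov_coords :: "('a, 'e) tensor \<Rightarrow> ('a, 'e) chart \<Rightarrow> 'e \<Rightarrow> 'e \<Rightarrow> 'e list \<Rightarrow> real" where
  "cov_coords K c y v us = deriv_at (\<lambda>z. tensor_coords A K c z us) y v -
     slot_sum (\<lambda>w r. tensor_coords A K c y (christoffel A g c y v w # r)) us"

lemma cov_coords_linear:
  assumes K: "sym_tensor_field A n K" and c: "c \<in> A" "y \<in> chart_range c" and us: "length us = n"
  shows "linear (\<lambda>v. cov_coords K c y v us)"
  unfolding cov_coords_def slot_sum_def
proof (intro linear_compose_sub linear_compose_sum ballI)
  show "linear (deriv_at (\<lambda>z. tensor_coords A K c z us) y)"
    by (rule has_derivative_linear[OF tensor_coords_has_derivative[OF K c us]])
  fix j assume j: "j \<in> {..<length us}"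
  have "linear (\<lambda>z. tensor_coords A K c y (z # take j us @ drop (Suc j) us))"
    by (rule sym_multilinear_linear[OF tensor_coords_multilinear[OF K c]]) (use j us in auto)
  from linear_compose[OF christoffel_bilinear(1)[OF c, of "us ! j"] this]
  show "linear (\<lambda>v. tensor_coords A K c y (christoffel A g c y v (us ! j) # take j us @ drop (Suc j) us))"
    by (simp add: o_def)
qed

lemma cov_coords_multilinear:
  assumes K: "sym_tensor_field A n K" and c: "c \<in> A" "y \<in> chart_range c"
  shows "sym_multilinear n (cov_coords K c y v)"
proof -
  note T = tensor_coords_multilinear[OF K c(1)]
  note D = tensor_coords_has_derivative[OF K c]
  note ro = chart_range_open[OF c(1)]
  have "sym_multilinear n (\<lambda>us. deriv_at (\<lambda>z. tensor_coords A K c z us) y v)"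
    unfolding sym_multilinear_def
  proof (intro conjI allI impI)
    fix us vs :: "'e list" assume *: "length us = n" "mset us = mset vs"
    have "deriv_at (\<lambda>z. tensor_coords A K c z us) y = deriv_at (\<lambda>z. tensor_coords A K c z vs) y"
      by (rule frechet_derivative_cong_open[OF ro c(2)]) (rule sym_multilinear_perm[OF T *])
    then show "deriv_at (\<lambda>z. tensor_coords A K c z us) y v = deriv_at (\<lambda>z. tensor_coords A K c z vs) y v"
      by simp
  next
    fix us :: "'e list" assume *: "Suc (length us) = n"
    show "linear (\<lambda>u. deriv_at (\<lambda>z. tensor_coords A K c z (u # us)) y v)"
      by (rule derivative_of_linear_family[where L = "\<lambda>z u. tensor_coords A K c z (u # us)", OF ro c(2)])
        (use sym_multilinear_linear[OF T *] D * in auto)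
  qed
  moreover have "sym_multilinear n (slot_sum (\<lambda>w r. tensor_coords A K c y (christoffel A g c y v w # r)))"
  proof (cases n)
    case 0
    then show ?thesis by (simp add: sym_multilinear_0)
  next
    case (Suc m)
    have T': "sym_multilinear (Suc m) (tensor_coords A K c y)" using T[OF c(2)] Suc by simp
    show ?thesis unfolding Suc
    proof (rule slot_sum_multilinear)
      show "sym_multilinear m (\<lambda>r. tensor_coords A K c y (christoffel A g c y v w # r))" for w
        by (rule sym_multilinear_Cons[OF T'])
      show "linear (\<lambda>w. tensor_coords A K c y (christoffel A g c y v w # us))" if "length us = m" for us
        using linear_compose[OF christoffel_bilinear(2)[OF c, of v] sym_multilinear_linear[OF T', of us]] that
        by (simp add: o_def)
    qed
  qed
  ultimately show ?thesis
    unfolding cov_coords_def[abs_def] by (rule sym_multilinear_diff)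
qed

lemma cov_tensor_coords:
  assumes K: "sym_tensor_field A n K" and p: "p \<in> points A" and c: "c = chart_at A p" and ws: "length ws = n"
  shows "cov_tensor A g K p u ws = cov_coords K c (snd c p) (u c) (map (\<lambda>w. w c) ws)"
proof -
  have cp: "c \<in> A" "snd c p \<in> chart_range c"
    unfolding c by (rule charts_at_chart[OF points_chart[OF p]])+
  define us where "us = map (\<lambda>w. w c) ws"
  have us: "length us = n" using ws by (simp add: us_def)
  have "tensor_coords A K c (snd c p) (us[j := z]) =
      tensor_coords A K c (snd c p) (z # take j us @ drop (Suc j) us)" if "j < length us" for j z
    by (rule sym_multilinear_perm[OF tensor_coords_multilinear[OF K cp]])
      (use us that in \<open>auto simp: upd_conv_take_nth_drop\<close>)
  then show ?thesis
    unfolding cov_tensor_def cov_coords_def slot_sum_def Let_def c[symmetric] us_def[symmetric] by simp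
qed

text \<open>In a chart the sum over the orthonormal frame collapses: \<open>\<Sum>\<^sub>i g(e\<^sub>i, w) \<nabla>\<^bsub>e\<^sub>i\<^esub>K = \<nabla>\<^sub>w K\<close>, by linearity of \<open>\<nabla>\<close>
in the direction. This also removes the choice of the frame.\<close>

lemma sym_differential_coords:
  assumes K: "sym_tensor_field A n K" and p: "p \<in> points A" and c: "c = chart_at A p"
    and ws: "ws \<in> tvecs A p (Suc n)"
  shows "sym_differential A g K p ws = slot_sum (cov_coords K c (snd c p)) (map (\<lambda>w. w c) ws)"
proof -
  let ?x = "snd c p"
  have cp: "c \<in> charts_at A p" unfolding c by (rule points_chart[OF p])
  then have cr: "c \<in> A" "?x \<in> chart_range c" by (rule charts_at_chart)+
  interpret B: inner_form "metric_coords c ?x" by (rule metric_inner_form[OF cr])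
  define e where "e = (SOME e. orthonormal_frame A g p e)"
  have "\<exists>e. orthonormal_frame A g p e"
  proof -
    obtain b where b: "B.orthonormal DIM('e) b" using B.orthonormal_exists by blast
    have "orthonormal_frame A g p (\<lambda>i. of_coords A c p (b i))"
      unfolding orthonormal_frame_def
      using b of_coords_tangent[OF cp] metric_component[OF cp] of_coords_self[OF cp]
      by (simp add: B.orthonormal_def)
    then show ?thesis by blast
  qed
  then have e: "orthonormal_frame A g p e" unfolding e_def by (rule someI_ex)
  then have et: "e i \<in> tangent_space A p" if "i < DIM('e)" for i
    using that unfolding orthonormal_frame_def by blast
  have eb: "B.orthonormal DIM('e) (\<lambda>i. e i c)"
    using e metric_component[OF cp et et] unfolding orthonormal_frame_def B.orthonormal_def by metis
  have "sym_differential A g K p ws =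
      (\<Sum>i<DIM('e). \<Sum>j<length ws. g p (e i) (ws ! j) * cov_tensor A g K p (e i) (take j ws @ drop (Suc j) ws))"
    unfolding sym_differential_def e_def[symmetric] Let_def sym_mult_def ..
  also have "\<dots> = slot_sum (\<lambda>w r. \<Sum>i<DIM('e). g p (e i) w * cov_tensor A g K p (e i) r) ws"
    unfolding slot_sum_def by (rule sum.swap)
  also have "\<dots> = slot_sum (\<lambda>w r. cov_coords K c ?x (w c) (map (\<lambda>w. w c) r)) ws"
  proof (rule slot_sum_cong)
    fix w and r :: "('a, 'e) tvec list"
    assume "w \<in> set ws" and r: "Suc (length r) = length ws"
    then have w: "w \<in> tangent_space A p" and r: "length r = n" using ws by (auto simp: tvecs_def)
    let ?h = "\<lambda>v. cov_coords K c ?x v (map (\<lambda>w. w c) r)"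
    have h: "linear ?h" by (rule cov_coords_linear[OF K cr]) (simp add: r)
    have "(\<Sum>i<DIM('e). g p (e i) w * cov_tensor A g K p (e i) r) =
        (\<Sum>i<DIM('e). metric_coords c ?x (e i c) (w c) * ?h (e i c))"
      using metric_component[OF cp et w] cov_tensor_coords[OF K p c r] by (intro sum.cong) auto
    also have "\<dots> = ?h (\<Sum>i<DIM('e). metric_coords c ?x (e i c) (w c) *\<^sub>R e i c)"
      by (simp add: linear_sum[OF h] linear_scale[OF h])
    also have "\<dots> = ?h (w c)" by (simp only: B.orthonormal_expansion[OF eb])
    finally show "(\<Sum>i<DIM('e). g p (e i) w * cov_tensor A g K p (e i) r) = ?h (w c)" .
  qed
  also have "\<dots> = slot_sum (cov_coords K c ?x) (map (\<lambda>w. w c) ws)" by (rule slot_sum_map)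
  finally show ?thesis .
qed

text \<open>The negative of the derivation \<open>F\<^sub>*\<close> in a chart.\<close>

definition force_term :: "('a, 'e) tensor \<Rightarrow> ('a, 'e) chart \<Rightarrow> 'e \<Rightarrow> 'e list \<Rightarrow> real" where
  "force_term K c y = slot_sum (\<lambda>w r. tensor_coords A K c y (force_coords c y w # r))"

lemma endo_deriv_coords:
  assumes K: "sym_tensor_field A (Suc n) K" and cp: "c \<in> charts_at A p" and ws: "ws \<in> tvecs A p (Suc n)"
  shows "endo_deriv F K p ws = - force_term K c (snd c p) (map (\<lambda>w. w c) ws)"
proof -
  have p: "p \<in> points A" using charts_atD[OF cp] chart_points by blast
  have sym: "K p ws' = K p vs" if "vs \<in> tvecs A p (Suc n)" "mset ws' = mset vs" for vs ws'
    using K p that unfolding sym_tensor_field_def sym_multilinear_at_def by blast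
  have Ft: "F p w \<in> tangent_space A p" "F p w c = force_coords c (snd c p) (w c)" if "w \<in> tangent_space A p" for w
  proof -
    show "F p w \<in> tangent_space A p" using force p that unfolding endo_field_def by blast
    show "F p w c = force_coords c (snd c p) (w c)"
      using force_of_coords[OF cp, of "w c"] of_coords_component[OF that cp] of_coords_self[OF cp] by metis
  qed
  have "(\<Sum>j<length ws. K p (ws[j := F p (ws ! j)])) = slot_sum (\<lambda>w r. K p (F p w # r)) ws"
    unfolding slot_sum_def
  proof (rule sum.cong[OF refl])
    fix j assume j: "j \<in> {..<length ws}"
    have "F p (ws ! j) \<in> tangent_space A p"
      using ws j by (intro Ft(1)) (auto simp: tvecs_def)
    then have "F p (ws ! j) # take j ws @ drop (Suc j) ws \<in> tvecs A p (Suc n)"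
      using ws j by (auto simp: tvecs_def dest: in_set_takeD in_set_dropD)
    then show "K p (ws[j := F p (ws ! j)]) = K p (F p (ws ! j) # take j ws @ drop (Suc j) ws)"
      by (rule sym) (use j in \<open>simp add: upd_conv_take_nth_drop\<close>)
  qed
  also have "\<dots> = slot_sum (\<lambda>w r. tensor_coords A K c (snd c p)
      (force_coords c (snd c p) (w c) # map (\<lambda>w. w c) r)) ws"
  proof (rule slot_sum_cong)
    fix w r assume "w \<in> set ws" "set r \<subseteq> set ws" "Suc (length r) = length ws"
    then have w: "w \<in> tangent_space A p" and r: "F p w # r \<in> tvecs A p (Suc n)"
      using ws Ft(1) by (auto simp: tvecs_def)
    show "K p (F p w # r) = tensor_coords A K c (snd c p) (force_coords c (snd c p) (w c) # map (\<lambda>w. w c) r)"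
      using tensor_coords_component[OF cp r] Ft(2)[OF w] by simp
  qed
  also have "\<dots> = force_term K c (snd c p) (map (\<lambda>w. w c) ws)"
    unfolding force_term_def
    by (rule slot_sum_map[of "\<lambda>w r. tensor_coords A K c (snd c p) (force_coords c (snd c p) w # r)"])
  finally show ?thesis by (simp add: endo_deriv_def)
qed

lemma force_term_multilinear:
  assumes K: "sym_tensor_field A (Suc n) K" and c: "c \<in> A" "y \<in> chart_range c"
  shows "sym_multilinear (Suc n) (force_term K c y)"
  unfolding force_term_def
proof (rule slot_sum_multilinear)
  have T: "sym_multilinear (Suc n) (tensor_coords A K c y)" by (rule tensor_coords_multilinear[OF K c])
  show "sym_multilinear n (\<lambda>r. tensor_coords A K c y (force_coords c y w # r))" for w
    by (rule sym_multilinear_Cons[OF T])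
  show "linear (\<lambda>w. tensor_coords A K c y (force_coords c y w # us))" if "length us = n" for us
    using linear_compose[OF force_coords_linear[OF c] sym_multilinear_linear[OF T, of us]] that
    by (simp add: o_def)
qed

section \<open>The derivative along a magnetic geodesic\<close>

text \<open>The equation of the curve replaces the second derivative by the force minus the Christoffel term;
the latter completes the derivative of the coefficients to the covariant derivative.\<close>

lemma assoc_fun_derivative_along_geodesic:
  assumes K: "sym_tensor_field A n K" and \<gamma>: "magnetic_geodesic X A g F I \<gamma>" and t: "t \<in> I"
    and c: "c \<in> charts_at A (\<gamma> t)"
  defines "x \<equiv> snd c (\<gamma> t)" and "u \<equiv> velocity A \<gamma> t c"
  shows "((\<lambda>s. assoc_fun n K (\<gamma> s, velocity A \<gamma> s)) has_real_derivative
    (cov_coords K c x u (replicate n u) +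
     n * tensor_coords A K c x (force_coords c x u # replicate (n - 1) u)) / fact n) (at t)"
proof -
  have cA: "c \<in> A" using charts_atD[OF c] by blast
  define U where "U = {s \<in> I. \<gamma> s \<in> fst c}"
  have I: "open I" "continuous_map (top_of_set I) X \<gamma>" and C2: "Ck_on 2 U (\<lambda>s. snd c (\<gamma> s))"
    and eq: "cov_along A g \<gamma> (velocity A \<gamma>) t = F (\<gamma> t) (velocity A \<gamma> t)"
    using \<gamma> t cA unfolding magnetic_geodesic_def C2_curve_def U_def by blast+
  have U: "open U" "t \<in> U" "\<And>s. s \<in> U \<Longrightarrow> \<gamma> s \<in> fst c"
  proof -
    have "openin (top_of_set I) U"
      using openin_continuous_map_preimage[OF I(2) chart_homeo(2)[OF cA]] by (simp add: U_def)
    then show "open U" using I(1) openin_open_trans by blast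
  qed (use t charts_atD[OF c] in \<open>auto simp: U_def\<close>)
  define \<xi> where "\<xi> s = snd c (\<gamma> s)" for s
  define v where "v s = deriv_at \<xi> s 1" for s
  define w where "w = deriv_at v t 1"
  have C2': "Ck_on 2 U \<xi>" using C2 unfolding \<xi>_def[abs_def] .
  have vd: "(f has_vector_derivative deriv_at f s 1) (at s)" if "f differentiable at s" for f :: "real \<Rightarrow> 'e" and s
  proof -
    have d: "(f has_derivative deriv_at f s) (at s)" using that by (rule iffD1[OF frechet_derivative_works])
    have "deriv_at f s = (\<lambda>h. h *\<^sub>R deriv_at f s 1)"
    proof
      show "deriv_at f s h = h *\<^sub>R deriv_at f s 1" for h
        using linear_scale[OF has_derivative_linear[OF d], of h 1] by simp
    qed
    then show ?thesis using d unfolding has_vector_derivative_def by simp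
  qed
  have d\<xi>: "(\<xi> has_vector_derivative v s) (at s)" if "s \<in> U" for s
    unfolding v_def by (rule vd) (use C2' that in \<open>simp add: numeral_2_eq_2\<close>)
  have dv: "(v has_vector_derivative w) (at t)"
    unfolding w_def by (rule vd) (use C2' U(2) in \<open>simp add: numeral_2_eq_2 v_def[abs_def]\<close>)
  have d\<gamma>: "((\<lambda>s. snd c (\<gamma> s)) has_vector_derivative v s) (at s)" if "s \<in> U" for s
    using d\<xi>[OF that] unfolding \<xi>_def[abs_def] .
  have ct: "c \<in> charts_at A (\<gamma> s)" if "s \<in> U" for s using U(3)[OF that] cA by (simp add: charts_at_def)
  have vel: "velocity A \<gamma> s = of_coords A c (\<gamma> s) (v s)" if "s \<in> U" for s
    by (rule velocity_of_coords[OF U(1) that U(3) ct[OF that] d\<gamma>[OF that]])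
  have uv: "u = v t" unfolding u_def vel[OF U(2)] by (rule of_coords_self[OF c])
  have xr: "\<xi> s \<in> chart_range c" if "s \<in> U" for s
    unfolding \<xi>_def by (rule chart_range_mem[OF U(3)[OF that]])
  have x\<xi>: "x = \<xi> t" by (simp add: x_def \<xi>_def)
  have w: "w = force_coords c x u - christoffel A g c x u u"
    using iffD1[OF magnetic_equation_coords[OF U cA d\<gamma> dv] eq] by (simp add: x_def uv algebra_simps)
  let ?T = "tensor_coords A K c"
  have "((\<lambda>s. ?T (\<xi> s) (replicate n (v s))) has_derivative
    (\<lambda>h. deriv_at (\<lambda>y. ?T y (replicate n (v t))) (\<xi> t) (h *\<^sub>R v t) +
       n * ?T (\<xi> t) ((h *\<^sub>R w) # replicate (n - 1) (v t)))) (at t)"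
  proof (rule has_derivative_diagonal[where T = "\<lambda>s. ?T (\<xi> s)" and
        D = "\<lambda>h us. deriv_at (\<lambda>y. ?T y us) (\<xi> t) (h *\<^sub>R v t)", OF U(1,2)])
    show "sym_multilinear n (?T (\<xi> s))" if "s \<in> U" for s
      by (rule tensor_coords_multilinear[OF K cA xr[OF that]])
    show "((\<lambda>s. ?T (\<xi> s) us) has_derivative (\<lambda>h. deriv_at (\<lambda>y. ?T y us) (\<xi> t) (h *\<^sub>R v t))) (at t)"
      if "length us = n" for us
      by (rule has_derivative_compose[OF d\<xi>[OF U(2), unfolded has_vector_derivative_def]
            tensor_coords_has_derivative[OF K cA xr[OF U(2)] that]])
    show "(v has_derivative (\<lambda>h. h *\<^sub>R w)) (at t)" using dv unfolding has_vector_derivative_def .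
  qed
  moreover have "(\<lambda>h. deriv_at (\<lambda>y. ?T y (replicate n (v t))) (\<xi> t) (h *\<^sub>R v t) +
       n * ?T (\<xi> t) ((h *\<^sub>R w) # replicate (n - 1) (v t))) =
     (*) (deriv_at (\<lambda>y. ?T y (replicate n u)) x u + n * ?T x (w # replicate (n - 1) u))"
  proof
    fix h :: real
    have l: "linear (deriv_at (\<lambda>y. ?T y (replicate n u)) x)"
      unfolding x\<xi> by (rule has_derivative_linear[OF tensor_coords_has_derivative[OF K cA xr[OF U(2)]]]) simp
    have "n * ?T x ((h *\<^sub>R w) # replicate (n - 1) u) = h * (n * ?T x (w # replicate (n - 1) u))"
    proof (cases n)
      case (Suc m)
      have "linear (\<lambda>z. ?T x (z # replicate m u))"
        unfolding x\<xi> by (rule sym_multilinear_linear[OF tensor_coords_multilinear[OF K cA xr[OF U(2)]]]) (simp add: Suc)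
      from linear_scale[OF this, of h w] show ?thesis by (simp add: Suc)
    qed simp
    then show "deriv_at (\<lambda>y. ?T y (replicate n (v t))) (\<xi> t) (h *\<^sub>R v t) +
       n * ?T (\<xi> t) ((h *\<^sub>R w) # replicate (n - 1) (v t)) =
      (deriv_at (\<lambda>y. ?T y (replicate n u)) x u + n * ?T x (w # replicate (n - 1) u)) * h"
      unfolding uv[symmetric] x\<xi>[symmetric] by (simp add: linear_scale[OF l] algebra_simps)
  qed
  ultimately have d1: "((\<lambda>s. ?T (\<xi> s) (replicate n (v s))) has_real_derivative
    deriv_at (\<lambda>y. ?T y (replicate n u)) x u + n * ?T x (w # replicate (n - 1) u)) (at t)"
    unfolding has_field_derivative_def by simp
  have d2: "deriv_at (\<lambda>y. ?T y (replicate n u)) x u + n * ?T x (w # replicate (n - 1) u) =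
     cov_coords K c x u (replicate n u) + n * ?T x (force_coords c x u # replicate (n - 1) u)"
  proof (cases n)
    case 0
    then show ?thesis by (simp add: cov_coords_def slot_sum_def)
  next
    case (Suc m)
    have l: "linear (\<lambda>z. ?T x (z # replicate m u))"
      by (rule sym_multilinear_linear[OF tensor_coords_multilinear[OF K cA]]) (simp_all add: x\<xi> xr[OF U(2)] Suc)
    show ?thesis
      unfolding cov_coords_def Suc slot_sum_replicate w
      by (simp add: linear_diff[OF l] algebra_simps del: replicate_Suc of_nat_Suc)
  qed
  have "((\<lambda>s. ?T (\<xi> s) (replicate n (v s)) / fact n) has_real_derivative
    (cov_coords K c x u (replicate n u) + n * ?T x (force_coords c x u # replicate (n - 1) u)) / fact n) (at t)"
    using DERIV_cdivide[OF d1] unfolding d2 .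
  then show ?thesis
    by (rule has_field_derivative_transform_within_open[OF _ U(1,2)])
      (simp add: vel assoc_fun_coords[OF ct] \<xi>_def)
qed

text \<open>In a chart, \<open>d\<^sup>sK - F\<^sub>*K'\<close>; the sign of \<open>force_term\<close> turns the difference into a sum.\<close>

definition killing_defect ::
    "('a, 'e) tensor \<Rightarrow> ('a, 'e) tensor \<Rightarrow> ('a, 'e) chart \<Rightarrow> 'e \<Rightarrow> 'e list \<Rightarrow> real" where
  "killing_defect K K' c y us = slot_sum (cov_coords K c y) us + force_term K' c y us"

text \<open>The chart is the one in which \<open>cov_tensor\<close> evaluates the covariant derivative at \<open>p\<close>.\<close>

lemma killing_defect_eq:
  assumes K: "sym_tensor_field A n K" and K': "sym_tensor_field A (Suc n) K'"
    and p: "p \<in> points A" and ws: "ws \<in> tvecs A p (Suc n)" and c: "c = chart_at A p"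
  shows "killing_defect K K' c (snd c p) (map (\<lambda>w. w c) ws) =
    sym_differential A g K p ws - endo_deriv F K' p ws"
  using sym_differential_coords[OF K p c ws] endo_deriv_coords[OF K' points_chart[OF p] ws]
  by (simp add: killing_defect_def c)

lemma killing_defect_multilinear:
  assumes K: "sym_tensor_field A n K" and K': "sym_tensor_field A (Suc n) K'"
    and c: "c \<in> A" "y \<in> chart_range c"
  shows "sym_multilinear (Suc n) (killing_defect K K' c y)"
  unfolding killing_defect_def[abs_def]
  by (intro sym_multilinear_add slot_sum_multilinear cov_coords_multilinear[OF K c]
      cov_coords_linear[OF K c] force_term_multilinear[OF K' c])

lemma killing_defect_diagonal:
  "killing_defect K K' c y (replicate (Suc n) u) =
     Suc n * (cov_coords K c y u (replicate n u) + tensor_coords A K' c y (force_coords c y u # replicate n u))"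
  by (simp only: killing_defect_def force_term_def slot_sum_replicate distrib_left)

text \<open>The force term of \<open>K\<^bsub>i+1\<^esub>\<close> is combined with the covariant derivative of \<open>K\<^sub>i\<close>, since both have
degree \<open>i + 1\<close> in the velocity. No term is left over: degree 0 carries no force term, and
the force term of degree \<open>l + 1\<close> vanishes.\<close>

lemma derivative_along_geodesic:
  fixes K :: "nat \<Rightarrow> ('a, 'e) tensor"
  assumes K: "\<And>i. i \<le> l \<Longrightarrow> sym_tensor_field A i (K i)" and top: "K (Suc l) = (\<lambda>p vs. 0)"
    and \<gamma>: "magnetic_geodesic X A g F I \<gamma>" and t: "t \<in> I" and c: "c \<in> charts_at A (\<gamma> t)"
  shows "((\<lambda>s. \<Sum>i\<le>l. assoc_fun i (K i) (\<gamma> s, velocity A \<gamma> s)) has_real_derivative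
    (\<Sum>i\<le>l. killing_defect (K i) (K (Suc i)) c (snd c (\<gamma> t)) (replicate (Suc i) (velocity A \<gamma> t c)) / fact (Suc i))) (at t)"
proof -
  define x where "x = snd c (\<gamma> t)"
  define u where "u = velocity A \<gamma> t c"
  \<comment> \<open>Since a 0 = 0, and a (Suc l) = 0 by the convention for K (Suc l), the sum of a may be shifted by one.\<close>
  define a where "a j = j * tensor_coords A (K j) c x (force_coords c x u # replicate (j - 1) u) / fact j" for j
  have "((\<lambda>s. \<Sum>i\<le>l. assoc_fun i (K i) (\<gamma> s, velocity A \<gamma> s)) has_real_derivative
    (\<Sum>i\<le>l. (cov_coords (K i) c x u (replicate i u) +
     i * tensor_coords A (K i) c x (force_coords c x u # replicate (i - 1) u)) / fact i)) (at t)"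
    unfolding x_def u_def by (intro DERIV_sum assoc_fun_derivative_along_geodesic[OF K \<gamma> t c]) simp
  also have "(\<Sum>i\<le>l. (cov_coords (K i) c x u (replicate i u) +
     i * tensor_coords A (K i) c x (force_coords c x u # replicate (i - 1) u)) / fact i) =
     (\<Sum>i\<le>l. cov_coords (K i) c x u (replicate i u) / fact i) + (\<Sum>j\<le>l. a j)"
    by (simp add: a_def add_divide_distrib sum.distrib)
  also have "(\<Sum>j\<le>l. a j) = (\<Sum>j\<le>Suc l. a j)"
    by (simp add: a_def top tensor_coords_def)
  also have "\<dots> = (\<Sum>i\<le>l. a (Suc i))"
    by (subst sum.atMost_Suc_shift) (simp add: a_def)
  also have "(\<Sum>i\<le>l. cov_coords (K i) c x u (replicate i u) / fact i) + (\<Sum>i\<le>l. a (Suc i)) =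
    (\<Sum>i\<le>l. killing_defect (K i) (K (Suc i)) c x (replicate (Suc i) u) / fact (Suc i))"
    unfolding sum.distrib[symmetric]
  proof (rule sum.cong[OF refl])
    fix i
    have f: "fact (Suc i) = real (Suc i) * fact i" by simp
    show "cov_coords (K i) c x u (replicate i u) / fact i + a (Suc i) =
      killing_defect (K i) (K (Suc i)) c x (replicate (Suc i) u) / fact (Suc i)"
      unfolding killing_defect_diagonal a_def f by (simp add: add_divide_distrib del: of_nat_Suc)
  qed
  finally show ?thesis unfolding x_def u_def .
qed

lemma magnetic_geodesic_points:
  assumes \<gamma>: "magnetic_geodesic X A g F I \<gamma>" and t: "t \<in> I"
  shows "\<gamma> t \<in> points A"
proof -
  have "continuous_map (top_of_set I) X \<gamma>"
    using \<gamma> unfolding magnetic_geodesic_def C2_curve_def by blast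
  then have "\<gamma> t \<in> topspace X" using t by (auto simp: continuous_map_def)
  then show ?thesis using mfd by (simp add: smooth_manifold_def)
qed

end

section \<open>First integrals and the Killing-type equations\<close>

theorem proposition2p7:
  fixes X :: "'a topology" and A :: "('a, 'e::euclidean_space) chart set"
    and g :: "('a, 'e) bilin_field" and F :: "('a, 'e) endo_field"
    and K :: "nat \<Rightarrow> ('a, 'e) tensor" and l :: nat
  assumes "riemannian_manifold X A g"
    and "lorentz_force A g F"
    and "\<And>i. i \<le> l \<Longrightarrow> sym_tensor_field A i (K i)"
    and "K (Suc l) = (\<lambda>p vs. 0)"
  shows "first_integral X A g F (\<lambda>\<xi>. \<Sum>i\<le>l. assoc_fun i (K i) \<xi>) \<longleftrightarrow>
    (\<forall>i\<le>l. tensor_eq A (Suc i) (sym_differential A g (K i)) (endo_deriv F (K (Suc i))))"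
proof -
  interpret magnetic X A g F
    using assms(1,2) by unfold_locales (auto simp: riemannian_manifold_def lorentz_force_def)
  note K = assms(3) and top = assms(4)
  have K': "sym_tensor_field A (Suc i) (K (Suc i))" if "i \<le> l" for i
    using K[of "Suc i"] zero_tensor_field top that by (cases "i = l") auto
  let ?\<phi> = "\<lambda>\<xi>. \<Sum>i\<le>l. assoc_fun i (K i) \<xi>"
  let ?E = "\<lambda>i c. killing_defect (K i) (K (Suc i)) c"
  show ?thesis
  proof
    assume int: "first_integral X A g F ?\<phi>"
    show "\<forall>i\<le>l. tensor_eq A (Suc i) (sym_differential A g (K i)) (endo_deriv F (K (Suc i)))"
      unfolding tensor_eq_def
    proof (intro allI impI ballI)
      fix i p ws assume i: "i \<le> l" and p: "p \<in> points A" and ws: "ws \<in> tvecs A p (Suc i)"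
      define c where "c = chart_at A p"
      have cp: "c \<in> charts_at A p" unfolding c_def by (rule points_chart[OF p])
      have "?E i c (snd c p) (map (\<lambda>w. w c) ws) = 0"
      proof (rule graded_polarization[where E = "\<lambda>i. ?E i c (snd c p)" and c = "\<lambda>i. fact (Suc i)", OF _ _ _ i])
        show "sym_multilinear (Suc i) (?E i c (snd c p))" if "i \<le> l" for i
          by (rule killing_defect_multilinear[OF K[OF that] K'[OF that] charts_at_chart[OF cp]])
        show "length (map (\<lambda>w. w c) ws) = Suc i" using ws by (simp add: tvecs_def)
        fix u
        obtain I \<gamma> where \<gamma>: "magnetic_geodesic X A g F I \<gamma>" "0 \<in> I" "\<gamma> 0 = p" "velocity A \<gamma> 0 = of_coords A c p u"
          using magnetic_geodesic_exists[OF p of_coords_tangent[OF cp]] by blast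
        have I: "open I" using \<gamma>(1) unfolding magnetic_geodesic_def C2_curve_def by blast
        have "((\<lambda>s. ?\<phi> (\<gamma> s, velocity A \<gamma> s)) has_real_derivative
          (\<Sum>i\<le>l. ?E i c (snd c p) (replicate (Suc i) u) / fact (Suc i))) (at 0)"
          using derivative_along_geodesic[OF K top \<gamma>(1,2), of c] cp \<gamma>(3,4) of_coords_self[OF cp]
          by (simp del: replicate_Suc fact_Suc)
        moreover obtain y where "\<And>s. s \<in> I \<Longrightarrow> ?\<phi> (\<gamma> s, velocity A \<gamma> s) = y"
          using int \<gamma>(1) unfolding first_integral_def constant_on_def by blast
        then have "((\<lambda>s. ?\<phi> (\<gamma> s, velocity A \<gamma> s)) has_real_derivative 0) (at 0)"
          by (intro has_field_derivative_transform_within_open[OF DERIV_const I \<gamma>(2)]) simp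
        ultimately show "(\<Sum>i\<le>l. ?E i c (snd c p) (replicate (Suc i) u) / fact (Suc i)) = 0"
          by (rule DERIV_unique)
      qed simp
      then show "sym_differential A g (K i) p ws = endo_deriv F (K (Suc i)) p ws"
        using killing_defect_eq[OF K[OF i] K'[OF i] p ws c_def] by simp
    qed
  next
    assume eq: "\<forall>i\<le>l. tensor_eq A (Suc i) (sym_differential A g (K i)) (endo_deriv F (K (Suc i)))"
    show "first_integral X A g F ?\<phi>"
      unfolding first_integral_def
    proof (intro conjI allI impI)
      show "differentiable_on_TM A ?\<phi>" by (rule sum_assoc_fun_differentiable[OF K])
      fix I \<gamma> assume \<gamma>: "magnetic_geodesic X A g F I \<gamma>"
      have "((\<lambda>s. ?\<phi> (\<gamma> s, velocity A \<gamma> s)) has_real_derivative 0) (at t within I)" if t: "t \<in> I" for t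
      proof -
        define p where "p = \<gamma> t"
        have p: "p \<in> points A" unfolding p_def by (rule magnetic_geodesic_points[OF \<gamma> t])
        define c where "c = chart_at A p"
        have cp: "c \<in> charts_at A p" unfolding c_def by (rule points_chart[OF p])
        define u where "u = velocity A \<gamma> t c"
        have "?E i c (snd c p) (replicate (Suc i) u) = 0" if i: "i \<le> l" for i
        proof -
          let ?ws = "map (of_coords A c p) (replicate (Suc i) u)"
          have ws: "?ws \<in> tvecs A p (Suc i)"
            using map_of_coords_tvecs[OF cp, of "replicate (Suc i) u"] by simp
          have "map (\<lambda>w. w c) ?ws = replicate (Suc i) u" by (simp add: of_coords_self[OF cp])
          then show ?thesis
            using killing_defect_eq[OF K[OF i] K'[OF i] p ws c_def] eq i p ws
            unfolding tensor_eq_def by (metis eq_iff_diff_eq_0)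
        qed
        then have "(\<Sum>i\<le>l. ?E i c (snd c p) (replicate (Suc i) u) / fact (Suc i)) = 0"
          by (intro sum.neutral) (simp del: replicate_Suc)
        then have "((\<lambda>s. ?\<phi> (\<gamma> s, velocity A \<gamma> s)) has_real_derivative 0) (at t)"
          using derivative_along_geodesic[OF K top \<gamma> t cp[unfolded p_def]] unfolding p_def u_def by simp
        then show ?thesis by (rule has_field_derivative_at_within)
      qed
      moreover have "convex I"
        using \<gamma> unfolding magnetic_geodesic_def C2_curve_def by (simp add: is_interval_convex)
      ultimately show "(\<lambda>t. ?\<phi> (\<gamma> t, velocity A \<gamma> t)) constant_on I"
        using has_field_derivative_zero_constant unfolding constant_on_def by blast
    qed
  qed
qed

end
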